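(* Let $\Sigma^m$, $m\le 2n$, be a submanifold of $N^n(c)\times\mathbb{R}$, where $N^n(c)$ is a complex space form. If $V$ is a normal vector field parallel in the normal bundle, with $\operatorname{trace} A_V$ constant, then $$\begin{aligned} \frac{1}{2}\Delta|A_V|^2=&\;|\nabla A_V|^2+\frac{c}{4}\Big\{m|A_V|^2-2m|A_VT|^2+6|tA_V|^2-|T|^2|A_V|^2+3(\operatorname{trace} A_V)\langle A_VT,T\rangle\\ &+6\operatorname{trace}(A_V(tA_{nV}))+3\operatorname{trace}(A_VA_{n(tV)})-(\operatorname{trace} A_V)^2+6\operatorname{trace}(A_V(t(A_Vt)))\\ &+3\operatorname{trace}(\langle t(\sigma(A_V\cdot,tV)),\cdot\rangle)-3\operatorname{trace}(\langle t(\sigma(A_V(tV),\cdot)),\cdot\rangle)\\ &+m\langle V,N\rangle(\operatorname{trace}(A_VA_N)-(\operatorname{trace} A_V)\langle H,N\rangle)+3m\langle A_V(tH),tV\rangle\Big\}\\ &+\sum_{\alpha=m+1}^{2n+1}\Big\{\operatorname{trace}(A_VA_{\alpha}A_VA_{\alpha}-A_V^2A_{\alpha}^2)+\operatorname{trace}(A_{\alpha})\operatorname{trace}(A_V^2A_{\alpha})-(\operatorname{trace}(A_VA_{\alpha}))^2\Big\}, \end{aligned}$$ where $\{E_{\alpha}\}_{\alpha=m+1}^{2n+1}$ is a local orthonormal frame field in the normal bundle and $A_\alpha=A_{E_\alpha}$.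
   Context: $N^n(c)$ is a complex space form of complex dimension $n$, complex structure $J$ and constant holomorphic sectional curvature $c$. On $N^n(c)\times\mathbb{R}$ with the product metric $\langle,\rangle$, put $\varphi=J\circ d\pi$, where $\pi:N^n(c)\times\mathbb{R}\to N^n(c)$ is the projection (the value being regarded as a vector tangent to the product), $\xi=\partial/\partial t$, $\eta=dt$. The curvature tensor is $$\begin{aligned}\tilde R(X,Y)Z=\tfrac{c}{4}\{&\langle Y,Z\rangle X-\langle X,Z\rangle Y+\langle X,\varphi Z\rangle \varphi Y-\langle Y,\varphi Z\rangle\varphi X+2\langle X,\varphi Y\rangle\varphi Z\\&+\eta(X)\eta(Z)Y-\eta(Y)\eta(Z)X+\langle X,Z\rangle\eta(Y)\xi-\langle Y,Z\rangle\eta(X)\xi\},\end{aligned}$$ with the convention $\tilde R(X,Y)Z=[\tilde\nabla_X,\tilde\nabla_Y]Z-\tilde\nabla_{[X,Y]}Z$. For a submanifold $\Sigma^m$: $\nabla$ is its Levi-Civita connection, $\sigma$ its second fundamental form ($\tilde\nabla_XY=\nabla_XY+\sigma(X,Y)$), $H=\frac1m\operatorname{trace}\sigma$ its mean curvature vector field, and $A_V$ the shape operator in the normal direction $V$, $\tilde\nabla_XV=-A_VX+\nabla^\perp_XV$; $V$ is parallel in the normal bundle if $\nabla^\perp V=0$. $\Delta=\operatorname{trace}\nabla^2$ is the Laplacian. Along $\Sigma$, $\xi=T+N$ with $T$ tangent and $N$ normal; for any vector $W$ (tangent or normal to $\Sigma$), $\varphi W=tW+nW$ with $tW$ tangent and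 $nW$ normal. $tA_V$ is the endomorphism $X\mapsto t(A_VX)$, $A_Vt$ is $X\mapsto A_V(tX)$, and so on. Norms of endomorphisms are $|B|^2=\sum_i|BE_i|^2$, and traces of bilinear expressions are over a local orthonormal tangent frame $\{E_i\}_{i=1}^m$, e.g. $\operatorname{trace}(\langle t(\sigma(A_V\cdot,tV)),\cdot\rangle)=\sum_{i=1}^m\langle t(\sigma(A_VE_i,tV)),E_i\rangle$. *)

theory Defs
  imports "HOL-Analysis.Analysis"
begin

section \<open>Smoothness and manifolds\<close>

abbreviation dd :: "('v::real_normed_vector \<Rightarrow> 'w::real_normed_vector) \<Rightarrow> 'v \<Rightarrow> 'v \<Rightarrow> 'w"
  where "dd f x u \<equiv> frechet_derivative f (at x) u"

text \<open>The next two notions are only used for open \<open>S\<close> in a Euclidean space, where they are the usual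
  classes of k times continuously differentiable and of smooth functions.\<close>

primrec Ck_on :: "nat \<Rightarrow> ('v::real_normed_vector \<Rightarrow> 'w::real_normed_vector) \<Rightarrow> 'v set \<Rightarrow> bool"
  where
    "Ck_on 0 f S \<longleftrightarrow> continuous_on S f"
  | "Ck_on (Suc k) f S \<longleftrightarrow>
       (\<forall>x\<in>S. f differentiable (at x)) \<and> (\<forall>v. Ck_on k (\<lambda>x. dd f x v) S)"

definition smooth_on :: "'v set \<Rightarrow> ('v::real_normed_vector \<Rightarrow> 'w::real_normed_vector) \<Rightarrow> bool"
  where "smooth_on S f \<longleftrightarrow> (\<forall>k. Ck_on k f S)"

text \<open>A chart is a pair of its domain and its coordinate map; the values of the map outside the
  domain are irrelevant. The manifold is the whole type \<open>'a\<close>.\<close>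

type_synonym ('a, 'v) chart = "'a set \<times> ('a \<Rightarrow> 'v)"

abbreviation chart_dom :: "('a, 'v) chart \<Rightarrow> 'a set" where "chart_dom c \<equiv> fst c"
abbreviation chart_map :: "('a, 'v) chart \<Rightarrow> 'a \<Rightarrow> 'v" where "chart_map c \<equiv> snd c"
abbreviation chart_img :: "('a, 'v) chart \<Rightarrow> 'v set" where "chart_img c \<equiv> chart_map c ` chart_dom c"

definition chart_inv :: "('a, 'v) chart \<Rightarrow> 'v \<Rightarrow> 'a"
  where "chart_inv c = inv_into (chart_dom c) (chart_map c)"

definition transition :: "('a, 'v) chart \<Rightarrow> ('a, 'v) chart \<Rightarrow> 'v \<Rightarrow> 'v"
  where "transition c c' = chart_map c' \<circ> chart_inv c"

definition smooth_manifold ::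
    "('a::{t2_space,second_countable_topology}, 'v::euclidean_space) chart set \<Rightarrow> bool"
  where "smooth_manifold \<A> \<longleftrightarrow>
    (\<Union>c\<in>\<A>. chart_dom c) = UNIV \<and>
    (\<forall>c\<in>\<A>. open (chart_dom c) \<and> open (chart_img c) \<and>
       homeomorphism (chart_dom c) (chart_img c) (chart_map c) (chart_inv c)) \<and>
    (\<forall>c\<in>\<A>. \<forall>c'\<in>\<A>. smooth_on (chart_map c ` (chart_dom c \<inter> chart_dom c')) (transition c c'))"


section \<open>Riemannian geometry in local coordinates\<close>

text \<open>Coordinates range over an open subset of a Euclidean space \<open>'v\<close>, and tangent vectors are elements
  of \<open>'v\<close>. The Euclidean inner product of \<open>'v\<close> plays no role, only \<open>G x\<close> does.\<close>

type_synonym 'v metric = "'v \<Rightarrow> 'v \<Rightarrow> 'v \<Rightarrow> real"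

definition riemannian_metric_on :: "'v::euclidean_space set \<Rightarrow> 'v metric \<Rightarrow> bool"
  where "riemannian_metric_on S G \<longleftrightarrow>
    (\<forall>x\<in>S. bilinear (G x) \<and> (\<forall>u v. G x u v = G x v u) \<and> (\<forall>u. u \<noteq> 0 \<longrightarrow> G x u u > 0)) \<and>
    (\<forall>u v. smooth_on S (\<lambda>x. G x u v))"

text \<open>The Christoffel symbols of the Levi-Civita connection, i.e. of the unique connection which is
  torsion-free and compatible with the metric.\<close>

definition christoffel :: "'v::euclidean_space metric \<Rightarrow> 'v \<Rightarrow> 'v \<Rightarrow> 'v \<Rightarrow> 'v"
  where "christoffel G x = (THE \<Gamma>. bilinear \<Gamma> \<and> (\<forall>u v. \<Gamma> u v = \<Gamma> v u) \<and>
    (\<forall>u v w. dd (\<lambda>z. G z v w) x u = G x (\<Gamma> u v) w + G x v (\<Gamma> u w)))"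

definition cov :: "'v::euclidean_space metric \<Rightarrow> ('v \<Rightarrow> 'v) \<Rightarrow> 'v \<Rightarrow> 'v \<Rightarrow> 'v"
  where "cov G Y x u = dd Y x u + christoffel G x u (Y x)"

definition curvature ::
    "'v::euclidean_space metric \<Rightarrow> ('v \<Rightarrow> 'v) \<Rightarrow> ('v \<Rightarrow> 'v) \<Rightarrow> ('v \<Rightarrow> 'v) \<Rightarrow> 'v \<Rightarrow> 'v"
  where "curvature G X Y Z x =
    cov G (\<lambda>z. cov G Z z (Y z)) x (X x) - cov G (\<lambda>z. cov G Z z (X z)) x (Y x)
    - cov G Z x (dd Y x (X x) - dd X x (Y x))"

definition sectional_curvature :: "'v::euclidean_space metric \<Rightarrow> 'v \<Rightarrow> 'v \<Rightarrow> 'v \<Rightarrow> real"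
  where "sectional_curvature G x u v =
    G x (curvature G (\<lambda>_. u) (\<lambda>_. v) (\<lambda>_. v) x) u / (G x u u * G x v v - (G x u v)\<^sup>2)"

text \<open>Traces over a basis that is orthonormal for an inner product \<open>k\<close>; for bilinear \<open>Q\<close> they do not
  depend on the chosen basis.\<close>

definition orthonormal_basis :: "('v::euclidean_space \<Rightarrow> 'v \<Rightarrow> real) \<Rightarrow> 'v set \<Rightarrow> bool"
  where "orthonormal_basis k B \<longleftrightarrow>
    finite B \<and> card B = DIM('v) \<and> (\<forall>u\<in>B. \<forall>v\<in>B. k u v = (if u = v then 1 else 0))"

definition metric_trace ::
    "('v::euclidean_space \<Rightarrow> 'v \<Rightarrow> real) \<Rightarrow> ('v \<Rightarrow> 'v \<Rightarrow> 'w::real_vector) \<Rightarrow> 'w"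
  where "metric_trace k Q = (\<Sum>e\<in>(SOME B. orthonormal_basis k B). Q e e)"

definition endo_trace :: "('v::euclidean_space \<Rightarrow> 'v \<Rightarrow> real) \<Rightarrow> ('v \<Rightarrow> 'v) \<Rightarrow> real"
  where "endo_trace k L = metric_trace k (\<lambda>u v. k (L u) v)"

definition endo_norm2 :: "('v::euclidean_space \<Rightarrow> 'v \<Rightarrow> real) \<Rightarrow> ('v \<Rightarrow> 'v) \<Rightarrow> real"
  where "endo_norm2 k L = metric_trace k (\<lambda>u v. k (L u) (L v))"

definition cov_endo ::
    "'v::euclidean_space metric \<Rightarrow> ('v \<Rightarrow> 'v \<Rightarrow> 'v) \<Rightarrow> 'v \<Rightarrow> 'v \<Rightarrow> 'v \<Rightarrow> 'v"
  where "cov_endo h L x u v = cov h (\<lambda>z. L z v) x u - L x (cov h (\<lambda>_. v) x u)"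

text \<open>\<open>|\<nabla>L|\<^sup>2\<close>, the sum of \<open>|(\<nabla>\<^bsub>E\<^sub>i\<^esub>L)E\<^sub>j|\<^sup>2\<close> over all \<open>i\<close>, \<open>j\<close>:\<close>

definition cov_endo_norm2 :: "'v::euclidean_space metric \<Rightarrow> ('v \<Rightarrow> 'v \<Rightarrow> 'v) \<Rightarrow> 'v \<Rightarrow> real"
  where "cov_endo_norm2 h L x = metric_trace (h x) (\<lambda>u u'. metric_trace (h x)
    (\<lambda>v v'. h x (cov_endo h L x u v) (cov_endo h L x u' v')))"

definition hessian :: "'v::euclidean_space metric \<Rightarrow> ('v \<Rightarrow> real) \<Rightarrow> 'v \<Rightarrow> 'v \<Rightarrow> 'v \<Rightarrow> real"
  where "hessian h \<psi> x u v = dd (\<lambda>z. dd \<psi> z v) x u - dd \<psi> x (cov h (\<lambda>_. v) x u)"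

definition laplacian :: "'v::euclidean_space metric \<Rightarrow> ('v \<Rightarrow> real) \<Rightarrow> 'v \<Rightarrow> real"
  where "laplacian h \<psi> x = metric_trace (h x) (hessian h \<psi> x)"


section \<open>Immersions in local coordinates\<close>

text \<open>Here \<open>f\<close> is an immersion of an open subset of \<open>'m\<close> into an open subset of \<open>'q\<close>, the latter with
  the metric \<open>G\<close>. Tangent vectors of the submanifold are elements of \<open>'m\<close>, carried to ambient vectors by
  the differential of \<open>f\<close>; ambient vector fields along \<open>f\<close> are functions \<open>W :: 'm \<Rightarrow> 'q\<close>.\<close>

definition induced_metric ::
    "'q::euclidean_space metric \<Rightarrow> ('m::euclidean_space \<Rightarrow> 'q) \<Rightarrow> 'm metric"
  where "induced_metric G f y u v = G (f y) (dd f y u) (dd f y v)"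

text \<open>Tangential part, as an element of \<open>'m\<close>, and normal part, as an element of \<open>'q\<close>:\<close>

definition tan_part ::
    "'q::euclidean_space metric \<Rightarrow> ('m::euclidean_space \<Rightarrow> 'q) \<Rightarrow> 'm \<Rightarrow> 'q \<Rightarrow> 'm"
  where "tan_part G f y w = (THE u. \<forall>v. G (f y) (w - dd f y u) (dd f y v) = 0)"

definition nor_part ::
    "'q::euclidean_space metric \<Rightarrow> ('m::euclidean_space \<Rightarrow> 'q) \<Rightarrow> 'm \<Rightarrow> 'q \<Rightarrow> 'q"
  where "nor_part G f y w = w - dd f y (tan_part G f y w)"

definition normal_on ::
    "'q::euclidean_space metric \<Rightarrow> ('m::euclidean_space \<Rightarrow> 'q) \<Rightarrow> 'm set \<Rightarrow> ('m \<Rightarrow> 'q) \<Rightarrow> bool"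
  where "normal_on G f S W \<longleftrightarrow> (\<forall>y\<in>S. \<forall>u. G (f y) (W y) (dd f y u) = 0)"

definition cov_along ::
    "'q::euclidean_space metric \<Rightarrow> ('m::euclidean_space \<Rightarrow> 'q) \<Rightarrow> ('m \<Rightarrow> 'q) \<Rightarrow> 'm \<Rightarrow> 'm \<Rightarrow> 'q"
  where "cov_along G f W y u = dd W y u + christoffel G (f y) (dd f y u) (W y)"

text \<open>The formulas of Gauss (for constant tangent fields \<open>u\<close>, \<open>v\<close>) and Weingarten:\<close>

definition second_ff ::
    "'q::euclidean_space metric \<Rightarrow> ('m::euclidean_space \<Rightarrow> 'q) \<Rightarrow> 'm \<Rightarrow> 'm \<Rightarrow> 'm \<Rightarrow> 'q"
  where "second_ff G f y u v =
    cov_along G f (\<lambda>z. dd f z v) y u - dd f y (cov (induced_metric G f) (\<lambda>_. v) y u)"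

definition shape ::
    "'q::euclidean_space metric \<Rightarrow> ('m::euclidean_space \<Rightarrow> 'q) \<Rightarrow> ('m \<Rightarrow> 'q) \<Rightarrow> 'm \<Rightarrow> 'm \<Rightarrow> 'm"
  where "shape G f W y u = - tan_part G f y (cov_along G f W y u)"

definition normal_conn ::
    "'q::euclidean_space metric \<Rightarrow> ('m::euclidean_space \<Rightarrow> 'q) \<Rightarrow> ('m \<Rightarrow> 'q) \<Rightarrow> 'm \<Rightarrow> 'm \<Rightarrow> 'q"
  where "normal_conn G f W y u = nor_part G f y (cov_along G f W y u)"

definition mean_curvature ::
    "'q::euclidean_space metric \<Rightarrow> ('m::euclidean_space \<Rightarrow> 'q) \<Rightarrow> 'm \<Rightarrow> 'q"
  where "mean_curvature G f y =
    (1 / DIM('m)) *\<^sub>R metric_trace (induced_metric G f y) (second_ff G f y)"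


section \<open>Complex space forms\<close>

text \<open>Tensor fields on a manifold are given by their components: \<open>g c p u v\<close> and \<open>J c p u\<close> are the metric
  and the complex structure at the point \<open>p\<close>, expressed in the chart \<open>c\<close>, and a change of
  charts acts by the differential of the transition map.\<close>

definition local_metric ::
    "(('a, 'v) chart \<Rightarrow> 'a \<Rightarrow> 'v \<Rightarrow> 'v \<Rightarrow> real) \<Rightarrow> ('a, 'v) chart \<Rightarrow> 'v metric"
  where "local_metric g c = (\<lambda>x. g c (chart_inv c x))"

definition local_endo ::
    "(('a, 'v) chart \<Rightarrow> 'a \<Rightarrow> 'v \<Rightarrow> 'v) \<Rightarrow> ('a, 'v) chart \<Rightarrow> 'v \<Rightarrow> 'v \<Rightarrow> 'v"
  where "local_endo J c = (\<lambda>x. J c (chart_inv c x))"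

definition riemannian_metric ::
    "('a, 'v::euclidean_space) chart set \<Rightarrow> (('a, 'v) chart \<Rightarrow> 'a \<Rightarrow> 'v \<Rightarrow> 'v \<Rightarrow> real) \<Rightarrow> bool"
  where "riemannian_metric \<A> g \<longleftrightarrow>
    (\<forall>c\<in>\<A>. riemannian_metric_on (chart_img c) (local_metric g c)) \<and>
    (\<forall>c\<in>\<A>. \<forall>c'\<in>\<A>. \<forall>p\<in>chart_dom c \<inter> chart_dom c'. \<forall>u v.
       g c p u v = g c' p (dd (transition c c') (chart_map c p) u)
                          (dd (transition c c') (chart_map c p) v))"

definition almost_complex_structure ::
    "('a, 'v::euclidean_space) chart set \<Rightarrow> (('a, 'v) chart \<Rightarrow> 'a \<Rightarrow> 'v \<Rightarrow> 'v) \<Rightarrow> bool"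
  where "almost_complex_structure \<A> J \<longleftrightarrow>
    (\<forall>c\<in>\<A>. (\<forall>p\<in>chart_dom c. linear (J c p) \<and> (\<forall>u. J c p (J c p u) = - u)) \<and>
       (\<forall>u. smooth_on (chart_img c) (\<lambda>x. local_endo J c x u))) \<and>
    (\<forall>c\<in>\<A>. \<forall>c'\<in>\<A>. \<forall>p\<in>chart_dom c \<inter> chart_dom c'. \<forall>u.
       dd (transition c c') (chart_map c p) (J c p u)
         = J c' p (dd (transition c c') (chart_map c p) u))"

text \<open>Kaehler manifold: \<open>J\<close> is orthogonal and \<open>\<nabla>J = 0\<close>. As \<open>\<nabla>\<close> is torsion-free, this makes the Nijenhuis tensor
  vanish, so \<open>J\<close> is integrable.\<close>

definition kaehler_manifold ::
    "('a::{t2_space,second_countable_topology}, 'v::euclidean_space) chart set \<Rightarrow>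
     (('a, 'v) chart \<Rightarrow> 'a \<Rightarrow> 'v \<Rightarrow> 'v \<Rightarrow> real) \<Rightarrow> (('a, 'v) chart \<Rightarrow> 'a \<Rightarrow> 'v \<Rightarrow> 'v) \<Rightarrow> bool"
  where "kaehler_manifold \<A> g J \<longleftrightarrow>
    smooth_manifold \<A> \<and> riemannian_metric \<A> g \<and> almost_complex_structure \<A> J \<and>
    (\<forall>c\<in>\<A>. \<forall>p\<in>chart_dom c. \<forall>u v. g c p (J c p u) (J c p v) = g c p u v) \<and>
    (\<forall>c\<in>\<A>. \<forall>x\<in>chart_img c. \<forall>u v. cov_endo (local_metric g c) (local_endo J c) x u v = 0)"

definition complex_space_form ::
    "nat \<Rightarrow> real \<Rightarrow> ('a::{t2_space,second_countable_topology}, 'v::euclidean_space) chart set \<Rightarrow>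
     (('a, 'v) chart \<Rightarrow> 'a \<Rightarrow> 'v \<Rightarrow> 'v \<Rightarrow> real) \<Rightarrow> (('a, 'v) chart \<Rightarrow> 'a \<Rightarrow> 'v \<Rightarrow> 'v) \<Rightarrow> bool"
  where "complex_space_form n c \<A> g J \<longleftrightarrow>
    DIM('v) = 2 * n \<and> kaehler_manifold \<A> g J \<and>
    (\<forall>a\<in>\<A>. \<forall>x\<in>chart_img a. \<forall>u. u \<noteq> 0 \<longrightarrow>
       sectional_curvature (local_metric g a) x u (local_endo J a x u) = c)"


section \<open>Submanifolds of the product with the real line\<close>

text \<open>A chart \<open>a\<close> of the first factor gives the chart \<open>a \<times> id\<close> of the product. \<open>F\<close> is the immersion of the
  submanifold, and an ambient vector field \<open>V\<close> along \<open>F\<close> has at \<open>p\<close> the components \<open>V a p\<close> in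
  that chart.\<close>

definition product_metric :: "'v metric \<Rightarrow> ('v \<times> real) metric"
  where "product_metric G q w w' = G (fst q) (fst w) (fst w') + snd w * snd w'"

definition product_phi :: "('v::zero \<Rightarrow> 'v \<Rightarrow> 'v) \<Rightarrow> 'v \<times> real \<Rightarrow> 'v \<times> real \<Rightarrow> 'v \<times> real"
  where "product_phi J q w = (J (fst q) (fst w), 0)"

definition overlap :: "('a, 'v) chart \<Rightarrow> ('s, 'm) chart \<Rightarrow> ('s \<Rightarrow> 'a \<times> real) \<Rightarrow> 'm set"
  where "overlap a b F = chart_map b ` {p \<in> chart_dom b. fst (F p) \<in> chart_dom a}"

definition local_map ::
    "('a, 'v) chart \<Rightarrow> ('s, 'm) chart \<Rightarrow> ('s \<Rightarrow> 'a \<times> real) \<Rightarrow> 'm \<Rightarrow> 'v \<times> real"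
  where "local_map a b F y =
    (chart_map a (fst (F (chart_inv b y))), snd (F (chart_inv b y)))"

definition local_field ::
    "('a, 'v) chart \<Rightarrow> ('s, 'm) chart \<Rightarrow> (('a, 'v) chart \<Rightarrow> 's \<Rightarrow> 'v \<times> real) \<Rightarrow> 'm \<Rightarrow> 'v \<times> real"
  where "local_field a b V y = V a (chart_inv b y)"

definition immersed_submanifold ::
    "('a::{t2_space,second_countable_topology}, 'v::euclidean_space) chart set \<Rightarrow>
     ('s::{t2_space,second_countable_topology}, 'm::euclidean_space) chart set \<Rightarrow>
     ('s \<Rightarrow> 'a \<times> real) \<Rightarrow> bool"
  where "immersed_submanifold \<A> \<B> F \<longleftrightarrow>
    smooth_manifold \<B> \<and> continuous_on UNIV F \<and>
    (\<forall>a\<in>\<A>. \<forall>b\<in>\<B>. smooth_on (overlap a b F) (local_map a b F) \<and>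
       (\<forall>y\<in>overlap a b F. inj (dd (local_map a b F) y)))"

definition normal_field ::
    "('a, 'v::euclidean_space) chart set \<Rightarrow> (('a, 'v) chart \<Rightarrow> 'a \<Rightarrow> 'v \<Rightarrow> 'v \<Rightarrow> real) \<Rightarrow>
     ('s, 'm::euclidean_space) chart set \<Rightarrow> ('s \<Rightarrow> 'a \<times> real) \<Rightarrow>
     (('a, 'v) chart \<Rightarrow> 's \<Rightarrow> 'v \<times> real) \<Rightarrow> bool"
  where "normal_field \<A> g \<B> F V \<longleftrightarrow>
    (\<forall>a\<in>\<A>. \<forall>a'\<in>\<A>. \<forall>p. fst (F p) \<in> chart_dom a \<inter> chart_dom a' \<longrightarrow>
       V a' p = (dd (transition a a') (chart_map a (fst (F p))) (fst (V a p)), snd (V a p))) \<and>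
    (\<forall>a\<in>\<A>. \<forall>b\<in>\<B>. smooth_on (overlap a b F) (local_field a b V) \<and>
       normal_on (product_metric (local_metric g a)) (local_map a b F) (overlap a b F)
         (local_field a b V))"

definition parallel_in_normal_bundle ::
    "('a, 'v::euclidean_space) chart set \<Rightarrow> (('a, 'v) chart \<Rightarrow> 'a \<Rightarrow> 'v \<Rightarrow> 'v \<Rightarrow> real) \<Rightarrow>
     ('s, 'm::euclidean_space) chart set \<Rightarrow> ('s \<Rightarrow> 'a \<times> real) \<Rightarrow>
     (('a, 'v) chart \<Rightarrow> 's \<Rightarrow> 'v \<times> real) \<Rightarrow> bool"
  where "parallel_in_normal_bundle \<A> g \<B> F V \<longleftrightarrow>
    (\<forall>a\<in>\<A>. \<forall>b\<in>\<B>. \<forall>y\<in>overlap a b F. \<forall>u.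
       normal_conn (product_metric (local_metric g a)) (local_map a b F) (local_field a b V) y u = 0)"

text \<open>The trace of the shape operator does not depend on the charts used to compute it.\<close>

definition constant_trace_shape ::
    "('a, 'v::euclidean_space) chart set \<Rightarrow> (('a, 'v) chart \<Rightarrow> 'a \<Rightarrow> 'v \<Rightarrow> 'v \<Rightarrow> real) \<Rightarrow>
     ('s, 'm::euclidean_space) chart set \<Rightarrow> ('s \<Rightarrow> 'a \<times> real) \<Rightarrow>
     (('a, 'v) chart \<Rightarrow> 's \<Rightarrow> 'v \<times> real) \<Rightarrow> bool"
  where "constant_trace_shape \<A> g \<B> F V \<longleftrightarrow>
    (\<exists>k. \<forall>a\<in>\<A>. \<forall>b\<in>\<B>. \<forall>y\<in>overlap a b F.
       endo_trace (induced_metric (product_metric (local_metric g a)) (local_map a b F) y)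
         (shape (product_metric (local_metric g a)) (local_map a b F) (local_field a b V) y) = k)"

definition orthonormal_normal_frame_on ::
    "'q::euclidean_space metric \<Rightarrow> ('m::euclidean_space \<Rightarrow> 'q) \<Rightarrow> 'm set \<Rightarrow> nat set \<Rightarrow>
     (nat \<Rightarrow> 'm \<Rightarrow> 'q) \<Rightarrow> bool"
  where "orthonormal_normal_frame_on G f S I E \<longleftrightarrow>
    (\<forall>\<alpha>\<in>I. smooth_on S (E \<alpha>) \<and> normal_on G f S (E \<alpha>)) \<and>
    (\<forall>y\<in>S. \<forall>\<alpha>\<in>I. \<forall>\<beta>\<in>I. G (f y) (E \<alpha> y) (E \<beta> y) = (if \<alpha> = \<beta> then 1 else 0))"

end

theory Submission
  imports Defs
begin

text \<open>
  Write \<open>A = A\<^sub>V\<close> and \<open>R\<close> for the ambient curvature. Because \<open>V\<close> is parallel, differentiating \<open>D V = - A\<close>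
  gives the Codazzi equation \<open>(\<nabla>\<^sub>u A)v - (\<nabla>\<^sub>v A)u = - (R(u,v)V)\<^sup>T\<close>. In
  \<open>1/2 \<Delta>|A|\<^sup>2 = |\<nabla>A|\<^sup>2 + \<Sum>\<^sub>i\<^sub>j \<langle>\<nabla>\<^sup>2\<^sub>i\<^sub>i A E\<^sub>j, A E\<^sub>j\<rangle>\<close> one exchanges indices with the derivative of the
  Codazzi equation, with the Ricci identity and the Gauss equation, and once more with Codazzi, until
  only \<open>\<Sum>\<^sub>i \<langle>\<nabla>\<^sup>2 A E\<^sub>i, E\<^sub>i\<rangle>\<close> is left, which vanishes since the trace of \<open>A\<close> is constant. The metric, \<open>\<phi>\<close> and
  \<open>\<xi>\<close> are parallel, hence so is \<open>R\<close>; differentiating the right hand side of the Codazzi equation therefore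
  only differentiates its arguments. What remains is an algebraic sum over an orthonormal frame,
  evaluated with the explicit form of \<open>R\<close>. That form follows from constant holomorphic
  sectional curvature by polarization.
\<close>

section \<open>Smooth functions\<close>

text \<open>All derivatives are taken in one chart of N and one of the submanifold, along constant
  coordinate fields. These commute but are not parallel, so Christoffel terms have to cancel at
  every step. No frame field is ever differentiated: a frame orthonormal at a single point is chosen
  when a trace is evaluated there, and a trace that has to be differentiated is first written as the
  sum of \<open>Q b (sharp b)\<close> over the fixed coordinate basis, where \<open>sharp\<close> is
  the inverse metric. Hence the effort spent on the smoothness of \<open>sharp\<close>.

  Differentiating the Codazzi equation also differentiates its tangent arguments, and the ambient
  derivative of a tangent field has the normal part \<sigma>. This is the origin of the curvatures
  with one argument \<sigma>, and with them of the terms in N, H, nV and tV. The sum over \<alpha>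
  comes from the quadratic terms of the Gauss equation.\<close>

lemma dd_eqI: "(f has_derivative f') (at x) \<Longrightarrow> frechet_derivative f (at x) = f'"
  by (metis frechet_derivative_at)

lemmas dd_transform = has_derivative_transform_within_open[THEN dd_eqI, THEN fun_cong]

lemma dd_has_derivative:
  "f differentiable (at x) \<Longrightarrow> (f has_derivative frechet_derivative f (at x)) (at x)"
  by (simp add: frechet_derivative_works)

lemma linear_dd: "f differentiable (at x) \<Longrightarrow> linear (frechet_derivative f (at x))"
  using dd_has_derivative has_derivative_linear by blast

lemma dd_cong:
  assumes "open S" "x \<in> S" "\<And>z. z \<in> S \<Longrightarrow> f z = g z"
  shows "frechet_derivative f (at x) = frechet_derivative g (at x)"
proof -
  have "(f has_derivative f') (at x) \<longleftrightarrow> (g has_derivative f') (at x)" for f'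
    using assms has_derivative_transform_within_open by (metis (no_types, lifting))
  then show ?thesis by (simp add: frechet_derivative_def)
qed

lemma differentiable_cong:
  assumes "open S" "x \<in> S" "\<And>z. z \<in> S \<Longrightarrow> f z = g z" "f differentiable (at x)"
  shows "g differentiable (at x)"
  using assms has_derivative_transform_within_open
  unfolding differentiable_def by (metis (no_types, lifting))

lemma Ck_on_mono: "Ck_on k f S \<Longrightarrow> T \<subseteq> S \<Longrightarrow> Ck_on k f T"
  by (induction k arbitrary: f) (auto intro: continuous_on_subset)

lemma Ck_on_cong:
  assumes "open S" "\<And>z. z \<in> S \<Longrightarrow> f z = g z" "Ck_on k f S"
  shows "Ck_on k g S"
  using assms(2,3)
proof (induction k arbitrary: f g)
  case 0 then show ?case by (simp cong: continuous_on_cong)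
next
  case (Suc k)
  have "Ck_on k (\<lambda>x. dd g x v) S" for v
  proof (rule Suc.IH)
    show "Ck_on k (\<lambda>x. dd f x v) S" using Suc.prems by simp
  qed (use dd_cong[OF assms(1)] Suc.prems(1) in metis)
  moreover have "g differentiable (at x)" if "x \<in> S" for x
    using differentiable_cong[OF assms(1) that, of f g] Suc.prems that by simp
  ultimately show ?case by simp
qed

lemma Ck_on_Suc_imp: "Ck_on (Suc k) f S \<Longrightarrow> Ck_on k f S"
proof (induction k arbitrary: f)
  case 0
  then show ?case
    by (auto intro!: continuous_at_imp_continuous_on differentiable_imp_continuous_within)
next
  case (Suc k) then show ?case by simp
qed

lemma Ck_on_const: "Ck_on k (\<lambda>_. a) S"
  by (induction k arbitrary: a) (auto simp: frechet_derivative_const)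

lemma Ck_on_bounded_linear:
  assumes "open S" "bounded_linear L" "Ck_on k f S"
  shows "Ck_on k (\<lambda>x. L (f x)) S"
  using assms(3)
proof (induction k arbitrary: f)
  case 0 then show ?case using assms(2) by (simp add: linear_continuous_on_compose bounded_linear.continuous_on)
next
  case (Suc k)
  have d: "((\<lambda>x. L (f x)) has_derivative (\<lambda>v. L (dd f x v))) (at x)" if "x \<in> S" for x
    using Suc.prems that by (auto intro!: bounded_linear.has_derivative[OF assms(2)] dd_has_derivative)
  have "Ck_on k (\<lambda>x. dd (\<lambda>x. L (f x)) x v) S" for v
    by (rule Ck_on_cong[OF assms(1) _ Suc.IH[of "\<lambda>x. dd f x v"]])
      (use Suc.prems dd_eqI[OF d] in auto)
  then show ?case using d by (auto simp: differentiable_def)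
qed

lemma Ck_on_add:
  assumes "open S" "Ck_on k f S" "Ck_on k g S"
  shows "Ck_on k (\<lambda>x. f x + g x) S"
  using assms(2,3)
proof (induction k arbitrary: f g)
  case 0 then show ?case by (simp add: continuous_on_add)
next
  case (Suc k)
  have d: "((\<lambda>x. f x + g x) has_derivative (\<lambda>v. dd f x v + dd g x v)) (at x)" if "x \<in> S" for x
    using Suc.prems that by (auto intro!: has_derivative_add dd_has_derivative)
  have "Ck_on k (\<lambda>x. dd (\<lambda>x. f x + g x) x v) S" for v
    by (rule Ck_on_cong[OF assms(1) _ Suc.IH[of "\<lambda>x. dd f x v" "\<lambda>x. dd g x v"]])
      (use Suc.prems dd_eqI[OF d] in auto)
  then show ?case using d by (auto simp: differentiable_def)
qed

lemma Ck_on_scaleR: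
  fixes f :: "'v::real_normed_vector \<Rightarrow> real"
  assumes "open S" "Ck_on k f S" "Ck_on k g S"
  shows "Ck_on k (\<lambda>x. f x *\<^sub>R g x) S"
  using assms(2,3)
proof (induction k arbitrary: f g)
  case 0 then show ?case by (simp add: continuous_on_scaleR)
next
  case (Suc k)
  have d: "((\<lambda>x. f x *\<^sub>R g x) has_derivative (\<lambda>v. f x *\<^sub>R dd g x v + dd f x v *\<^sub>R g x)) (at x)"
    if "x \<in> S" for x
    using Suc.prems that by (auto intro!: has_derivative_scaleR dd_has_derivative)
  have "Ck_on k (\<lambda>x. dd (\<lambda>x. f x *\<^sub>R g x) x v) S" for v
  proof (rule Ck_on_cong[OF assms(1)])
    show "Ck_on k (\<lambda>x. f x *\<^sub>R dd g x v + dd f x v *\<^sub>R g x) S"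
      using Suc.prems Ck_on_Suc_imp[of k f S] Ck_on_Suc_imp[of k g S]
      by (intro Ck_on_add[OF assms(1)] Suc.IH) simp_all
  qed (use dd_eqI[OF d] in auto)
  then show ?case using d by (auto simp: differentiable_def)
qed

lemma Ck_on_sum:
  assumes "open S" "\<And>i. i \<in> I \<Longrightarrow> Ck_on k (f i) S"
  shows "Ck_on k (\<lambda>x. \<Sum>i\<in>I. f i x) S"
  using assms(2)
  by (induction I rule: infinite_finite_induct) (auto intro!: Ck_on_const Ck_on_add[OF assms(1)])

lemma dd_basis_sum:
  fixes f :: "'v::euclidean_space \<Rightarrow> 'w::real_normed_vector"
  assumes "f differentiable (at x)"
  shows "dd f x u = (\<Sum>b\<in>Basis. (u \<bullet> b) *\<^sub>R dd f x b)"
  using linear_sum[OF linear_dd[OF assms], of "\<lambda>b. (u \<bullet> b) *\<^sub>R b" Basis]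
  by (simp add: euclidean_representation linear_scale[OF linear_dd[OF assms]])

text \<open>The chain rule yields the derivative of \<open>f\<close> in the variable direction
  \<open>dd g x v\<close>, to which the induction hypothesis does not apply. Expanded in the basis,
  it is a sum of products of coefficients of \<open>dd g x v\<close> with derivatives of
  \<open>f\<close> in fixed directions.\<close>

lemma Ck_on_compose:
  fixes g :: "'u::real_normed_vector \<Rightarrow> 'v::euclidean_space" and f :: "'v \<Rightarrow> 'w::real_normed_vector"
  assumes "open S" "Ck_on k f T" "Ck_on k g S" "g ` S \<subseteq> T"
  shows "Ck_on k (\<lambda>x. f (g x)) S"
  using assms(2,3)
proof (induction k arbitrary: f)
  case 0 then show ?case using assms(4) by (auto intro: continuous_on_compose2)
next
  case (Suc k)
  have fd: "f differentiable (at (g x))" if "x \<in> S" for x using Suc.prems assms(4) that by auto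
  have d: "((\<lambda>x. f (g x)) has_derivative (\<lambda>v. dd f (g x) (dd g x v))) (at x)" if "x \<in> S" for x
    using has_derivative_compose[OF dd_has_derivative[of g x] dd_has_derivative[OF fd[OF that]]]
      Suc.prems that by simp
  have "Ck_on k (\<lambda>x. dd (\<lambda>x. f (g x)) x v) S" for v
  proof (rule Ck_on_cong[OF assms(1)])
    have "Ck_on k (\<lambda>x. dd g x v \<bullet> b) S" for b
      using Ck_on_bounded_linear[OF assms(1) bounded_linear_inner_left, of k "\<lambda>x. dd g x v"] Suc.prems by simp
    then show "Ck_on k (\<lambda>x. \<Sum>b\<in>Basis. (dd g x v \<bullet> b) *\<^sub>R dd f (g x) b) S"
      using Suc.prems Ck_on_Suc_imp[of k g S]
      by (intro Ck_on_sum[OF assms(1)] Ck_on_scaleR[OF assms(1)] Suc.IH) simp_all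
  qed (use dd_eqI[OF d] dd_basis_sum[OF fd] in metis)
  then show ?case using d by (auto simp: differentiable_def)
qed

lemma smooth_on_differentiable: "smooth_on S f \<Longrightarrow> x \<in> S \<Longrightarrow> f differentiable (at x)"
  unfolding smooth_on_def by (metis Ck_on.simps(2))

lemma smooth_on_mono: "smooth_on S f \<Longrightarrow> T \<subseteq> S \<Longrightarrow> smooth_on T f"
  unfolding smooth_on_def using Ck_on_mono by blast

lemma smooth_on_cong:
  "open S \<Longrightarrow> (\<And>z. z \<in> S \<Longrightarrow> f z = g z) \<Longrightarrow> smooth_on S f \<Longrightarrow> smooth_on S g"
  unfolding smooth_on_def using Ck_on_cong by (metis (no_types, lifting))

lemma smooth_on_const: "smooth_on S (\<lambda>_. a)"
  by (simp add: smooth_on_def Ck_on_const)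

lemma smooth_on_dd: "smooth_on S f \<Longrightarrow> smooth_on S (\<lambda>x. dd f x v)"
  unfolding smooth_on_def by (metis Ck_on.simps(2))

lemma smooth_on_bounded_linear:
  "open S \<Longrightarrow> bounded_linear L \<Longrightarrow> smooth_on S f \<Longrightarrow> smooth_on S (\<lambda>x. L (f x))"
  by (simp add: smooth_on_def Ck_on_bounded_linear)

lemma smooth_on_add:
  "open S \<Longrightarrow> smooth_on S f \<Longrightarrow> smooth_on S g \<Longrightarrow> smooth_on S (\<lambda>x. f x + g x)"
  by (simp add: smooth_on_def Ck_on_add)

lemma smooth_on_minus: "open S \<Longrightarrow> smooth_on S f \<Longrightarrow> smooth_on S (\<lambda>x. - f x)"
  by (rule smooth_on_bounded_linear[OF _ bounded_linear_minus[OF bounded_linear_ident]])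

lemma smooth_on_diff:
  "open S \<Longrightarrow> smooth_on S f \<Longrightarrow> smooth_on S g \<Longrightarrow> smooth_on S (\<lambda>x. f x - g x)"
  using smooth_on_add[OF _ _ smooth_on_minus, of S f g] by simp

lemma smooth_on_scaleR:
  fixes f :: "'v::real_normed_vector \<Rightarrow> real"
  shows "open S \<Longrightarrow> smooth_on S f \<Longrightarrow> smooth_on S g \<Longrightarrow> smooth_on S (\<lambda>x. f x *\<^sub>R g x)"
  by (simp add: smooth_on_def Ck_on_scaleR)

lemma smooth_on_mult:
  fixes f g :: "'v::real_normed_vector \<Rightarrow> real"
  shows "open S \<Longrightarrow> smooth_on S f \<Longrightarrow> smooth_on S g \<Longrightarrow> smooth_on S (\<lambda>x. f x * g x)"
  using smooth_on_scaleR[of S f g] by simp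

lemma smooth_on_sum:
  "open S \<Longrightarrow> (\<And>i. i \<in> I \<Longrightarrow> smooth_on S (f i)) \<Longrightarrow> smooth_on S (\<lambda>x. \<Sum>i\<in>I. f i x)"
  by (simp add: smooth_on_def Ck_on_sum)

lemma smooth_on_inner_left:
  "open S \<Longrightarrow> smooth_on S f \<Longrightarrow> smooth_on S (\<lambda>x. f x \<bullet> b)"
  by (rule smooth_on_bounded_linear[OF _ bounded_linear_inner_left])

lemma smooth_on_Pair:
  assumes "open S" "smooth_on S f" "smooth_on S g"
  shows "smooth_on S (\<lambda>x. (f x, g x))"
proof -
  have "bounded_linear (\<lambda>u. (u, 0))" "bounded_linear (\<lambda>u. (0, u))"
    by (auto intro!: bounded_linear_Pair bounded_linear_ident bounded_linear_zero)
  from smooth_on_add[OF assms(1) smooth_on_bounded_linear[OF assms(1) this(1) assms(2)]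
      smooth_on_bounded_linear[OF assms(1) this(2) assms(3)]]
  show ?thesis by simp
qed

lemma smooth_on_compose:
  fixes g :: "'u::real_normed_vector \<Rightarrow> 'v::euclidean_space" and f :: "'v \<Rightarrow> 'w::real_normed_vector"
  shows "open S \<Longrightarrow> smooth_on T f \<Longrightarrow> smooth_on S g \<Longrightarrow> g ` S \<subseteq> T \<Longrightarrow> smooth_on S (\<lambda>x. f (g x))"
  unfolding smooth_on_def using Ck_on_compose by blast

lemma smooth_on_ident: "smooth_on S (\<lambda>x. x)"
proof -
  have "Ck_on k (\<lambda>x. x) S" for k
    by (cases k) (auto simp: frechet_derivative_ident Ck_on_const)
  then show ?thesis by (simp add: smooth_on_def)
qed

section \<open>Tensor fields evaluated on vector fields: smoothness and product rules\<close>

lemma linear_basis_sum: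
  fixes L :: "'v::euclidean_space \<Rightarrow> 'w::real_vector"
  assumes "linear L"
  shows "L u = (\<Sum>b\<in>Basis. (u \<bullet> b) *\<^sub>R L b)"
  using linear_sum[OF assms, of "\<lambda>b. (u \<bullet> b) *\<^sub>R b" Basis]
  by (simp add: euclidean_representation linear_scale[OF assms])

text \<open>Smoothness of a tensor field is only given for constant arguments; expanding the
  argument in the fixed basis extends it to variable ones.\<close>

lemma smooth_on_linear:
  fixes L :: "'u::real_normed_vector \<Rightarrow> 'v::euclidean_space \<Rightarrow> 'w::real_normed_vector"
  assumes "open S" "\<And>z. z \<in> S \<Longrightarrow> linear (L z)" "\<And>b. smooth_on S (\<lambda>z. L z b)" "smooth_on S W"
  shows "smooth_on S (\<lambda>z. L z (W z))"
proof (rule smooth_on_cong[OF assms(1)])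
  show "smooth_on S (\<lambda>z. \<Sum>b\<in>Basis. (W z \<bullet> b) *\<^sub>R L z b)"
    using assms by (intro smooth_on_sum smooth_on_scaleR smooth_on_inner_left)
qed (use linear_basis_sum[OF assms(2)] in metis)

lemma smooth_on_bilinear:
  fixes B :: "'u::real_normed_vector \<Rightarrow> 'v::euclidean_space \<Rightarrow> 'x::euclidean_space \<Rightarrow> 'w::real_normed_vector"
  assumes "open S" "\<And>z. z \<in> S \<Longrightarrow> bilinear (B z)" "\<And>u v. smooth_on S (\<lambda>z. B z u v)"
    "smooth_on S W" "smooth_on S W'"
  shows "smooth_on S (\<lambda>z. B z (W z) (W' z))"
proof (rule smooth_on_linear[OF assms(1) _ _ assms(5)])
  show "smooth_on S (\<lambda>z. B z (W z) b)" for b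
    by (rule smooth_on_linear[OF assms(1) _ _ assms(4), of "\<lambda>z u. B z u b"])
      (use assms in \<open>auto simp: bilinear_def\<close>)
qed (use assms in \<open>auto simp: bilinear_def\<close>)

lemma has_derivative_linear_eval:
  fixes L :: "'u::real_normed_vector \<Rightarrow> 'v::euclidean_space \<Rightarrow> 'w::real_normed_vector"
  assumes "open S" "x \<in> S" "\<And>z. z \<in> S \<Longrightarrow> linear (L z)"
    "\<And>b. (\<lambda>z. L z b) differentiable (at x)" "W differentiable (at x)"
  shows "((\<lambda>z. L z (W z)) has_derivative (\<lambda>u. dd (\<lambda>z. L z (W x)) x u + L x (dd W x u))) (at x)"
proof -
  have *: "((\<lambda>z. L z (Y z)) has_derivative (\<lambda>u. \<Sum>b\<in>Basis. (Y x \<bullet> b) *\<^sub>R dd (\<lambda>z. L z b) x u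
       + (dd Y x u \<bullet> b) *\<^sub>R L x b)) (at x)" if "Y differentiable (at x)" for Y
  proof (rule has_derivative_transform_within_open[OF _ assms(1,2)])
    show "((\<lambda>z. \<Sum>b\<in>Basis. (Y z \<bullet> b) *\<^sub>R L z b) has_derivative
       (\<lambda>u. \<Sum>b\<in>Basis. (Y x \<bullet> b) *\<^sub>R dd (\<lambda>z. L z b) x u + (dd Y x u \<bullet> b) *\<^sub>R L x b)) (at x)"
      by (intro has_derivative_sum has_derivative_scaleR has_derivative_inner_left dd_has_derivative that assms(4))
  qed (simp add: linear_basis_sum[OF assms(3), symmetric])
  have "dd (\<lambda>z. L z (W x)) x u = (\<Sum>b\<in>Basis. (W x \<bullet> b) *\<^sub>R dd (\<lambda>z. L z b) x u)" for u
    using dd_eqI[OF *[of "\<lambda>_. W x"]] by (simp add: frechet_derivative_const)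
  then show ?thesis
    using *[OF assms(5)] by (simp add: sum.distrib linear_basis_sum[OF assms(3)[OF assms(2)], symmetric])
qed

lemma dd_linear_eval:
  fixes L :: "'u::real_normed_vector \<Rightarrow> 'v::euclidean_space \<Rightarrow> 'w::real_normed_vector"
  assumes "open S" "x \<in> S" "\<And>z. z \<in> S \<Longrightarrow> linear (L z)"
    "\<And>b. (\<lambda>z. L z b) differentiable (at x)" "W differentiable (at x)"
  shows "dd (\<lambda>z. L z (W z)) x u = dd (\<lambda>z. L z (W x)) x u + L x (dd W x u)"
  using dd_eqI[OF has_derivative_linear_eval[OF assms]] by simp

lemma has_derivative_bilinear_eval:
  fixes B :: "'u::real_normed_vector \<Rightarrow> 'v::euclidean_space \<Rightarrow> 'x::euclidean_space \<Rightarrow> 'w::real_normed_vector"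
  assumes S: "open S" "x \<in> S" and B: "\<And>z. z \<in> S \<Longrightarrow> bilinear (B z)"
    "\<And>u v. (\<lambda>z. B z u v) differentiable (at x)" and W: "W differentiable (at x)" "W' differentiable (at x)"
  shows "((\<lambda>z. B z (W z) (W' z)) has_derivative (\<lambda>u. dd (\<lambda>z. B z (W x) (W' x)) x u
      + B x (dd W x u) (W' x) + B x (W x) (dd W' x u))) (at x)"
proof -
  have 1: "((\<lambda>z. B z (W z) b) has_derivative (\<lambda>u. dd (\<lambda>z. B z (W x) b) x u + B x (dd W x u) b)) (at x)" for b
    using has_derivative_linear_eval[OF S _ _ W(1), of "\<lambda>z u. B z u b"] B by (auto simp: bilinear_def)
  have "((\<lambda>z. B z (W z) (W' z)) has_derivative
      (\<lambda>u. dd (\<lambda>z. B z (W z) (W' x)) x u + B x (W x) (dd W' x u))) (at x)"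
  proof (rule has_derivative_linear_eval[OF S _ _ W(2)])
    show "(\<lambda>z. B z (W z) b) differentiable (at x)" for b using 1 by (auto simp: differentiable_def)
  qed (use B in \<open>auto simp: bilinear_def\<close>)
  then show ?thesis by (simp add: dd_eqI[OF 1])
qed

lemma dd_bilinear_eval:
  fixes B :: "'u::real_normed_vector \<Rightarrow> 'v::euclidean_space \<Rightarrow> 'x::euclidean_space \<Rightarrow> 'w::real_normed_vector"
  assumes "open S" "x \<in> S" "\<And>z. z \<in> S \<Longrightarrow> bilinear (B z)"
    "\<And>u v. (\<lambda>z. B z u v) differentiable (at x)" "W differentiable (at x)" "W' differentiable (at x)"
  shows "dd (\<lambda>z. B z (W z) (W' z)) x u
     = dd (\<lambda>z. B z (W x) (W' x)) x u + B x (dd W x u) (W' x) + B x (W x) (dd W' x u)"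
  using dd_eqI[OF has_derivative_bilinear_eval[OF assms]] by simp

text \<open>The mean value theorem is applied twice to the second difference: in direction
  \<open>u\<close> to the difference \<open>k\<close>, then in direction \<open>v\<close> to the
  derivative so obtained.\<close>

lemma mixed_difference:
  fixes f :: "'v::real_normed_vector \<Rightarrow> real"
  assumes "Ck_on 2 f S" "t > 0"
    and sub: "\<And>r s. 0 \<le> r \<Longrightarrow> r \<le> t \<Longrightarrow> 0 \<le> s \<Longrightarrow> s \<le> t \<Longrightarrow> x + r *\<^sub>R u + s *\<^sub>R v \<in> S"
  obtains r s where "0 < r" "r < t" "0 < s" "s < t"
    "f (x + t *\<^sub>R u + t *\<^sub>R v) - f (x + t *\<^sub>R u) - f (x + t *\<^sub>R v) + f x
       = t * t * dd (\<lambda>z. dd f z u) (x + r *\<^sub>R u + s *\<^sub>R v) v"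
proof -
  have C: "\<And>z. z \<in> S \<Longrightarrow> f differentiable (at z)"
    "\<And>z w. z \<in> S \<Longrightarrow> (\<lambda>z. dd f z w) differentiable (at z)"
    using assms(1) by (auto simp: numeral_2_eq_2)
  define k where "k r = f (x + r *\<^sub>R u + t *\<^sub>R v) - f (x + r *\<^sub>R u)" for r
  have dk: "DERIV k r :> dd f (x + r *\<^sub>R u + t *\<^sub>R v) u - dd f (x + r *\<^sub>R u) u" if "0 \<le> r" "r \<le> t" for r
  proof -
    have "x + r *\<^sub>R u + t *\<^sub>R v \<in> S" "x + r *\<^sub>R u \<in> S"
      using sub[OF that, of t] sub[OF that, of 0] \<open>t > 0\<close> by auto
    note D = dd_has_derivative[OF C(1)[OF this(1)]] dd_has_derivative[OF C(1)[OF this(2)]]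
      and L = linear_dd[OF C(1)[OF this(1)]] linear_dd[OF C(1)[OF this(2)]]
    have "(k has_derivative (\<lambda>h. dd f (x + r *\<^sub>R u + t *\<^sub>R v) (h *\<^sub>R u) - dd f (x + r *\<^sub>R u) (h *\<^sub>R u))) (at r)"
      unfolding k_def
      by (rule has_derivative_diff,
          rule has_derivative_compose[of "\<lambda>r. x + r *\<^sub>R u + t *\<^sub>R v" _ r UNIV f, OF _ D(1)],
          (auto intro!: derivative_eq_intros)[1],
          rule has_derivative_compose[of "\<lambda>r. x + r *\<^sub>R u" _ r UNIV f, OF _ D(2)],
          auto intro!: derivative_eq_intros)
    moreover have "(\<lambda>h. dd f (x + r *\<^sub>R u + t *\<^sub>R v) (h *\<^sub>R u) - dd f (x + r *\<^sub>R u) (h *\<^sub>R u))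
        = (*) (dd f (x + r *\<^sub>R u + t *\<^sub>R v) u - dd f (x + r *\<^sub>R u) u)"
      by (rule ext) (simp add: linear_scale[OF L(1)] linear_scale[OF L(2)] left_diff_distrib right_diff_distrib mult.commute)
    ultimately show ?thesis by (simp add: has_field_derivative_def)
  qed
  obtain r where r: "0 < r" "r < t" "k t - k 0 = (t - 0) * (dd f (x + r *\<^sub>R u + t *\<^sub>R v) u - dd f (x + r *\<^sub>R u) u)"
    using MVT2[OF \<open>t > 0\<close> dk] by auto
  define l where "l s = dd f (x + r *\<^sub>R u + s *\<^sub>R v) u" for s
  have dl: "DERIV l s :> dd (\<lambda>z. dd f z u) (x + r *\<^sub>R u + s *\<^sub>R v) v" if "0 \<le> s" "s \<le> t" for s
  proof -
    have "x + r *\<^sub>R u + s *\<^sub>R v \<in> S" using sub[of r s] that r by simp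
    note D = dd_has_derivative[OF C(2)[OF this]] and L = linear_dd[OF C(2)[OF this]]
    have "(l has_derivative (\<lambda>h. dd (\<lambda>z. dd f z u) (x + r *\<^sub>R u + s *\<^sub>R v) (h *\<^sub>R v))) (at s)"
      unfolding l_def
      by (rule has_derivative_compose[of "\<lambda>s. x + r *\<^sub>R u + s *\<^sub>R v" _ s UNIV "\<lambda>z. dd f z u", OF _ D]) (auto intro!: derivative_eq_intros)
    moreover have "(\<lambda>h. dd (\<lambda>z. dd f z u) (x + r *\<^sub>R u + s *\<^sub>R v) (h *\<^sub>R v))
        = (*) (dd (\<lambda>z. dd f z u) (x + r *\<^sub>R u + s *\<^sub>R v) v)"
      by (rule ext) (simp add: linear_scale[OF L])
    ultimately show ?thesis by (simp add: has_field_derivative_def)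
  qed
  obtain s where s: "0 < s" "s < t" "l t - l 0 = (t - 0) * dd (\<lambda>z. dd f z u) (x + r *\<^sub>R u + s *\<^sub>R v) v"
    using MVT2[OF \<open>t > 0\<close> dl] by auto
  show thesis using that[OF r(1,2) s(1,2)] r(3) s(3) by (simp add: k_def l_def)
qed

text \<open>The second difference does not depend on the order of \<open>u\<close> and
  \<open>v\<close>. So the two mixed derivatives take a common value at points arbitrarily close to
  \<open>x\<close>, and by continuity they cannot differ at \<open>x\<close>.\<close>

lemma symmetric_second_derivative_real:
  fixes f :: "'v::real_normed_vector \<Rightarrow> real"
  assumes "open S" "x \<in> S" "Ck_on 2 f S"
  shows "dd (\<lambda>z. dd f z u) x v = dd (\<lambda>z. dd f z v) x u"
proof (rule ccontr)
  define F where "F = (\<lambda>u v z. dd (\<lambda>z. dd f z u) z v)"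
  have cont: "continuous_on S (F u v)" for u v
    using assms(3) by (simp add: numeral_2_eq_2 F_def)
  assume "\<not> ?thesis"
  then have "dist (F u v x) (F v u x) > 0" by (simp add: F_def)
  then obtain e where e: "e > 0" "dist (F u v x) (F v u x) = 2 * e"
    using that[of "dist (F u v x) (F v u x) / 2"] by simp
  have "\<forall>\<^sub>F z in at x. z \<in> S \<and> dist (F u v z) (F u v x) < e \<and> dist (F v u z) (F v u x) < e"
    using cont assms(1,2) e(1) eventually_at_in_open'[OF assms(1,2)]
    by (intro eventually_conj) (auto simp: continuous_on_eq_continuous_at continuous_at tendsto_iff)
  then obtain d where d: "d > 0"
    "\<And>z. dist z x < d \<Longrightarrow> z \<in> S \<and> dist (F u v z) (F u v x) < e \<and> dist (F v u z) (F v u x) < e"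
    unfolding eventually_at using assms(2) e(1) by (metis UNIV_I dist_self)
  \<comment> \<open>With this size the whole parallelogram spanned by \<open>t u\<close> and
    \<open>t v\<close> stays within distance \<open>d / 2\<close> of \<open>x\<close>; the summand 1
    covers \<open>u = v = 0\<close>.\<close>
  define t where "t = d / (2 * (norm u + norm v + 1))"
  have pos: "norm u + norm v + 1 > 0" by (smt (verit) norm_ge_zero)
  have t: "t > 0" using d(1) pos by (simp add: t_def)
  have near: "dist (x + r *\<^sub>R u + s *\<^sub>R v) x < d" if "0 \<le> r" "r \<le> t" "0 \<le> s" "s \<le> t" for r s
  proof -
    have "dist (x + r *\<^sub>R u + s *\<^sub>R v) x \<le> r * norm u + s * norm v"
      using that by (simp add: dist_norm) (metis abs_of_nonneg norm_scaleR norm_triangle_ineq)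
    also have "\<dots> \<le> t * norm u + t * norm v" using that by (intro add_mono mult_right_mono) auto
    also have "\<dots> \<le> t * (norm u + norm v + 1)" using t by (simp add: algebra_simps)
    also have "\<dots> = d / 2" using pos by (simp add: t_def field_simps)
    finally show ?thesis using d(1) by simp
  qed
  obtain r s where 1: "0 < r" "r < t" "0 < s" "s < t"
    "f (x + t *\<^sub>R u + t *\<^sub>R v) - f (x + t *\<^sub>R u) - f (x + t *\<^sub>R v) + f x = t * t * F u v (x + r *\<^sub>R u + s *\<^sub>R v)"
    by (rule mixed_difference[OF assms(3) t, of x u v]) (use d(2)[OF near] that in \<open>auto simp: F_def\<close>)
  have near': "dist (x + r *\<^sub>R v + s *\<^sub>R u) x < d" if "0 \<le> r" "r \<le> t" "0 \<le> s" "s \<le> t" for r s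
    using near[of s r] that by (simp add: add_ac)
  obtain r' s' where 2: "0 < r'" "r' < t" "0 < s'" "s' < t"
    "f (x + t *\<^sub>R v + t *\<^sub>R u) - f (x + t *\<^sub>R v) - f (x + t *\<^sub>R u) + f x = t * t * F v u (x + r' *\<^sub>R v + s' *\<^sub>R u)"
    by (rule mixed_difference[OF assms(3) t, of x v u]) (use d(2)[OF near'] that in \<open>auto simp: F_def\<close>)
  have "F u v (x + r *\<^sub>R u + s *\<^sub>R v) = F v u (x + s' *\<^sub>R u + r' *\<^sub>R v)"
  proof -
    have *: "x + t *\<^sub>R v + t *\<^sub>R u = x + t *\<^sub>R u + t *\<^sub>R v" by simp
    have "t * t * F u v (x + r *\<^sub>R u + s *\<^sub>R v) = t * t * F v u (x + r' *\<^sub>R v + s' *\<^sub>R u)"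
      using 1(5) 2(5)[unfolded *] by linarith
    then show ?thesis using t by (simp add: add_ac)
  qed
  then show False
    using d(2)[OF near[of r s]] d(2)[OF near[of s' r']] 1 2 e unfolding dist_real_def by (smt (verit))
qed

lemma dd_bounded_linear:
  assumes "bounded_linear L" "f differentiable (at x)"
  shows "dd (\<lambda>z. L (f z)) x u = L (dd f x u)"
  using dd_eqI[OF bounded_linear.has_derivative[OF assms(1) dd_has_derivative[OF assms(2)]]] by simp

lemma symmetric_second_derivative:
  fixes f :: "'v::real_normed_vector \<Rightarrow> 'w::euclidean_space"
  assumes "open S" "x \<in> S" "smooth_on S f"
  shows "dd (\<lambda>z. dd f z u) x v = dd (\<lambda>z. dd f z v) x u"
proof (rule euclidean_eqI)
  fix b :: 'w
  have *: "dd (\<lambda>z. dd f z u) x v \<bullet> b = dd (\<lambda>z. dd (\<lambda>z. f z \<bullet> b) z u) x v" for u v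
  proof -
    have "dd (\<lambda>z. dd f z u) x v \<bullet> b = dd (\<lambda>z. dd f z u \<bullet> b) x v"
      by (rule dd_bounded_linear[OF bounded_linear_inner_left, symmetric])
        (use smooth_on_differentiable[OF smooth_on_dd[OF assms(3)] assms(2)] in auto)
    also have "\<dots> = dd (\<lambda>z. dd (\<lambda>z. f z \<bullet> b) z u) x v"
      by (intro dd_cong[OF assms(1,2), THEN fun_cong]
         dd_bounded_linear[OF bounded_linear_inner_left, symmetric] smooth_on_differentiable[OF assms(3)])
    finally show ?thesis .
  qed
  show "dd (\<lambda>z. dd f z u) x v \<bullet> b = dd (\<lambda>z. dd f z v) x u \<bullet> b"
    unfolding *
    by (rule symmetric_second_derivative_real[OF assms(1,2)])
      (use smooth_on_inner_left[OF assms(1,3)] in \<open>simp add: smooth_on_def del: Ck_on.simps\<close>)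
qed

section \<open>Inner products depending smoothly on a point\<close>

definition inner_form :: "('v::real_vector \<Rightarrow> 'v \<Rightarrow> real) \<Rightarrow> bool"
  where "inner_form k \<longleftrightarrow> bilinear k \<and> (\<forall>u v. k u v = k v u) \<and> (\<forall>u. u \<noteq> 0 \<longrightarrow> k u u > 0)"

lemma bilinearI':
  assumes "\<And>u u' v. B (u + u') v = B u v + B u' v" "\<And>u v v'. B u (v + v') = B u v + B u v'"
    "\<And>r u v. B (r *\<^sub>R u) v = r *\<^sub>R B u v" "\<And>r u v. B u (r *\<^sub>R v) = r *\<^sub>R B u v"
  shows "bilinear B"
  using assms by (auto simp: bilinear_def intro!: linearI)

lemma bilinear_linear_left: "bilinear B \<Longrightarrow> linear (\<lambda>u. B u v)"
  and bilinear_linear_right: "bilinear B \<Longrightarrow> linear (B u)"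
  by (auto simp: bilinear_def)

lemma bilinear_sum_left: "bilinear B \<Longrightarrow> B (\<Sum>i\<in>I. f i) v = (\<Sum>i\<in>I. B (f i) v)"
  by (rule linear_sum[OF bilinear_linear_left])

lemma bilinear_sum_right: "bilinear B \<Longrightarrow> B v (\<Sum>i\<in>I. f i) = (\<Sum>i\<in>I. B v (f i))"
  by (rule linear_sum[OF bilinear_linear_right])

lemmas bilinear_simps = bilinear_ladd bilinear_radd bilinear_lmul bilinear_rmul bilinear_lneg
  bilinear_rneg bilinear_lsub bilinear_rsub bilinear_lzero bilinear_rzero bilinear_sum_left bilinear_sum_right

context
  fixes k :: "'v::euclidean_space \<Rightarrow> 'v \<Rightarrow> real"
  assumes k: "inner_form k"
begin

lemma inner_form_bilinear: "bilinear k" and inner_form_sym: "k u v = k v u"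
  and inner_form_pos: "u \<noteq> 0 \<Longrightarrow> k u u > 0"
  using k by (auto simp: inner_form_def)

lemmas inner_form_simps = bilinear_simps[OF inner_form_bilinear]

lemma inner_form_eq_zero: "k u u = 0 \<longleftrightarrow> u = 0"
  using inner_form_pos[of u] bilinear_lzero[OF inner_form_bilinear] by force

lemma inner_form_ext: "(\<And>v. k u v = k u' v) \<Longrightarrow> u = u'"
  using inner_form_eq_zero[of "u - u'"] by (simp add: bilinear_lsub[OF inner_form_bilinear])

lemma sharp_exists: "\<exists>u. \<forall>v. k u v = x \<bullet> v"
proof -
  define L where "L u = (\<Sum>b\<in>Basis. k u b *\<^sub>R b)" for u
  have L: "L u \<bullet> v = k u v" for u v
  proof -
    have "k u v = (\<Sum>b\<in>Basis. (v \<bullet> b) *\<^sub>R k u b)"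
      by (rule linear_basis_sum[OF bilinear_linear_right[OF inner_form_bilinear]])
    moreover have "L u \<bullet> v = (\<Sum>b\<in>Basis. k u b * (b \<bullet> v))" by (simp add: L_def inner_sum_left)
    ultimately show ?thesis by (simp add: inner_commute mult.commute)
  qed
  have "linear L"
    by (rule linearI) (simp_all add: L_def inner_form_simps scaleR_add_left sum.distrib scaleR_sum_right)
  moreover have "inj L"
    using L inner_form_ext by (metis injI)
  ultimately have "surj L" by (rule linear_inj_imp_surj)
  then show ?thesis using L by (metis surj_def)
qed

end

text \<open>Index raising by \<open>k\<close>, a covector being written as
  \<open>v \<mapsto> x \<bullet> v\<close>. For a basis vector \<open>b\<close>,
  \<open>sharp k b\<close> is the corresponding column of the inverse matrix of
  \<open>k\<close>.\<close>

definition sharp :: "('v::euclidean_space \<Rightarrow> 'v \<Rightarrow> real) \<Rightarrow> 'v \<Rightarrow> 'v"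
  where "sharp k x = (THE u. \<forall>v. k u v = x \<bullet> v)"

context
  fixes k :: "'v::euclidean_space \<Rightarrow> 'v \<Rightarrow> real"
  assumes k: "inner_form k"
begin

lemma sharp_unique: "(\<And>v. k u v = x \<bullet> v) \<Longrightarrow> sharp k x = u"
  unfolding sharp_def by (rule the_equality) (auto intro: inner_form_ext[OF k])

lemma sharp_inner: "k (sharp k x) v = x \<bullet> v"
  using sharp_exists[OF k, of x] sharp_unique by metis

lemma linear_sharp: "linear (sharp k)"
  by (rule linearI; rule sharp_unique)
    (simp_all add: inner_form_simps[OF k] sharp_inner inner_add_left)

text \<open>Minimum over the compact unit sphere, then homogeneity. The constant bounds the inverse
  metric in \<open>isCont_sharp\<close>.\<close>

lemma inner_form_lower_bound: obtains c where "c > 0" "\<And>w. k w w \<ge> c * (norm w)\<^sup>2"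
proof -
  have bb: "bounded_bilinear k" using inner_form_bilinear[OF k] by (simp add: bilinear_conv_bounded_bilinear)
  have "continuous_on (sphere 0 1) (\<lambda>w. k w w)"
    by (intro bounded_bilinear.continuous_on[OF bb] continuous_on_id)
  moreover have "sphere (0::'v) 1 \<noteq> {}" by simp
  ultimately obtain w0 where w0: "w0 \<in> sphere 0 1" "\<And>w. w \<in> sphere 0 1 \<Longrightarrow> k w0 w0 \<le> k w w"
    using continuous_attains_inf[OF compact_sphere, of "0::'v" 1 "\<lambda>w. k w w"] by auto
  have "k w w \<ge> k w0 w0 * (norm w)\<^sup>2" for w
  proof (cases "w = 0")
    case False
    have "k w0 w0 \<le> k ((1 / norm w) *\<^sub>R w) ((1 / norm w) *\<^sub>R w)"
      using False by (intro w0(2)) simp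
    then show ?thesis using False
      by (simp add: inner_form_simps[OF k] power2_eq_square field_simps)
  qed (simp add: inner_form_simps[OF k])
  moreover have "k w0 w0 > 0" using w0(1) by (intro inner_form_pos[OF k]) auto
  ultimately show thesis using that by blast
qed

section \<open>Orthonormal bases and traces\<close>

lemma orthonormal_independent:
  assumes "finite C" "\<And>u v. u \<in> C \<Longrightarrow> v \<in> C \<Longrightarrow> k u v = (if u = v then 1 else 0)"
  shows "independent C"
proof (rule independent_if_scalars_zero[OF assms(1)])
  fix f x assume f: "(\<Sum>x\<in>C. f x *\<^sub>R x) = 0" "x \<in> C"
  have "0 = k (\<Sum>x\<in>C. f x *\<^sub>R x) x" using f by (simp add: inner_form_simps[OF k])
  also have "\<dots> = (\<Sum>y\<in>C. f y * k y x)" by (simp add: inner_form_simps[OF k])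
  also have "\<dots> = (\<Sum>y\<in>C. if y = x then f y else 0)" using assms f by (intro sum.cong) auto
  also have "\<dots> = f x" using assms f by simp
  finally show "f x = 0" by simp
qed

lemma orthonormal_residual:
  assumes "finite C" "\<And>u v. u \<in> C \<Longrightarrow> v \<in> C \<Longrightarrow> k u v = (if u = v then 1 else 0)" "e \<in> C"
  shows "k (u - (\<Sum>e\<in>C. k u e *\<^sub>R e)) e = 0"
proof -
  have "k (\<Sum>x\<in>C. k u x *\<^sub>R x) e = (\<Sum>y\<in>C. k u y * k y e)"
    by (simp add: inner_form_simps[OF k])
  also have "\<dots> = (\<Sum>y\<in>C. if y = e then k u y else 0)" using assms by (intro sum.cong) auto
  finally have "k (\<Sum>x\<in>C. k u x *\<^sub>R x) e = k u e" using assms by simp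
  then show ?thesis by (simp add: bilinear_lsub[OF inner_form_bilinear[OF k]])
qed

text \<open>An orthonormal set of greatest cardinality is taken. If it had fewer than
  \<open>DIM('v)\<close> elements it would not span, and one Gram-Schmidt step would enlarge
  it.\<close>

lemma orthonormal_basis_exists: "\<exists>B. orthonormal_basis k B"
proof -
  define P where "P C \<longleftrightarrow> finite C \<and> (\<forall>u\<in>C. \<forall>v\<in>C. k u v = (if u = v then 1 else 0))" for C
  have "card C < Suc DIM('v)" if "P C" for C
    using independent_card_le[OF orthonormal_independent, of C] that by (auto simp: P_def less_Suc_eq_le)
  moreover have "P {}" by (simp add: P_def)
  ultimately obtain C where C: "P C" "\<And>D. P D \<Longrightarrow> card D \<le> card C"
    using ex_has_greatest_nat[of P "{}" card "Suc DIM('v)"] by blast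
  have fin: "finite C" and on: "\<And>u v. u \<in> C \<Longrightarrow> v \<in> C \<Longrightarrow> k u v = (if u = v then 1 else 0)"
    using C(1) by (auto simp: P_def)
  have "card C = DIM('v)"
  proof (rule ccontr)
    assume neq: "card C \<noteq> DIM('v)"
    have "span C \<noteq> UNIV"
      using neq dim_eq_card_independent[OF orthonormal_independent[OF fin on]] dim_span[of C] dim_UNIV
      by metis
    then obtain x where x: "x \<notin> span C" by blast
    define w where "w = x - (\<Sum>e\<in>C. k x e *\<^sub>R e)"
    have w0: "w \<noteq> 0" using x span_sum[of C "\<lambda>e. k x e *\<^sub>R e" C] by (auto simp: w_def span_base span_scale)
    define e where "e = (1 / sqrt (k w w)) *\<^sub>R w"
    have kw: "k w w > 0" by (rule inner_form_pos[OF k w0])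
    have "k w u = 0" if "u \<in> C" for u
      unfolding w_def by (rule orthonormal_residual[OF fin on that])
    then have eC: "k e u = 0" "k u e = 0" if "u \<in> C" for u
      using that inner_form_sym[OF k] by (auto simp: e_def inner_form_simps[OF k])
    have ee: "k e e = 1"
      using kw by (simp add: e_def inner_form_simps[OF k])
    have "e \<notin> C" using eC ee by fastforce
    moreover have "P (insert e C)" using eC ee on fin \<open>e \<notin> C\<close> by (auto simp: P_def)
    ultimately show False using C(2)[of "insert e C"] fin by simp
  qed
  then show ?thesis using fin on by (auto simp: orthonormal_basis_def)
qed

context
  fixes B assumes B: "orthonormal_basis k B"
begin

lemma orthonormal_expansion: "u = (\<Sum>e\<in>B. k u e *\<^sub>R e)"
proof -
  have fin: "finite B" and on: "\<And>u v. u \<in> B \<Longrightarrow> v \<in> B \<Longrightarrow> k u v = (if u = v then 1 else 0)"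
    and card: "card B = DIM('v)" using B by (auto simp: orthonormal_basis_def)
  define w where "w = u - (\<Sum>e\<in>B. k u e *\<^sub>R e)"
  have "span B = UNIV"
    using card_eq_dim[of B UNIV] orthonormal_independent[OF fin on] fin card by auto
  have "k w v = 0" if "v \<in> span B" for v
    using that
  proof (induction rule: span_induct_alt)
    case base then show ?case by (simp add: inner_form_simps[OF k])
  next
    case (step c x y)
    then show ?case using orthonormal_residual[OF fin on, of x u]
      by (simp add: w_def inner_form_simps[OF k])
  qed
  then have "k w w = 0" using \<open>span B = UNIV\<close> by simp
  then have "w = 0" using inner_form_eq_zero[OF k] by simp
  then show ?thesis by (simp add: w_def)
qed

lemma orthonormal_parseval: "k u v = (\<Sum>e\<in>B. k u e * k v e)"
  using arg_cong[OF orthonormal_expansion[of v], of "k u"]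
  by (simp add: inner_form_simps[OF k] mult.commute)

lemma orthonormal_linear_expansion:
  assumes "linear L" shows "L u = (\<Sum>e\<in>B. k u e *\<^sub>R L e)"
  using arg_cong[OF orthonormal_expansion[of u], of L]
  by (simp add: linear_sum[OF assms] linear_scale[OF assms])

text \<open>Both sides contract \<open>Q\<close> with the inverse metric, since
  \<open>sharp k b\<close> has the coefficients \<open>e \<bullet> b\<close> in the frame. So the
  left side does not depend on the frame, and the right side, whose basis is independent of the
  metric, can be differentiated when the metric varies.\<close>

lemma sum_orthonormal_sharp:
  assumes Q: "bilinear Q"
  shows "(\<Sum>e\<in>B. Q e e) = (\<Sum>b\<in>Basis. Q b (sharp k b))"
proof -
  have s: "sharp k b = (\<Sum>e\<in>B. (e \<bullet> b) *\<^sub>R e)" for b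
    using orthonormal_expansion[of "sharp k b"] by (simp add: sharp_inner inner_commute)
  have "(\<Sum>e\<in>B. Q e e) = (\<Sum>e\<in>B. \<Sum>b\<in>Basis. (e \<bullet> b) *\<^sub>R Q b e)"
    using linear_basis_sum[OF bilinear_linear_left[OF Q]] by (intro sum.cong refl) blast
  also have "\<dots> = (\<Sum>b\<in>Basis. Q b (sharp k b))"
    unfolding s bilinear_sum_right[OF Q] by (subst sum.swap) (simp add: bilinear_rmul[OF Q])
  finally show ?thesis .
qed

end

lemma metric_trace_eq:
  assumes B: "orthonormal_basis k B" and Q: "bilinear Q"
  shows "metric_trace k Q = (\<Sum>e\<in>B. Q e e)"
proof -
  have "orthonormal_basis k (SOME B. orthonormal_basis k B)"
    using B by (rule someI)
  then show ?thesis
    unfolding metric_trace_def using sum_orthonormal_sharp[OF _ Q] sum_orthonormal_sharp[OF B Q] by simp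
qed

end

lemma metric_trace_sharp:
  assumes "inner_form k" "bilinear Q"
  shows "metric_trace k Q = (\<Sum>b\<in>Basis. Q b (sharp k b))"
  using orthonormal_basis_exists[OF assms(1)] metric_trace_eq[OF assms(1) _ assms(2)]
    sum_orthonormal_sharp[OF assms(1) _ assms(2)] by metis

text \<open>A product rule at a zero of \<open>f\<close> for a factor \<open>g\<close> that is
  merely continuous. It lets the differentiability of \<open>sharp\<close> be deduced from its
  continuity.\<close>

lemma has_derivative_scaleR_zero:
  fixes f :: "'u::real_normed_vector \<Rightarrow> real" and g :: "'u \<Rightarrow> 'w::real_normed_vector"
  assumes "(f has_derivative f') (at y)" "f y = 0" "isCont g y"
  shows "((\<lambda>z. f z *\<^sub>R g z) has_derivative (\<lambda>v. f' v *\<^sub>R g y)) (at y)"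
proof -
  have bl: "bounded_linear f'" using assms(1) has_derivative_bounded_linear by blast
  obtain K where K: "K > 0" "\<And>v. norm (f' v) \<le> norm v * K" using bounded_linear.pos_bounded[OF bl] by blast
  define e where "e h = (f (y + h) - f' h) / norm h" for h
  have e: "(e \<longlongrightarrow> 0) (at 0)"
  proof (rule tendsto_norm_zero_cancel)
    show "((\<lambda>h. norm (e h)) \<longlongrightarrow> 0) (at 0)"
      using assms(1,2) by (simp add: has_derivative_at e_def)
  qed
  have g: "((\<lambda>h. g (y + h)) \<longlongrightarrow> g y) (at 0)" using assms(3) by (simp add: isCont_iff)
  have "((\<lambda>h. norm (e h *\<^sub>R g (y + h)) + K * norm (g (y + h) - g y)) \<longlongrightarrow> norm (0 *\<^sub>R g y) + K * norm (g y - g y)) (at 0)"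
    by (intro tendsto_intros e g)
  then have lim: "((\<lambda>h. norm (e h *\<^sub>R g (y + h)) + K * norm (g (y + h) - g y)) \<longlongrightarrow> 0) (at 0)" by simp
  have "((\<lambda>h. norm (f (y + h) *\<^sub>R g (y + h) - f y *\<^sub>R g y - f' h *\<^sub>R g y) / norm h) \<longlongrightarrow> 0) (at 0)"
  proof (rule tendsto_sandwich[OF _ _ tendsto_const lim])
    show "\<forall>\<^sub>F h in at 0. norm (f (y + h) *\<^sub>R g (y + h) - f y *\<^sub>R g y - f' h *\<^sub>R g y) / norm h
        \<le> norm (e h *\<^sub>R g (y + h)) + K * norm (g (y + h) - g y)"
      unfolding eventually_at
    proof (intro exI[of _ 1] conjI ballI impI)
      fix h :: 'u assume "h \<noteq> 0 \<and> dist h 0 < 1"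
      then have h: "norm h > 0" by simp
      have "f (y + h) = norm h * e h + f' h" using h by (simp add: e_def)
      then have "f (y + h) *\<^sub>R g (y + h) - f y *\<^sub>R g y - f' h *\<^sub>R g y
          = norm h *\<^sub>R (e h *\<^sub>R g (y + h)) + f' h *\<^sub>R (g (y + h) - g y)"
        using assms(2) by (simp add: algebra_simps)
      then have "norm (f (y + h) *\<^sub>R g (y + h) - f y *\<^sub>R g y - f' h *\<^sub>R g y)
          \<le> norm h * norm (e h *\<^sub>R g (y + h)) + \<bar>f' h\<bar> * norm (g (y + h) - g y)"
        using norm_triangle_ineq[of "norm h *\<^sub>R (e h *\<^sub>R g (y + h))" "f' h *\<^sub>R (g (y + h) - g y)"]
        by (simp add: abs_mult mult.assoc)
      also have "\<dots> \<le> norm h * norm (e h *\<^sub>R g (y + h)) + (norm h * K) * norm (g (y + h) - g y)"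
        using K(2)[of h] by (intro add_left_mono mult_right_mono) auto
      finally show "norm (f (y + h) *\<^sub>R g (y + h) - f y *\<^sub>R g y - f' h *\<^sub>R g y) / norm h
        \<le> norm (e h *\<^sub>R g (y + h)) + K * norm (g (y + h) - g y)"
        using h by (simp add: field_simps)
    qed simp
  qed simp
  moreover have "bounded_linear (\<lambda>v. f' v *\<^sub>R g y)"
    using bounded_linear_compose[OF bounded_linear_scaleR_left bl] .
  ultimately show ?thesis unfolding has_derivative_at by simp
qed

section \<open>Smooth dependence of the inverse metric on the point\<close>

context
  fixes h :: "'u::euclidean_space \<Rightarrow> 'v::euclidean_space \<Rightarrow> 'v \<Rightarrow> real" and S
  assumes S: "open S" and h: "\<And>z. z \<in> S \<Longrightarrow> inner_form (h z)"
    and smooth_h: "\<And>u v. smooth_on S (\<lambda>z. h z u v)"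
begin

text \<open>A perturbation estimate. With \<open>w\<close> the difference of the two solutions and
  \<open>r z\<close> the defect of the solution at \<open>y\<close> in the equation at
  \<open>z\<close>, one has \<open>h z w w = - (r z \<bullet> w)\<close>. Once the matrix entries
  differ by less than \<open>c / 2\<close> in total, \<open>h z\<close> still has the lower bound
  \<open>c / 2\<close>, so \<open>norm w\<close> is at most \<open>2 / c\<close> times
  \<open>norm (r z)\<close>, which tends to 0.\<close>

lemma isCont_sharp:
  assumes y: "y \<in> S"
  shows "isCont (\<lambda>z. sharp (h z) x) y"
proof -
  have cont: "((\<lambda>z. h z u v) \<longlongrightarrow> h y u v) (at y)" for u v
    using differentiable_imp_continuous_within[OF smooth_on_differentiable[OF smooth_h y]]
    by (simp add: isCont_def)
  obtain c where c: "c > 0" "\<And>w. h y w w \<ge> c * (norm w)\<^sup>2"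
    using inner_form_lower_bound[OF h[OF y]] by blast
  define u where "u = sharp (h y) x"
  define d where "d z = (\<Sum>b\<in>Basis. \<Sum>b'\<in>Basis. \<bar>h z b b' - h y b b'\<bar>)" for z
  define r where "r z = (\<Sum>b\<in>Basis. (h z u b - h y u b) *\<^sub>R b)" for z
  have "(d \<longlongrightarrow> (\<Sum>b\<in>Basis. \<Sum>b'\<in>Basis. \<bar>h y b b' - h y b b'\<bar>)) (at y)"
    unfolding d_def by (intro tendsto_intros cont)
  then have "(d \<longlongrightarrow> 0) (at y)" by simp
  then have evd: "\<forall>\<^sub>F z in at y. d z < c / 2"
    using c(1) by (intro order_tendstoD) auto
  have "(r \<longlongrightarrow> (\<Sum>b\<in>Basis. (h y u b - h y u b) *\<^sub>R b)) (at y)"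
    unfolding r_def by (intro tendsto_intros cont)
  then have r0: "((\<lambda>z. 2 / c * norm (r z)) \<longlongrightarrow> 0) (at y)"
    using c(1) by (auto intro!: tendsto_eq_intros)
  have bound: "norm (sharp (h z) x - u) \<le> 2 / c * norm (r z)" if z: "z \<in> S" and dz: "d z < c / 2" for z
  proof -
    define w where "w = sharp (h z) x - u"
    note bz = inner_form_bilinear[OF h[OF z]] and byy = inner_form_bilinear[OF h[OF y]]
    have exp: "k w w = (\<Sum>b\<in>Basis. \<Sum>b'\<in>Basis. (w \<bullet> b) * (w \<bullet> b') * k b b')" if "bilinear k" for k
    proof -
      have "k w w = (\<Sum>b\<in>Basis. (w \<bullet> b) *\<^sub>R k b w)"
        by (rule linear_basis_sum[OF bilinear_linear_left[OF that]])
      also have "\<dots> = (\<Sum>b\<in>Basis. (w \<bullet> b) *\<^sub>R (\<Sum>b'\<in>Basis. (w \<bullet> b') *\<^sub>R k b b'))"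
        by (intro sum.cong refl arg_cong[where f = "scaleR _"] linear_basis_sum[OF bilinear_linear_right[OF that]])
      finally show ?thesis by (simp add: sum_distrib_left mult.assoc)
    qed
    have "\<bar>h z w w - h y w w\<bar> = \<bar>\<Sum>b\<in>Basis. \<Sum>b'\<in>Basis. (w \<bullet> b) * (w \<bullet> b') * (h z b b' - h y b b')\<bar>"
      by (simp add: exp[OF bz] exp[OF byy] sum_subtractf[symmetric] right_diff_distrib)
    also have "\<dots> \<le> (\<Sum>b\<in>Basis. \<Sum>b'\<in>Basis. \<bar>(w \<bullet> b) * (w \<bullet> b') * (h z b b' - h y b b')\<bar>)"
      by (rule order_trans[OF sum_abs]) (intro sum_mono sum_abs)
    also have "\<dots> \<le> (\<Sum>b\<in>Basis. \<Sum>b'\<in>Basis. (norm w)\<^sup>2 * \<bar>h z b b' - h y b b'\<bar>)"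
      unfolding abs_mult power2_eq_square
      by (intro sum_mono mult_right_mono mult_mono Basis_le_norm) auto
    also have "\<dots> = (norm w)\<^sup>2 * d z" by (simp add: d_def sum_distrib_left)
    also have "\<dots> \<le> (norm w)\<^sup>2 * (c / 2)" using dz by (intro mult_left_mono) auto
    finally have F: "\<bar>h z w w - h y w w\<bar> \<le> (norm w)\<^sup>2 * (c / 2)" .
    have "c / 2 * (norm w)\<^sup>2 \<le> h z w w"
      using abs_le_D2[OF F] c(2)[of w] by (simp add: field_simps)
    \<comment> \<open>Both \<open>h z (sharp (h z) x)\<close> and \<open>h y u\<close> are the
      covector of \<open>x\<close>.\<close>
    also have "h z w w = - (r z \<bullet> w)"
    proof -
      have "h z w w = h y u w - h z u w"
        unfolding w_def bilinear_lsub[OF bz] by (simp add: sharp_inner[OF h[OF z]] u_def sharp_inner[OF h[OF y]])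
      moreover have "r z \<bullet> w = (\<Sum>b\<in>Basis. (h z u b - h y u b) * (b \<bullet> w))"
        by (simp add: r_def inner_sum_left)
      then have "r z \<bullet> w = h z u w - h y u w"
        using linear_basis_sum[OF bilinear_linear_right[OF bz], of u w] linear_basis_sum[OF bilinear_linear_right[OF byy], of u w]
        by (simp add: inner_commute[of w] left_diff_distrib mult.commute[of "_ \<bullet> _"] sum_subtractf)
      ultimately show ?thesis by simp
    qed
    also have "\<dots> \<le> norm (r z) * norm w" using Cauchy_Schwarz_ineq2[of "r z" w] by linarith
    finally have "norm w * (c / 2 * norm w) \<le> norm w * norm (r z)" by (simp add: power2_eq_square mult_ac)
    then have "norm w = 0 \<or> c / 2 * norm w \<le> norm (r z)" by (metis mult_le_cancel_left_pos norm_ge_zero order_le_less)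
    then show ?thesis using c(1) by (auto simp: w_def field_simps)
  qed
  have "((\<lambda>z. norm (sharp (h z) x - u)) \<longlongrightarrow> 0) (at y)"
  proof (rule tendsto_sandwich[OF _ _ tendsto_const r0])
    show "\<forall>\<^sub>F z in at y. norm (sharp (h z) x - u) \<le> 2 / c * norm (r z)"
      using evd eventually_at_in_open'[OF S y] by eventually_elim (rule bound)
  qed simp
  then show ?thesis
    unfolding isCont_def u_def[symmetric] by (simp add: LIM_zero_iff tendsto_norm_zero_iff)
qed

text \<open>The proof rests on the exact identity that \<open>sharp (h z) x\<close> equals
  \<open>u\<close> minus the sum of \<open>(h z u b - h y u b) *\<^sub>R sharp (h z) b\<close>. The
  coefficients vanish at \<open>y\<close>, so continuity of the remaining factor suffices to
  differentiate it.\<close>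

lemma has_derivative_sharp:
  assumes y: "y \<in> S"
  shows "((\<lambda>z. sharp (h z) x) has_derivative
    (\<lambda>v. - (\<Sum>b\<in>Basis. dd (\<lambda>z. h z (sharp (h y) x) b) y v *\<^sub>R sharp (h y) b))) (at y)"
proof -
  define u where "u = sharp (h y) x"
  have d: "((\<lambda>z. h z u b - h y u b) has_derivative (\<lambda>v. dd (\<lambda>z. h z u b) y v)) (at y)" for b
    using dd_has_derivative[OF smooth_on_differentiable[OF smooth_h y]] by (auto intro!: derivative_eq_intros)
  have "((\<lambda>z. u - (\<Sum>b\<in>Basis. (h z u b - h y u b) *\<^sub>R sharp (h z) b)) has_derivative
    (\<lambda>v. 0 - (\<Sum>b\<in>Basis. dd (\<lambda>z. h z u b) y v *\<^sub>R sharp (h y) b))) (at y)"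
    by (intro has_derivative_diff has_derivative_const has_derivative_sum has_derivative_scaleR_zero[OF d] isCont_sharp[OF y]) simp
  moreover have "u - (\<Sum>b\<in>Basis. (h z u b - h y u b) *\<^sub>R sharp (h z) b) = sharp (h z) x" if z: "z \<in> S" for z
  proof (rule sharp_unique[OF h[OF z], symmetric])
    fix v
    note bz = inner_form_bilinear[OF h[OF z]] and byy = inner_form_bilinear[OF h[OF y]]
    have "(\<Sum>b\<in>Basis. (h z u b - h y u b) * (b \<bullet> v)) = h z u v - h y u v"
      using linear_basis_sum[OF bilinear_linear_right[OF bz], of u v] linear_basis_sum[OF bilinear_linear_right[OF byy], of u v]
      by (simp add: inner_commute algebra_simps sum_subtractf)
    then show "h z (u - (\<Sum>b\<in>Basis. (h z u b - h y u b) *\<^sub>R sharp (h z) b)) v = x \<bullet> v"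
      by (simp add: bilinear_simps[OF bz] sharp_inner[OF h[OF z]]) (simp add: u_def sharp_inner[OF h[OF y]])
  qed
  ultimately show ?thesis
    by (auto intro: has_derivative_transform_within_open[OF _ S y] simp: u_def)
qed

text \<open>Bootstrapping: the derivative of \<open>sharp\<close> is built from \<open>sharp\<close>
  itself and derivatives of \<open>h\<close>, so being k times differentiable for all right hand
  sides \<open>x\<close> implies it for k + 1. The point-dependent argument
  \<open>sharp (h z) x\<close> inside \<open>dd\<close> is expanded in the basis first.\<close>

lemma smooth_on_sharp: "smooth_on S (\<lambda>z. sharp (h z) x)"
proof -
  have "Ck_on k (\<lambda>z. sharp (h z) x) S" for k
  proof (induction k arbitrary: x)
    case 0
    then show ?case by (auto intro!: continuous_at_imp_continuous_on isCont_sharp)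
  next
    case (Suc k)
    have dh: "(\<lambda>z. h z u b) differentiable (at z)" if "z \<in> S" for u b z
      using smooth_on_differentiable[OF smooth_h that] .
    have lin: "dd (\<lambda>z. h z u b) y v = (\<Sum>b'\<in>Basis. (u \<bullet> b') *\<^sub>R dd (\<lambda>z. h z b' b) y v)" if "y \<in> S" for u b y v
    proof (rule dd_transform[OF _ S that])
      show "((\<lambda>z. \<Sum>b'\<in>Basis. (u \<bullet> b') *\<^sub>R h z b' b) has_derivative
          (\<lambda>v. \<Sum>b'\<in>Basis. (u \<bullet> b') *\<^sub>R dd (\<lambda>z. h z b' b) y v)) (at y)"
        by (intro has_derivative_sum has_derivative_scaleR_right dd_has_derivative dh that)
    qed (use linear_basis_sum[OF bilinear_linear_left[OF inner_form_bilinear[OF h]]] in metis)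
    have "Ck_on k (\<lambda>z. dd (\<lambda>z. sharp (h z) x) z v) S" for v
    proof (rule Ck_on_cong[OF S])
      show "Ck_on k (\<lambda>z. - (\<Sum>b\<in>Basis. (\<Sum>b'\<in>Basis. (sharp (h z) x \<bullet> b') *\<^sub>R dd (\<lambda>z. h z b' b) z v) *\<^sub>R sharp (h z) b)) S"
        using smooth_on_dd[OF smooth_h] unfolding smooth_on_def
        by (intro Ck_on_bounded_linear[OF S bounded_linear_minus[OF bounded_linear_ident]] Ck_on_sum[OF S] Ck_on_scaleR[OF S]
            Ck_on_bounded_linear[OF S bounded_linear_inner_left] Suc.IH) blast
    qed (simp add: dd_eqI[OF has_derivative_sharp] lin)
    moreover have "(\<lambda>z. sharp (h z) x) differentiable (at z)" if "z \<in> S" for z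
      using has_derivative_sharp[OF that] by (auto simp: differentiable_def)
    ultimately show ?case by simp
  qed
  then show ?thesis by (simp add: smooth_on_def)
qed

end

section \<open>Connections and curvature\<close>

text \<open>The right hand side of the Koszul formula for constant fields, whose brackets
  vanish.\<close>

definition koszul :: "'v::euclidean_space metric \<Rightarrow> 'v \<Rightarrow> 'v \<Rightarrow> 'v \<Rightarrow> 'v \<Rightarrow> real"
  where "koszul G x u v w = (dd (\<lambda>z. G z v w) x u + dd (\<lambda>z. G z u w) x v - dd (\<lambda>z. G z u v) x w) / 2"

definition riem :: "'v::euclidean_space metric \<Rightarrow> 'v \<Rightarrow> 'v \<Rightarrow> 'v \<Rightarrow> 'v \<Rightarrow> 'v"
  where "riem G x u v w = curvature G (\<lambda>_. u) (\<lambda>_. v) (\<lambda>_. w) x"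

locale riemannian =
  fixes \<Omega> :: "'q::euclidean_space set" and G :: "'q metric"
  assumes open_Omega: "open \<Omega>" and riemannian_G: "riemannian_metric_on \<Omega> G"
begin

lemma inner_form_G: "x \<in> \<Omega> \<Longrightarrow> inner_form (G x)"
  and smooth_G: "smooth_on \<Omega> (\<lambda>x. G x u v)"
  using riemannian_G by (auto simp: riemannian_metric_on_def inner_form_def)

lemmas G_bilinear = inner_form_bilinear[OF inner_form_G]
  and G_sym = inner_form_sym[OF inner_form_G]

lemmas G_simps = bilinear_simps[OF G_bilinear]

lemma differentiable_G: "x \<in> \<Omega> \<Longrightarrow> (\<lambda>z. G z u v) differentiable (at x)"
  by (rule smooth_on_differentiable[OF smooth_G])

lemma dd_G_linear:
  assumes "x \<in> \<Omega>"
  shows "dd (\<lambda>z. G z (v + v') w) x u = dd (\<lambda>z. G z v w) x u + dd (\<lambda>z. G z v' w) x u"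
    and "dd (\<lambda>z. G z (r *\<^sub>R v) w) x u = r * dd (\<lambda>z. G z v w) x u"
    and "dd (\<lambda>z. G z v w) x u = dd (\<lambda>z. G z w v) x u"
    and "dd (\<lambda>z. G z v w) x (u + u') = dd (\<lambda>z. G z v w) x u + dd (\<lambda>z. G z v w) x u'"
    and "dd (\<lambda>z. G z v w) x (r *\<^sub>R u) = r * dd (\<lambda>z. G z v w) x u"
proof -
  note d = dd_has_derivative[OF differentiable_G[OF assms]]
  show "dd (\<lambda>z. G z (v + v') w) x u = dd (\<lambda>z. G z v w) x u + dd (\<lambda>z. G z v' w) x u"
    by (rule dd_transform[OF _ open_Omega assms],
        rule has_derivative_add[OF d d]) (simp add: G_simps)
  show "dd (\<lambda>z. G z (r *\<^sub>R v) w) x u = r * dd (\<lambda>z. G z v w) x u"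
    by (rule dd_transform[OF _ open_Omega assms],
        rule has_derivative_mult_right[OF d]) (simp add: G_simps)
  show "dd (\<lambda>z. G z v w) x u = dd (\<lambda>z. G z w v) x u"
    by (rule dd_cong[OF open_Omega assms, THEN fun_cong]) (rule G_sym)
qed (use linear_dd[OF differentiable_G[OF assms]] in \<open>auto simp: linear_add linear_scale\<close>)

lemma dd_G_linear_right:
  assumes "x \<in> \<Omega>"
  shows "dd (\<lambda>z. G z v (w + w')) x u = dd (\<lambda>z. G z v w) x u + dd (\<lambda>z. G z v w') x u"
    and "dd (\<lambda>z. G z v (r *\<^sub>R w)) x u = r * dd (\<lambda>z. G z v w) x u"
  using dd_G_linear(1)[OF assms, of w w' v u] dd_G_linear(2)[OF assms, of r w v u]
  by (simp_all add: dd_G_linear(3)[OF assms, of v])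

section \<open>Existence, uniqueness and smoothness of the Levi-Civita connection\<close>

lemma koszul_linear: "x \<in> \<Omega> \<Longrightarrow> linear (koszul G x u v)"
  by (rule linearI) (simp_all add: koszul_def dd_G_linear dd_G_linear_right field_simps)

text \<open>In the Koszul combination of the three compatibility equations, symmetry of
  \<open>B\<close> leaves only twice \<open>G x (B u v) w\<close>. As \<open>christoffel\<close> is
  a definite description, this is also the way to identify it for the induced and the product
  metric.\<close>

lemma christoffel_unique:
  assumes "x \<in> \<Omega>" and B: "bilinear B" "\<And>u v. B u v = B v u"
    "\<And>u v w. dd (\<lambda>z. G z v w) x u = G x (B u v) w + G x v (B u w)"
  shows "G x (B u v) w = koszul G x u v w" "christoffel G x = B"
proof -
  have *: "G x (B u v) w = koszul G x u v w" if B: "\<And>u v. B u v = B v u"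
    "\<And>u v w. dd (\<lambda>z. G z v w) x u = G x (B u v) w + G x v (B u w)" for B u v w
  proof -
    have "dd (\<lambda>z. G z v w) x u + dd (\<lambda>z. G z u w) x v - dd (\<lambda>z. G z u v) x w = 2 * G x (B u v) w"
      unfolding B(2) using B(1)[of w u] B(1)[of w v] B(1)[of u v]
      by (simp add: G_sym[OF assms(1), of u] G_sym[OF assms(1), of v])
    then show ?thesis by (simp add: koszul_def)
  qed
  show "G x (B u v) w = koszul G x u v w" by (rule *[OF B(2,3)])
  show "christoffel G x = B"
    unfolding christoffel_def
  proof (rule the_equality)
    fix B' assume B': "bilinear B' \<and> (\<forall>u v. B' u v = B' v u) \<and>
      (\<forall>u v w. dd (\<lambda>z. G z v w) x u = G x (B' u v) w + G x v (B' u w))"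
    have "G x (B' u v) w = G x (B u v) w" for u v w
      using *[of B' u v w] *[OF B(2,3), of u v w] B' by auto
    then show "B' = B" by (intro ext inner_form_ext[OF inner_form_G[OF assms(1)]])
  qed (use B in auto)
qed

text \<open>Existence, by raising the index of the Koszul expression. The explicit formula also
  gives the smoothness of the symbols.\<close>

lemma christoffel_sharp:
  assumes x: "x \<in> \<Omega>"
  defines "B \<equiv> (\<lambda>u v. sharp (G x) (\<Sum>b\<in>Basis. koszul G x u v b *\<^sub>R b))"
  shows "christoffel G x = B"
    and "bilinear B \<and> (\<forall>u v. B u v = B v u) \<and>
      (\<forall>u v w. dd (\<lambda>z. G z v w) x u = G x (B u v) w + G x v (B u w))"
proof -
  note iG = inner_form_G[OF x]
  have B: "G x (B u v) w = koszul G x u v w" for u v w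
    unfolding B_def sharp_inner[OF iG] inner_sum_left
    using linear_basis_sum[OF koszul_linear[OF x], of u v w] by (simp add: inner_commute mult.commute)
  have bil: "bilinear B"
    by (rule bilinearI'; rule inner_form_ext[OF iG])
      (simp_all add: G_simps[OF x] B koszul_def dd_G_linear[OF x] dd_G_linear_right[OF x] field_simps)
  have sym: "B u v = B v u" for u v
    by (rule inner_form_ext[OF iG]) (simp add: B koszul_def dd_G_linear(3)[OF x, of u v])
  have compat: "dd (\<lambda>z. G z v w) x u = G x (B u v) w + G x v (B u w)" for u v w
    unfolding G_sym[OF x, of v] B koszul_def
    by (simp add: dd_G_linear(3)[OF x, of w v] field_simps)
  show "christoffel G x = B" by (rule christoffel_unique[OF x bil sym compat])
  show "bilinear B \<and> (\<forall>u v. B u v = B v u) \<and>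
      (\<forall>u v w. dd (\<lambda>z. G z v w) x u = G x (B u v) w + G x v (B u w))"
    using bil sym compat by blast
qed

lemma christoffel_properties:
  assumes x: "x \<in> \<Omega>"
  shows "bilinear (christoffel G x) \<and> (\<forall>u v. christoffel G x u v = christoffel G x v u) \<and>
    (\<forall>u v w. dd (\<lambda>z. G z v w) x u = G x (christoffel G x u v) w + G x v (christoffel G x u w))"
  unfolding christoffel_sharp(1)[OF x] by (rule christoffel_sharp(2)[OF x])

lemma christoffel_bilinear: "x \<in> \<Omega> \<Longrightarrow> bilinear (christoffel G x)"
  and christoffel_sym: "x \<in> \<Omega> \<Longrightarrow> christoffel G x u v = christoffel G x v u"
  and christoffel_compat: "x \<in> \<Omega> \<Longrightarrow>
    dd (\<lambda>z. G z v w) x u = G x (christoffel G x u v) w + G x v (christoffel G x u w)"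
  using christoffel_properties[of x] by blast+

lemma christoffel_smooth: "smooth_on \<Omega> (\<lambda>x. christoffel G x u v)"
proof (rule smooth_on_cong[OF open_Omega])
  show "smooth_on \<Omega> (\<lambda>x. sharp (G x) (\<Sum>b\<in>Basis. koszul G x u v b *\<^sub>R b))"
  proof (rule smooth_on_linear[where L = "\<lambda>x. sharp (G x)", OF open_Omega])
    show "smooth_on \<Omega> (\<lambda>x. \<Sum>b\<in>Basis. koszul G x u v b *\<^sub>R b)"
      unfolding koszul_def divide_inverse
      by (intro smooth_on_sum smooth_on_scaleR smooth_on_mult smooth_on_const smooth_on_add
          smooth_on_diff smooth_on_dd smooth_G open_Omega)
  qed (auto intro: smooth_on_sharp[OF open_Omega] linear_sharp inner_form_G smooth_G)
qed (simp add: christoffel_sharp(1))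

lemmas chr_simps = bilinear_simps[OF christoffel_bilinear]

lemma differentiable_christoffel: "x \<in> \<Omega> \<Longrightarrow> (\<lambda>z. christoffel G z u v) differentiable (at x)"
  by (rule smooth_on_differentiable[OF christoffel_smooth])

lemma riem_christoffel:
  assumes "x \<in> \<Omega>"
  shows "riem G x u v w = dd (\<lambda>z. christoffel G z v w) x u - dd (\<lambda>z. christoffel G z u w) x v
    + christoffel G x u (christoffel G x v w) - christoffel G x v (christoffel G x u w)"
  by (simp add: riem_def curvature_def cov_def frechet_derivative_const chr_simps[OF assms] algebra_simps)

end

text \<open>The setting for the pull-back connection \<open>D\<close> on ambient fields along
  \<open>f\<close>. Injectivity of the differential is left out so that \<open>f\<close> may be any
  smooth map; for the identity, \<open>D\<close> is \<open>cov\<close>, and facts about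
  \<open>cov\<close> become special cases.\<close>

locale map_into_riemannian = riemannian \<Omega> G
  for \<Omega> :: "'q::euclidean_space set" and G +
  fixes S :: "'m::euclidean_space set" and f :: "'m \<Rightarrow> 'q"
  assumes open_S: "open S" and smooth_f: "smooth_on S f" and f_into: "f ` S \<subseteq> \<Omega>"
begin

abbreviation "D \<equiv> cov_along G f"

lemma f_in: "z \<in> S \<Longrightarrow> f z \<in> \<Omega>" using f_into by auto

lemma smooth_compose_f: "smooth_on \<Omega> k \<Longrightarrow> smooth_on S (\<lambda>z. k (f z))"
  for k :: "'q \<Rightarrow> 'w::real_normed_vector"
  by (rule smooth_on_compose[OF open_S _ smooth_f f_into])

lemma dd_compose_f:
  fixes k :: "'q \<Rightarrow> 'w::real_normed_vector"
  assumes "z \<in> S" "smooth_on \<Omega> k"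
  shows "dd (\<lambda>z. k (f z)) z u = dd k (f z) (dd f z u)"
proof -
  have "((\<lambda>z. k (f z)) has_derivative (\<lambda>u. dd k (f z) (dd f z u))) (at z)"
    by (rule has_derivative_compose[of f "frechet_derivative f (at z)" z UNIV k])
      (use smooth_on_differentiable[OF smooth_f assms(1)] smooth_on_differentiable[OF assms(2) f_in[OF assms(1)]]
        in \<open>auto intro: dd_has_derivative\<close>)
  from dd_eqI[OF this] show ?thesis by simp
qed

lemma smooth_df: "smooth_on S (\<lambda>z. dd f z u)" by (rule smooth_on_dd[OF smooth_f])

lemma linear_df: "z \<in> S \<Longrightarrow> linear (\<lambda>u. dd f z u)"
  using linear_dd[OF smooth_on_differentiable[OF smooth_f]] .

lemma smooth_G_along:
  "smooth_on S W \<Longrightarrow> smooth_on S W' \<Longrightarrow> smooth_on S (\<lambda>z. G (f z) (W z) (W' z))"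
  by (rule smooth_on_bilinear[OF open_S G_bilinear[OF f_in] smooth_compose_f[OF smooth_G]])

lemma smooth_D: "smooth_on S W \<Longrightarrow> smooth_on S (\<lambda>z. D W z u)"
  unfolding cov_along_def
  by (intro smooth_on_add smooth_on_dd open_S
      smooth_on_bilinear[OF open_S christoffel_bilinear[OF f_in] smooth_compose_f[OF christoffel_smooth]] smooth_df)

lemma linear_D: "z \<in> S \<Longrightarrow> W differentiable (at z) \<Longrightarrow> linear (D W z)"
  by (rule linearI) (simp_all add: cov_along_def chr_simps[OF f_in] linear_add[OF linear_df] linear_scale[OF linear_df]
      linear_add[OF linear_dd] linear_scale[OF linear_dd] algebra_simps)

lemma D_cong:
  assumes "z \<in> S" "\<And>z. z \<in> S \<Longrightarrow> W z = W' z"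
  shows "D W z u = D W' z u"
  using dd_cong[OF open_S assms(1), of W W'] assms by (simp add: cov_along_def)

lemma D_add:
  assumes "z \<in> S" "W differentiable (at z)" "W' differentiable (at z)"
  shows "D (\<lambda>z. W z + W' z) z u = D W z u + D W' z u"
  using dd_eqI[OF has_derivative_add[OF dd_has_derivative dd_has_derivative], OF assms(2,3)]
  by (simp add: cov_along_def chr_simps[OF f_in[OF assms(1)]])

lemma D_minus:
  assumes "z \<in> S" "W differentiable (at z)"
  shows "D (\<lambda>z. - W z) z u = - D W z u"
  using dd_eqI[OF has_derivative_minus[OF dd_has_derivative], OF assms(2)]
  by (simp add: cov_along_def chr_simps[OF f_in[OF assms(1)]])

lemma D_torsion_free:
  assumes "z \<in> S"
  shows "D (\<lambda>z. dd f z v) z u = D (\<lambda>z. dd f z u) z v"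
  unfolding cov_along_def
  using symmetric_second_derivative[OF open_S assms smooth_f] christoffel_sym[OF f_in[OF assms]] by metis

lemma D_metric:
  assumes "z \<in> S" "W differentiable (at z)" "W' differentiable (at z)"
  shows "dd (\<lambda>z. G (f z) (W z) (W' z)) z u = G (f z) (D W z u) (W' z) + G (f z) (W z) (D W' z u)"
proof -
  have "dd (\<lambda>z. G (f z) (W z) (W' z)) z u = dd (\<lambda>x. G (f x) (W z) (W' z)) z u
      + G (f z) (dd W z u) (W' z) + G (f z) (W z) (dd W' z u)"
    by (rule dd_bilinear_eval[OF open_S assms(1) G_bilinear[OF f_in] _ assms(2,3)])
      (use smooth_on_differentiable[OF smooth_compose_f[OF smooth_G] assms(1)] in auto)
  also have "dd (\<lambda>x. G (f x) (W z) (W' z)) z u = G (f z) (christoffel G (f z) (dd f z u) (W z)) (W' z)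
      + G (f z) (W z) (christoffel G (f z) (dd f z u) (W' z))"
    using dd_compose_f[OF assms(1) smooth_G] christoffel_compat[OF f_in[OF assms(1)]] by metis
  finally show ?thesis by (simp add: cov_along_def G_simps[OF f_in[OF assms(1)]])
qed

text \<open>The curvature of the pull-back connection; \<open>u\<close> and \<open>v\<close> are
  constant and commute. Under antisymmetrization the second derivatives of \<open>W\<close> and
  \<open>f\<close> cancel, as do the mixed products of first derivatives, and the Christoffel terms
  left over are those of \<open>riem_christoffel\<close>. Gauss, Codazzi and the symmetries of the
  curvature are all drawn from this equation.\<close>

lemma D_curvature:
  assumes z: "z \<in> S" and W: "smooth_on S W"
  shows "D (\<lambda>z. D W z v) z u - D (\<lambda>z. D W z u) z v = riem G (f z) (dd f z u) (dd f z v) (W z)"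
proof -
  let ?\<Gamma> = "christoffel G (f z)"
  note dW = smooth_on_differentiable[OF smooth_on_dd[OF W] z] smooth_on_differentiable[OF W z]
  have *: "D (\<lambda>z. D W z v) z u = dd (\<lambda>z. dd W z v) z u
     + (dd (\<lambda>q. christoffel G q (dd f z v) (W z)) (f z) (dd f z u)
      + ?\<Gamma> (dd (\<lambda>z. dd f z v) z u) (W z) + ?\<Gamma> (dd f z v) (dd W z u))
     + (?\<Gamma> (dd f z u) (dd W z v) + ?\<Gamma> (dd f z u) (?\<Gamma> (dd f z v) (W z)))" for u v
  proof -
    let ?B = "\<lambda>z. christoffel G (f z) (dd f z v) (W z)"
    have B: "smooth_on S ?B"
      by (rule smooth_on_bilinear[OF open_S christoffel_bilinear[OF f_in] smooth_compose_f[OF christoffel_smooth] smooth_df W])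
    have "dd (\<lambda>z. D W z v) z u = dd (\<lambda>z. dd W z v) z u + dd ?B z u"
      unfolding cov_along_def
      using dd_eqI[OF has_derivative_add[OF dd_has_derivative[OF dW(1)]
            dd_has_derivative[OF smooth_on_differentiable[OF B z]]]] by simp
    also have "dd ?B z u = dd (\<lambda>x. christoffel G (f x) (dd f z v) (W z)) z u
       + ?\<Gamma> (dd (\<lambda>z. dd f z v) z u) (W z) + ?\<Gamma> (dd f z v) (dd W z u)"
      by (rule dd_bilinear_eval[OF open_S z christoffel_bilinear[OF f_in] _ _ dW(2)])
        (use smooth_on_differentiable[OF smooth_compose_f[OF christoffel_smooth] z]
          smooth_on_differentiable[OF smooth_df z] in auto)
    also have "dd (\<lambda>x. christoffel G (f x) (dd f z v) (W z)) z u
       = dd (\<lambda>q. christoffel G q (dd f z v) (W z)) (f z) (dd f z u)"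
      by (rule dd_compose_f[OF z christoffel_smooth])
    finally show ?thesis by (simp add: cov_along_def chr_simps[OF f_in[OF z]])
  qed
  show ?thesis
    unfolding * riem_christoffel[OF f_in[OF z]] symmetric_second_derivative[OF open_S z W, of v u]
      symmetric_second_derivative[OF open_S z smooth_f, of v u] by simp
qed

lemma D_parallel_endo:
  assumes z: "z \<in> S" and \<phi>: "\<And>q. q \<in> \<Omega> \<Longrightarrow> linear (\<phi> q)" "\<And>w. smooth_on \<Omega> (\<lambda>q. \<phi> q w)"
    "\<And>q u v. q \<in> \<Omega> \<Longrightarrow> cov_endo G \<phi> q u v = 0" and W: "W differentiable (at z)"
  shows "D (\<lambda>z. \<phi> (f z) (W z)) z u = \<phi> (f z) (D W z u)"
proof -
  have "dd (\<lambda>z. \<phi> (f z) (W z)) z u = dd (\<lambda>x. \<phi> (f x) (W z)) z u + \<phi> (f z) (dd W z u)"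
    by (rule dd_linear_eval[OF open_S z \<phi>(1)[OF f_in] _ W])
      (use smooth_on_differentiable[OF smooth_compose_f[OF \<phi>(2)] z] in auto)
  also have "dd (\<lambda>x. \<phi> (f x) (W z)) z u = dd (\<lambda>q. \<phi> q (W z)) (f z) (dd f z u)"
    by (rule dd_compose_f[OF z \<phi>(2)])
  also have "\<dots> = \<phi> (f z) (christoffel G (f z) (dd f z u) (W z))
      - christoffel G (f z) (dd f z u) (\<phi> (f z) (W z))"
    using \<phi>(3)[OF f_in[OF z], of "dd f z u" "W z"]
    by (simp add: cov_endo_def cov_def frechet_derivative_const algebra_simps)
  finally show ?thesis by (simp add: cov_along_def linear_add[OF \<phi>(1)[OF f_in[OF z]]])
qed

end

lemma cov_along_ident: "cov_along G (\<lambda>z. z) W = cov G W"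
  by (intro ext) (simp add: cov_along_def cov_def frechet_derivative_ident)

lemma (in riemannian) ident_map: "map_into_riemannian \<Omega> G \<Omega> (\<lambda>z. z)"
  by unfold_locales (simp_all add: open_Omega smooth_on_ident)

section \<open>Fields of endomorphisms\<close>

text \<open>The second covariant derivative, with outer direction \<open>u\<close> and inner
  direction \<open>v\<close>. The subtracted term removes the derivative of the constant field
  \<open>v\<close>, which makes it tensorial.\<close>

definition cov_endo2 ::
    "'v::euclidean_space metric \<Rightarrow> ('v \<Rightarrow> 'v \<Rightarrow> 'v) \<Rightarrow> 'v \<Rightarrow> 'v \<Rightarrow> 'v \<Rightarrow> 'v \<Rightarrow> 'v"
  where "cov_endo2 G L x u v w =
    cov_endo G (\<lambda>z. cov_endo G L z v) x u w - cov_endo G L x (cov G (\<lambda>_. v) x u) w"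

lemma cov_const: "cov G (\<lambda>_. v) x u = christoffel G x u v"
  by (simp add: cov_def frechet_derivative_const)

lemma cov_endo_eq:
  "cov_endo G L x u v = dd (\<lambda>z. L z v) x u + christoffel G x u (L x v) - L x (christoffel G x u v)"
  by (simp add: cov_endo_def cov_const) (simp add: cov_def)

context riemannian
begin

lemma sum_G_sharp: "x \<in> \<Omega> \<Longrightarrow> (\<Sum>b\<in>Basis. G x a b *\<^sub>R sharp (G x) b) = a"
proof (rule inner_form_ext[OF inner_form_G])
  fix v assume x: "x \<in> \<Omega>"
  have "G x a v = (\<Sum>b\<in>Basis. (v \<bullet> b) *\<^sub>R G x a b)"
    by (rule linear_basis_sum[OF bilinear_linear_right[OF G_bilinear[OF x]]])
  then show "G x (\<Sum>b\<in>Basis. G x a b *\<^sub>R sharp (G x) b) v = G x a v"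
    by (simp add: G_simps[OF x] sharp_inner[OF inner_form_G[OF x]] inner_commute mult.commute)
qed

lemma smooth_sharp: "smooth_on \<Omega> (\<lambda>z. sharp (G z) b)"
  by (rule smooth_on_sharp[OF open_Omega inner_form_G smooth_G])

text \<open>This says that the inverse metric is parallel: the two terms are the Christoffel
  corrections for the vector \<open>sharp (G x) b\<close> and for the covector of
  \<open>b\<close>.\<close>

lemma dd_sharp:
  assumes x: "x \<in> \<Omega>"
  shows "dd (\<lambda>z. sharp (G z) b) x u = - christoffel G x u (sharp (G x) b)
    - (\<Sum>b'\<in>Basis. (b \<bullet> christoffel G x u b') *\<^sub>R sharp (G x) b')"
proof -
  have "dd (\<lambda>z. sharp (G z) b) x u = - (\<Sum>b'\<in>Basis. dd (\<lambda>z. G z (sharp (G x) b) b') x u *\<^sub>R sharp (G x) b')"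
    by (rule dd_eqI[THEN fun_cong], rule has_derivative_sharp[OF open_Omega inner_form_G smooth_G x])
  also have "\<dots> = - (\<Sum>b'\<in>Basis. G x (christoffel G x u (sharp (G x) b)) b' *\<^sub>R sharp (G x) b')
      - (\<Sum>b'\<in>Basis. (b \<bullet> christoffel G x u b') *\<^sub>R sharp (G x) b')"
    by (simp add: christoffel_compat[OF x] sharp_inner[OF inner_form_G[OF x]] scaleR_add_left sum.distrib)
  finally show ?thesis unfolding sum_G_sharp[OF x] .
qed

lemma smooth_metric_trace:
  assumes "\<And>z. z \<in> \<Omega> \<Longrightarrow> bilinear (Q z)" "\<And>v w. smooth_on \<Omega> (\<lambda>z. Q z v w)"
  shows "smooth_on \<Omega> (\<lambda>z. metric_trace (G z) (Q z) :: real)"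
proof (rule smooth_on_cong[OF open_Omega])
  show "smooth_on \<Omega> (\<lambda>z. \<Sum>b\<in>Basis. Q z b (sharp (G z) b))"
    by (intro smooth_on_sum open_Omega smooth_on_linear[OF open_Omega bilinear_linear_right[OF assms(1)] assms(2)]
        smooth_sharp)
qed (simp add: metric_trace_sharp inner_form_G assms)

text \<open>Traces commute with covariant differentiation, because the inverse metric in
  \<open>metric_trace_sharp\<close> is parallel.\<close>

lemma dd_metric_trace:
  fixes Q :: "'q \<Rightarrow> 'q \<Rightarrow> 'q \<Rightarrow> real"
  assumes Q: "\<And>z. z \<in> \<Omega> \<Longrightarrow> bilinear (Q z)" "\<And>v w. smooth_on \<Omega> (\<lambda>z. Q z v w)" and x: "x \<in> \<Omega>"
  shows "dd (\<lambda>z. metric_trace (G z) (Q z)) x u = metric_trace (G x)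
    (\<lambda>v w. dd (\<lambda>z. Q z v w) x u - Q x (christoffel G x u v) w - Q x v (christoffel G x u w))"
proof -
  let ?s = "\<lambda>z. sharp (G z)" and ?\<Gamma> = "christoffel G x u"
  have dQ: "(\<lambda>z. Q z v w) differentiable (at x)" for v w by (rule smooth_on_differentiable[OF Q(2) x])
  have ds: "(\<lambda>z. ?s z b) differentiable (at x)" for b by (rule smooth_on_differentiable[OF smooth_sharp x])
  note Qs = bilinear_simps[OF Q(1)[OF x]]
  have 1: "((\<lambda>z. metric_trace (G z) (Q z)) has_derivative
     (\<lambda>u. \<Sum>b\<in>Basis. dd (\<lambda>z. Q z b (?s x b)) x u + Q x b (dd (\<lambda>z. ?s z b) x u))) (at x)"
  proof (rule has_derivative_transform_within_open[OF _ open_Omega x])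
    show "((\<lambda>z. \<Sum>b\<in>Basis. Q z b (?s z b)) has_derivative
     (\<lambda>u. \<Sum>b\<in>Basis. dd (\<lambda>z. Q z b (?s x b)) x u + Q x b (dd (\<lambda>z. ?s z b) x u))) (at x)"
      by (intro has_derivative_sum has_derivative_linear_eval[OF open_Omega x bilinear_linear_right[OF Q(1)] dQ ds])
  qed (simp add: metric_trace_sharp inner_form_G Q)
  \<comment> \<open>Exchanging the two summations moves the Christoffel symbol from the covector
    index to the first argument of \<open>Q\<close>.\<close>
  have "(\<Sum>b\<in>Basis. Q x b (\<Sum>b'\<in>Basis. (b \<bullet> ?\<Gamma> b') *\<^sub>R ?s x b')) = (\<Sum>b'\<in>Basis. Q x (?\<Gamma> b') (?s x b'))"
  proof -
    have "(\<Sum>b\<in>Basis. Q x b (\<Sum>b'\<in>Basis. (b \<bullet> ?\<Gamma> b') *\<^sub>R ?s x b'))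
        = (\<Sum>b\<in>Basis. \<Sum>b'\<in>Basis. (?\<Gamma> b' \<bullet> b) *\<^sub>R Q x b (?s x b'))"
      by (simp add: Qs inner_commute)
    also have "\<dots> = (\<Sum>b'\<in>Basis. Q x (?\<Gamma> b') (?s x b'))"
      by (subst sum.swap) (rule sum.cong[OF refl], rule linear_basis_sum[OF bilinear_linear_left[OF Q(1)[OF x]], symmetric])
    finally show ?thesis .
  qed
  then have 2: "dd (\<lambda>z. metric_trace (G z) (Q z)) x u
     = (\<Sum>b\<in>Basis. dd (\<lambda>z. Q z b (?s x b)) x u - Q x (?\<Gamma> b) (?s x b) - Q x b (?\<Gamma> (?s x b)))"
    unfolding dd_eqI[OF 1] dd_sharp[OF x]
    by (simp add: bilinear_lsub[OF Q(1)[OF x]] bilinear_rsub[OF Q(1)[OF x]] bilinear_rneg[OF Q(1)[OF x]]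
       sum.distrib sum_subtractf sum_negf)
  have d_lin: "dd (\<lambda>z. Q z (v + v') w) x u = dd (\<lambda>z. Q z v w) x u + dd (\<lambda>z. Q z v' w) x u"
    "dd (\<lambda>z. Q z v (w + w')) x u = dd (\<lambda>z. Q z v w) x u + dd (\<lambda>z. Q z v w') x u"
    "dd (\<lambda>z. Q z (r *\<^sub>R v) w) x u = r * dd (\<lambda>z. Q z v w) x u"
    "dd (\<lambda>z. Q z v (r *\<^sub>R w)) x u = r * dd (\<lambda>z. Q z v w) x u" for v v' w w' r
    by (rule dd_transform[OF _ open_Omega x], rule has_derivative_add[OF dd_has_derivative[OF dQ] dd_has_derivative[OF dQ]]
             has_derivative_mult_right[OF dd_has_derivative[OF dQ]],
        simp add: bilinear_simps[OF Q(1)])+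
  have "bilinear (\<lambda>v w. dd (\<lambda>z. Q z v w) x u - Q x (?\<Gamma> v) w - Q x v (?\<Gamma> w))"
    by (rule bilinearI')
      (simp_all add: d_lin bilinear_ladd[OF Q(1)[OF x]] bilinear_radd[OF Q(1)[OF x]] bilinear_lmul[OF Q(1)[OF x]]
        bilinear_rmul[OF Q(1)[OF x]] chr_simps[OF x] algebra_simps)
  then show ?thesis unfolding 2 by (simp add: metric_trace_sharp inner_form_G[OF x])
qed

definition smooth_endo :: "('q \<Rightarrow> 'q \<Rightarrow> 'q) \<Rightarrow> bool"
  where "smooth_endo A \<longleftrightarrow> (\<forall>z\<in>\<Omega>. linear (A z)) \<and> (\<forall>v. smooth_on \<Omega> (\<lambda>z. A z v))"

definition symmetric_endo :: "('q \<Rightarrow> 'q \<Rightarrow> 'q) \<Rightarrow> bool"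
  where "symmetric_endo A \<longleftrightarrow> (\<forall>z\<in>\<Omega>. \<forall>v w. G z (A z v) w = G z v (A z w))"

lemma endo_linear: "smooth_endo A \<Longrightarrow> x \<in> \<Omega> \<Longrightarrow> linear (A x)"
  and endo_smooth: "smooth_endo A \<Longrightarrow> smooth_on \<Omega> (\<lambda>z. A z v)"
  by (simp_all add: smooth_endo_def)

lemma endo_differentiable: "smooth_endo A \<Longrightarrow> x \<in> \<Omega> \<Longrightarrow> (\<lambda>z. A z v) differentiable (at x)"
  by (rule smooth_on_differentiable[OF endo_smooth])

lemma endo_add: "smooth_endo A \<Longrightarrow> x \<in> \<Omega> \<Longrightarrow> A x (v + w) = A x v + A x w"
  and endo_scale: "smooth_endo A \<Longrightarrow> x \<in> \<Omega> \<Longrightarrow> A x (r *\<^sub>R v) = r *\<^sub>R A x v"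
  and endo_diff: "smooth_endo A \<Longrightarrow> x \<in> \<Omega> \<Longrightarrow> A x (v - w) = A x v - A x w"
  by (simp_all add: linear_add linear_scale linear_diff endo_linear)

lemma dd_endo_linear:
  assumes A: "smooth_endo A" and x: "x \<in> \<Omega>"
  shows "dd (\<lambda>z. A z (v + w)) x u = dd (\<lambda>z. A z v) x u + dd (\<lambda>z. A z w) x u"
    "dd (\<lambda>z. A z (r *\<^sub>R v)) x u = r *\<^sub>R dd (\<lambda>z. A z v) x u"
  by (rule dd_transform[OF _ open_Omega x],
      rule has_derivative_add[OF dd_has_derivative dd_has_derivative] has_derivative_scaleR_right[OF dd_has_derivative],
      (rule endo_differentiable[OF A x])+, simp add: endo_add[OF A] endo_scale[OF A])+

lemma cov_endo_linear:
  assumes A: "smooth_endo A" and x: "x \<in> \<Omega>"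
  shows "cov_endo G A x (u + u') v = cov_endo G A x u v + cov_endo G A x u' v"
    "cov_endo G A x (r *\<^sub>R u) v = r *\<^sub>R cov_endo G A x u v"
    "cov_endo G A x u (v + w) = cov_endo G A x u v + cov_endo G A x u w"
    "cov_endo G A x u (r *\<^sub>R v) = r *\<^sub>R cov_endo G A x u v"
  unfolding cov_endo_eq
  by (simp_all add: dd_endo_linear[OF A x] endo_add[OF A x] endo_scale[OF A x] chr_simps[OF x]
      linear_add[OF linear_dd[OF endo_differentiable[OF A x]]]
      linear_scale[OF linear_dd[OF endo_differentiable[OF A x]]] algebra_simps)

lemma smooth_endo_cov:
  assumes A: "smooth_endo A"
  shows "smooth_endo (\<lambda>z. cov_endo G A z v)"
  unfolding smooth_endo_def
proof (intro conjI ballI allI)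
  show "linear (cov_endo G A z v)" if "z \<in> \<Omega>" for z
    by (rule linearI) (simp_all add: cov_endo_linear[OF A that])
  show "smooth_on \<Omega> (\<lambda>z. cov_endo G A z v w)" for w
    unfolding cov_endo_eq
    by (intro smooth_on_diff smooth_on_add smooth_on_dd open_Omega endo_smooth[OF A]
        smooth_on_linear[OF open_Omega bilinear_linear_right[OF christoffel_bilinear] christoffel_smooth]
        smooth_on_linear[OF open_Omega endo_linear[OF A] endo_smooth[OF A]] christoffel_smooth)
qed

interpretation I: map_into_riemannian \<Omega> G \<Omega> "\<lambda>z. z"
  by (rule ident_map)

lemma cov_metric:
  assumes "z \<in> \<Omega>" "W differentiable (at z)" "W' differentiable (at z)"
  shows "dd (\<lambda>z. G z (W z) (W' z)) z u = G z (cov G W z u) (W' z) + G z (W z) (cov G W' z u)"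
  using I.D_metric[OF assms] by (simp add: cov_along_ident)

lemma cov_curvature:
  assumes "z \<in> \<Omega>" "smooth_on \<Omega> W"
  shows "cov G (\<lambda>z. cov G W z v) z u - cov G (\<lambda>z. cov G W z u) z v = riem G z u v (W z)"
  using I.D_curvature[OF assms] by (simp add: cov_along_ident frechet_derivative_ident)

lemma cov_eq_cov_endo: "cov G (\<lambda>z. A z v) x u = cov_endo G A x u v + A x (christoffel G x u v)"
  by (simp add: cov_endo_def cov_const)

lemma cov_endo_bilinear_form:
  assumes A: "smooth_endo A" and B: "smooth_endo B" and x: "x \<in> \<Omega>"
  shows "dd (\<lambda>z. G z (A z v) (B z w)) x u - G x (A x (christoffel G x u v)) (B x w)
      - G x (A x v) (B x (christoffel G x u w))
    = G x (cov_endo G A x u v) (B x w) + G x (A x v) (cov_endo G B x u w)"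
  unfolding cov_metric[OF x endo_differentiable[OF A x] endo_differentiable[OF B x]] cov_eq_cov_endo
  by (simp add: G_simps[OF x])

text \<open>The identity is a parallel field of endomorphisms. Inserted for \<open>A\<close> or
  \<open>B\<close>, it specializes the statements on pairs to a single field.\<close>

lemma smooth_endo_ident: "smooth_endo (\<lambda>_ v. v)"
  by (simp add: smooth_endo_def smooth_on_const linear_id[unfolded id_def])

lemma cov_endo_ident: "x \<in> \<Omega> \<Longrightarrow> cov_endo G (\<lambda>_ v. v) x u v = 0"
  by (simp add: cov_endo_eq frechet_derivative_const)

lemma symmetric_endo_cov:
  assumes A: "smooth_endo A" "symmetric_endo A"
  shows "symmetric_endo (\<lambda>z. cov_endo G A z u)"
  unfolding symmetric_endo_def
proof (intro ballI allI)
  fix z v w assume z: "z \<in> \<Omega>"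
  have s: "G z (A z v) w = G z v (A z w)" if "z \<in> \<Omega>" for v w z using A(2) that by (simp add: symmetric_endo_def)
  have "dd (\<lambda>z. G z (A z v) w) z u = dd (\<lambda>z. G z v (A z w)) z u"
    by (rule dd_cong[OF open_Omega z, THEN fun_cong]) (rule s)
  then show "G z (cov_endo G A z u v) w = G z v (cov_endo G A z u w)"
    using cov_endo_bilinear_form[OF A(1) smooth_endo_ident z, of v w u]
      cov_endo_bilinear_form[OF smooth_endo_ident A(1) z, of v w u]
    by (simp add: cov_endo_ident[OF z] G_simps[OF z] s[OF z])
qed

lemma endo_form:
  assumes "smooth_endo A" "smooth_endo B"
  shows "z \<in> \<Omega> \<Longrightarrow> bilinear (\<lambda>v w. G z (A z v) (B z w))"
    and "smooth_on \<Omega> (\<lambda>z. G z (A z v) (B z w))"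
proof -
  show "bilinear (\<lambda>v w. G z (A z v) (B z w))" if "z \<in> \<Omega>" for z
    by (rule bilinearI') (simp_all add: G_simps[OF that] endo_add[OF _ that] endo_scale[OF _ that] assms)
  show "smooth_on \<Omega> (\<lambda>z. G z (A z v) (B z w))"
    by (rule smooth_on_bilinear[OF open_Omega G_bilinear smooth_G]) (auto intro: endo_smooth assms)
qed

lemma dd_trace_endo_form:
  assumes A: "smooth_endo A" and B: "smooth_endo B" and x: "x \<in> \<Omega>"
  shows "dd (\<lambda>z. metric_trace (G z) (\<lambda>v w. G z (A z v) (B z w))) x u
    = metric_trace (G x) (\<lambda>v w. G x (cov_endo G A x u v) (B x w) + G x (A x v) (cov_endo G B x u w))"
  by (subst dd_metric_trace[OF endo_form[OF A B] x]) (simp_all only: cov_endo_bilinear_form[OF A B x])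

lemma dd_endo_trace:
  assumes A: "smooth_endo A" and x: "x \<in> \<Omega>"
  shows "dd (\<lambda>z. endo_trace (G z) (A z)) x u = endo_trace (G x) (cov_endo G A x u)"
  using dd_trace_endo_form[OF A smooth_endo_ident x, of u]
  by (simp add: endo_trace_def cov_endo_ident[OF x] G_simps[OF x])

text \<open>Since traces commute with covariant differentiation, constancy makes first the trace of
  the first derivative vanish in every direction, and then that of its derivative.\<close>

lemma trace_cov_endo2_zero:
  assumes A: "smooth_endo A" and const: "\<And>z. z \<in> \<Omega> \<Longrightarrow> endo_trace (G z) (A z) = k" and x: "x \<in> \<Omega>"
  shows "endo_trace (G x) (cov_endo2 G A x u v) = 0"
proof -
  have 0: "endo_trace (G z) (cov_endo G A z w) = 0" if z: "z \<in> \<Omega>" for z w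
  proof -
    have "endo_trace (G z) (cov_endo G A z w) = dd (\<lambda>z. endo_trace (G z) (A z)) z w"
      by (rule dd_endo_trace[OF A z, symmetric])
    also have "\<dots> = dd (\<lambda>_. k) z w" by (rule dd_cong[OF open_Omega z, THEN fun_cong]) (rule const)
    finally show ?thesis by (simp add: frechet_derivative_const)
  qed
  have 1: "endo_trace (G x) (cov_endo G (\<lambda>z. cov_endo G A z v) x u) = 0"
  proof -
    have "endo_trace (G x) (cov_endo G (\<lambda>z. cov_endo G A z v) x u)
        = dd (\<lambda>z. endo_trace (G z) (cov_endo G A z v)) x u"
      by (rule dd_endo_trace[OF smooth_endo_cov[OF A] x, symmetric])
    also have "\<dots> = dd (\<lambda>_. 0) x u" by (rule dd_cong[OF open_Omega x, THEN fun_cong]) (rule 0)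
    finally show ?thesis by (simp add: frechet_derivative_const)
  qed
  have "endo_trace (G x) (cov_endo2 G A x u v) = endo_trace (G x) (cov_endo G (\<lambda>z. cov_endo G A z v) x u)
      - endo_trace (G x) (cov_endo G A x (cov G (\<lambda>_. v) x u))"
    unfolding endo_trace_def cov_endo2_def metric_trace_def by (simp add: G_simps[OF x] sum_subtractf)
  then show ?thesis using 0[OF x] 1 by simp
qed

text \<open>The curvature acts on endomorphisms as a derivation: once on the value
  \<open>A w\<close>, once on the argument \<open>w\<close>. Torsion-freeness removes the terms that
  come from differentiating the directions.\<close>

lemma ricci_identity:
  assumes A: "smooth_endo A" and x: "x \<in> \<Omega>"
  shows "cov_endo2 G A x u v w - cov_endo2 G A x v u w = riem G x u v (A x w) - A x (riem G x u v w)"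
proof -
  let ?\<Gamma> = "christoffel G x"
  have *: "cov_endo G (\<lambda>z. cov_endo G A z v) x u w
      = cov G (\<lambda>z. cov G (\<lambda>z. A z w) z v) x u - cov G (\<lambda>z. A z (?\<Gamma> v w)) x u
        - A x (dd (\<lambda>z. christoffel G z v w) x u)
        - cov G (\<lambda>z. A z (?\<Gamma> u w)) x v + A x (?\<Gamma> v (?\<Gamma> u w))" for u v
  proof -
    have c: "cov_endo G A z v w = cov G (\<lambda>z. A z w) z v - A z (christoffel G z v w)" for z v w
      by (simp add: cov_endo_def cov_const)
    have s: "smooth_on \<Omega> (\<lambda>z. cov G (\<lambda>z. A z w) z v)"
      unfolding cov_along_ident[symmetric] by (rule I.smooth_D[OF endo_smooth[OF A]])
    have s2: "smooth_on \<Omega> (\<lambda>z. A z (christoffel G z v w))"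
      by (rule smooth_on_linear[OF open_Omega endo_linear[OF A] endo_smooth[OF A] christoffel_smooth])
    have "cov G (\<lambda>z. cov_endo G A z v w) x u
        = cov G (\<lambda>z. cov G (\<lambda>z. A z w) z v) x u - cov G (\<lambda>z. A z (christoffel G z v w)) x u"
      unfolding c
      using dd_eqI[OF has_derivative_diff[OF dd_has_derivative[OF smooth_on_differentiable[OF s x]]
            dd_has_derivative[OF smooth_on_differentiable[OF s2 x]]]]
      by (simp add: cov_def[of G "\<lambda>z. _ z - _ z"] cov_def[of G "\<lambda>z. A z (christoffel G z v w)"] chr_simps[OF x])
         (simp add: cov_def chr_simps[OF x])
    also have "cov G (\<lambda>z. A z (christoffel G z v w)) x u
        = cov G (\<lambda>z. A z (?\<Gamma> v w)) x u + A x (dd (\<lambda>z. christoffel G z v w) x u)"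
      using dd_linear_eval[OF open_Omega x endo_linear[OF A] endo_differentiable[OF A x]
          differentiable_christoffel[OF x], of v w u]
      by (simp add: cov_def)
    finally show ?thesis
      by (simp add: cov_endo_def[of G "\<lambda>z. cov_endo G A z v"] cov_const) (simp add: c)
  qed
  \<comment> \<open>The two terms of \<open>*\<close> in which \<open>cov\<close> differentiates
    \<open>A\<close> applied to a fixed Christoffel vector are exchanged by swapping
    \<open>u\<close> and \<open>v\<close>, so they cancel here.\<close>
  have "cov_endo2 G A x u v w - cov_endo2 G A x v u w
      = (cov G (\<lambda>z. cov G (\<lambda>z. A z w) z v) x u - cov G (\<lambda>z. cov G (\<lambda>z. A z w) z u) x v)
       - A x (dd (\<lambda>z. christoffel G z v w) x u - dd (\<lambda>z. christoffel G z u w) x v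
         + ?\<Gamma> u (?\<Gamma> v w) - ?\<Gamma> v (?\<Gamma> u w))"
    by (simp add: cov_endo2_def * cov_const christoffel_sym[OF x, of u v] endo_diff[OF A x] endo_add[OF A x])
  also have "\<dots> = riem G x u v (A x w) - A x (riem G x u v w)"
    using cov_curvature[OF x endo_smooth[OF A]] riem_christoffel[OF x, of u v w] by simp
  finally show ?thesis .
qed

lemma cov_endo2_symmetric:
  assumes A: "smooth_endo A" "symmetric_endo A" and x: "x \<in> \<Omega>"
  shows "G x (cov_endo2 G A x u v w) w' = G x w (cov_endo2 G A x u v w')"
  using symmetric_endo_cov[OF A] symmetric_endo_cov[OF smooth_endo_cov[OF A(1)] symmetric_endo_cov[OF A], of v u] x
  by (simp add: cov_endo2_def symmetric_endo_def G_simps[OF x])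

text \<open>The product rule for the squared norm, a Bochner formula. The norm is differentiated as
  a trace and evaluated in \<open>B\<close> afterwards.\<close>

lemma laplacian_endo_norm2:
  assumes A: "smooth_endo A" and x: "x \<in> \<Omega>" and B: "orthonormal_basis (G x) B"
  shows "1/2 * laplacian G (\<lambda>z. endo_norm2 (G z) (A z)) x = cov_endo_norm2 G A x
    + (\<Sum>i\<in>B. \<Sum>j\<in>B. G x (cov_endo2 G A x i i j) (A x j))"
proof -
  let ?\<psi> = "\<lambda>z. endo_norm2 (G z) (A z)"
  have tr: "metric_trace (G z) Q = (\<Sum>e\<in>C. Q e e)" if "orthonormal_basis (G z) C" "bilinear Q" "z \<in> \<Omega>"
    for C z and Q :: "'q \<Rightarrow> 'q \<Rightarrow> real"
    by (rule metric_trace_eq[OF inner_form_G[OF that(3)] that(1,2)])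
  have bil: "bilinear (\<lambda>v w. G z (C z v) (C' z w) + G z (D z v) (D' z w))"
    if "smooth_endo C" "smooth_endo C'" "smooth_endo D" "smooth_endo D'" "z \<in> \<Omega>" for C C' D D' z
    by (rule bilinearI') (simp_all add: G_simps[OF that(5)] endo_add[OF _ that(5)] endo_scale[OF _ that(5)] that algebra_simps)
  note A' = smooth_endo_cov[OF A]
  have d1: "dd ?\<psi> z v = 2 * metric_trace (G z) (\<lambda>p q. G z (cov_endo G A z v p) (A z q))" if z: "z \<in> \<Omega>" for z v
  proof -
    obtain C where C: "orthonormal_basis (G z) C" using orthonormal_basis_exists[OF inner_form_G[OF z]] by blast
    show ?thesis
      unfolding endo_norm2_def dd_trace_endo_form[OF A A z] tr[OF C bil[OF A' A A A'] z, OF z]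
        tr[OF C endo_form(1)[OF A' A z] z]
      by (simp add: G_sym[OF z, of "A z _"] sum_distrib_left)
  qed
  have d2: "dd (\<lambda>z. dd ?\<psi> z v) x u = 2 * (\<Sum>j\<in>B. G x (cov_endo G (\<lambda>z. cov_endo G A z v) x u j) (A x j)
      + G x (cov_endo G A x v j) (cov_endo G A x u j))" for u v
  proof -
    have "dd (\<lambda>z. dd ?\<psi> z v) x u = dd (\<lambda>z. 2 * metric_trace (G z) (\<lambda>p q. G z (cov_endo G A z v p) (A z q))) x u"
      by (rule dd_cong[OF open_Omega x, THEN fun_cong]) (rule d1)
    also have "\<dots> = 2 * dd (\<lambda>z. metric_trace (G z) (\<lambda>p q. G z (cov_endo G A z v p) (A z q))) x u"
      by (rule dd_bounded_linear[OF bounded_linear_mult_right])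
        (rule smooth_on_differentiable[OF smooth_metric_trace[OF endo_form[OF A' A]] x])
    finally show ?thesis
      unfolding dd_trace_endo_form[OF A' A x] tr[OF B bil[OF smooth_endo_cov[OF A'] A A' A'] x, OF x] .
  qed
  have hess: "hessian G ?\<psi> x u v = 2 * (\<Sum>j\<in>B. G x (cov_endo2 G A x u v j) (A x j))
      + 2 * (\<Sum>j\<in>B. G x (cov_endo G A x u j) (cov_endo G A x v j))" for u v
    unfolding hessian_def d2 d1[OF x] tr[OF B endo_form(1)[OF A' A x] x] cov_endo2_def
    by (simp add: G_simps[OF x] sum.distrib sum_subtractf G_sym[OF x, of "cov_endo G A x v _"] algebra_simps)
  \<comment> \<open>\<open>metric_trace\<close> picks a frame of its own, and only for a bilinear
    form may it be computed in \<open>B\<close>. The Hessian is bilinear once the second covariant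
    derivative is linear in both directions.\<close>
  have c2: "bilinear (\<lambda>u v. cov_endo2 G A x u v w)" for w
  proof (rule bilinearI')
    have add: "cov_endo G (\<lambda>z. cov_endo G A z (v + v')) x u w
       = cov_endo G (\<lambda>z. cov_endo G A z v) x u w + cov_endo G (\<lambda>z. cov_endo G A z v') x u w" for u v v'
    proof -
      have "dd (\<lambda>z. cov_endo G A z (v + v') w) x u = dd (\<lambda>z. cov_endo G A z v w) x u + dd (\<lambda>z. cov_endo G A z v' w) x u"
        by (rule dd_transform[OF _ open_Omega x], rule has_derivative_add[OF dd_has_derivative[OF endo_differentiable[OF A' x]] dd_has_derivative[OF endo_differentiable[OF A' x]]])
          (simp add: cov_endo_linear[OF A])
      then show ?thesis
        by (simp add: cov_endo_eq[of G "\<lambda>z. cov_endo G A z _"] cov_endo_linear[OF A x] chr_simps[OF x])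
    qed
    have scale: "cov_endo G (\<lambda>z. cov_endo G A z (r *\<^sub>R v)) x u w = r *\<^sub>R cov_endo G (\<lambda>z. cov_endo G A z v) x u w" for u v r
    proof -
      have "dd (\<lambda>z. cov_endo G A z (r *\<^sub>R v) w) x u = r *\<^sub>R dd (\<lambda>z. cov_endo G A z v w) x u"
        by (rule dd_transform[OF _ open_Omega x], rule has_derivative_scaleR_right[OF dd_has_derivative[OF endo_differentiable[OF A' x]]])
          (simp add: cov_endo_linear[OF A])
      then show ?thesis
        by (simp add: cov_endo_eq[of G "\<lambda>z. cov_endo G A z _"] cov_endo_linear[OF A x] chr_simps[OF x] algebra_simps)
    qed
    show "cov_endo2 G A x u (v + v') w = cov_endo2 G A x u v w + cov_endo2 G A x u v' w"
      "cov_endo2 G A x u (r *\<^sub>R v) w = r *\<^sub>R cov_endo2 G A x u v w"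
      "cov_endo2 G A x (u + u') v w = cov_endo2 G A x u v w + cov_endo2 G A x u' v w"
      "cov_endo2 G A x (r *\<^sub>R u) v w = r *\<^sub>R cov_endo2 G A x u v w" for r u u' v v'
      by (simp_all add: cov_endo2_def add scale cov_const cov_endo_linear[OF A x] cov_endo_linear[OF A' x] chr_simps[OF x] algebra_simps)
  qed
  have "bilinear (hessian G ?\<psi> x)"
    by (rule bilinearI')
      (simp_all add: hess bilinear_simps[OF c2] G_simps[OF x] cov_endo_linear[OF A x] sum.distrib sum_distrib_left algebra_simps)
  then have "laplacian G ?\<psi> x = (\<Sum>i\<in>B. hessian G ?\<psi> x i i)" unfolding laplacian_def by (rule tr[OF B _ x])
  moreover have "cov_endo_norm2 G A x = (\<Sum>i\<in>B. \<Sum>j\<in>B. G x (cov_endo G A x i j) (cov_endo G A x i j))"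
  proof -
    have inner: "metric_trace (G x) (\<lambda>v v'. G x (cov_endo G A x u v) (cov_endo G A x u' v'))
        = (\<Sum>j\<in>B. G x (cov_endo G A x u j) (cov_endo G A x u' j))" for u u'
      by (rule tr[OF B _ x]) (rule bilinearI'; simp add: G_simps[OF x] cov_endo_linear[OF A x])
    show ?thesis unfolding cov_endo_norm2_def inner
      by (rule tr[OF B _ x])
        (rule bilinearI'; simp add: G_simps[OF x] cov_endo_linear[OF A x] sum.distrib sum_distrib_left)
  qed
  ultimately show ?thesis by (simp add: hess sum.distrib sum_distrib_left[symmetric])
qed

end

section \<open>Immersions\<close>

context riemannian
begin

text \<open>Christoffel symbols do not form a tensor, but \<open>smooth_endo\<close> refers to a
  single chart; it supplies the linearity of their derivatives.\<close>

lemma smooth_endo_christoffel: "smooth_endo (\<lambda>z. christoffel G z u)"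
  by (simp add: smooth_endo_def christoffel_smooth bilinear_linear_right[OF christoffel_bilinear])

lemma riem_linear:
  assumes x: "x \<in> \<Omega>"
  shows "riem G x (u + u') v w = riem G x u v w + riem G x u' v w"
    "riem G x (r *\<^sub>R u) v w = r *\<^sub>R riem G x u v w"
    "riem G x u (v + v') w = riem G x u v w + riem G x u v' w"
    "riem G x u (r *\<^sub>R v) w = r *\<^sub>R riem G x u v w"
    "riem G x u v (w + w') = riem G x u v w + riem G x u v w'"
    "riem G x u v (r *\<^sub>R w) = r *\<^sub>R riem G x u v w"
proof -
  note c2 = dd_endo_linear[OF smooth_endo_christoffel x]
  have c1: "dd (\<lambda>z. christoffel G z (v + v') w) x u = dd (\<lambda>z. christoffel G z v w) x u + dd (\<lambda>z. christoffel G z v' w) x u"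
    "dd (\<lambda>z. christoffel G z (r *\<^sub>R v) w) x u = r *\<^sub>R dd (\<lambda>z. christoffel G z v w) x u" for v v' w u r
  proof -
    have s: "dd (\<lambda>z. christoffel G z v w) x u = dd (\<lambda>z. christoffel G z w v) x u" for v w u
      by (rule dd_cong[OF open_Omega x, THEN fun_cong]) (rule christoffel_sym)
    show "dd (\<lambda>z. christoffel G z (v + v') w) x u = dd (\<lambda>z. christoffel G z v w) x u + dd (\<lambda>z. christoffel G z v' w) x u"
      unfolding s[of "v + v'" w] s[of v w] s[of v' w] by (rule c2)
    show "dd (\<lambda>z. christoffel G z (r *\<^sub>R v) w) x u = r *\<^sub>R dd (\<lambda>z. christoffel G z v w) x u"
      unfolding s[of "r *\<^sub>R v" w] s[of v w] by (rule c2)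
  qed
  note l = linear_add[OF linear_dd[OF differentiable_christoffel[OF x]]]
    linear_scale[OF linear_dd[OF differentiable_christoffel[OF x]]]
  show "riem G x (u + u') v w = riem G x u v w + riem G x u' v w"
    "riem G x (r *\<^sub>R u) v w = r *\<^sub>R riem G x u v w"
    "riem G x u (v + v') w = riem G x u v w + riem G x u v' w"
    "riem G x u (r *\<^sub>R v) w = r *\<^sub>R riem G x u v w"
    "riem G x u v (w + w') = riem G x u v w + riem G x u v w'"
    "riem G x u v (r *\<^sub>R w) = r *\<^sub>R riem G x u v w"
    unfolding riem_christoffel[OF x]
    by (simp_all add: c1 c2 l chr_simps[OF x] algebra_simps)
qed

definition Riem :: "'q \<Rightarrow> 'q \<Rightarrow> 'q \<Rightarrow> 'q \<Rightarrow> 'q \<Rightarrow> real"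
  where "Riem x u v w w' = G x (riem G x u v w) w'"

lemma Riem_add:
  assumes "x \<in> \<Omega>"
  shows "Riem x (u + u') v w y = Riem x u v w y + Riem x u' v w y"
    "Riem x u (v + v') w y = Riem x u v w y + Riem x u v' w y"
    "Riem x u v (w + w') y = Riem x u v w y + Riem x u v w' y"
    "Riem x u v w (y + y') = Riem x u v w y + Riem x u v w y'"
  by (simp_all add: Riem_def riem_linear[OF assms] G_simps[OF assms])

lemma Riem_scale:
  assumes "x \<in> \<Omega>"
  shows "Riem x (r *\<^sub>R u) v w y = r * Riem x u v w y"
    "Riem x u (r *\<^sub>R v) w y = r * Riem x u v w y"
    "Riem x u v (r *\<^sub>R w) y = r * Riem x u v w y"
    "Riem x u v w (r *\<^sub>R y) = r * Riem x u v w y"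
  by (simp_all add: Riem_def riem_linear[OF assms] G_simps[OF assms])

lemma Riem_minus3: "x \<in> \<Omega> \<Longrightarrow> Riem x u v (- w) y = - Riem x u v w y"
  using Riem_scale(3)[of x u v "-1" w y] by simp

end

section \<open>The induced connection, the second fundamental form and the Gauss equation\<close>

locale immersion = map_into_riemannian \<Omega> G S f
  for \<Omega> :: "'q::euclidean_space set" and G and S :: "'m::euclidean_space set" and f :: "'m \<Rightarrow> 'q" +
  assumes inj_df: "z \<in> S \<Longrightarrow> inj (frechet_derivative f (at z))"
begin

abbreviation "h \<equiv> induced_metric G f"
abbreviation "X u z \<equiv> dd f z u"
abbreviation "\<sigma> \<equiv> second_ff G f"

lemmas df_simps = linear_add[OF linear_df] linear_scale[OF linear_df] linear_diff[OF linear_df]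
  linear_neg[OF linear_df] linear_0[OF linear_df]

lemma df_eq_0: "z \<in> S \<Longrightarrow> dd f z u = 0 \<longleftrightarrow> u = 0"
  using linear_injective_0[OF linear_df] inj_df df_simps(5) by metis

lemma riemannian_induced: "riemannian S h"
proof
  show "riemannian_metric_on S h"
    unfolding riemannian_metric_on_def
  proof (intro conjI ballI allI impI)
    fix z u v assume z: "z \<in> S"
    show "bilinear (h z)"
      by (rule bilinearI') (simp_all add: induced_metric_def df_simps[OF z] G_simps[OF f_in[OF z]])
    show "h z u v = h z v u" by (simp add: induced_metric_def G_sym[OF f_in[OF z], of _ "dd f z v"])
    show "h z u u > 0" if "u \<noteq> 0"
      using inner_form_pos[OF inner_form_G[OF f_in[OF z]]] df_eq_0[OF z] that by (simp add: induced_metric_def)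
  next
    show "smooth_on S (\<lambda>z. h z u v)" for u v
      unfolding induced_metric_def by (intro smooth_G_along smooth_df)
  qed
qed (rule open_S)

sublocale H: riemannian S h by (rule riemannian_induced)

text \<open>The tangential part of \<open>w\<close> arises by raising the index of the covector
  \<open>v \<mapsto> G (f z) w (dd f z v)\<close>; this form also exhibits its smooth dependence on
  the point.\<close>

lemma tan_part_exists:
  assumes z: "z \<in> S"
  shows "tan_part G f z w = sharp (h z) (\<Sum>b\<in>Basis. G (f z) w (dd f z b) *\<^sub>R b)"
    and tan_part_inner: "h z (tan_part G f z w) v = G (f z) w (dd f z v)"
proof -
  let ?t = "sharp (h z) (\<Sum>b\<in>Basis. G (f z) w (dd f z b) *\<^sub>R b)"
  have lin: "linear (\<lambda>v. G (f z) w (dd f z v))"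
    by (rule linearI) (simp_all add: df_simps[OF z] G_simps[OF f_in[OF z]])
  have t: "h z ?t v = G (f z) w (dd f z v)" for v
  proof -
    have "h z ?t v = (\<Sum>b\<in>Basis. G (f z) w (dd f z b) * (b \<bullet> v))"
      by (simp add: sharp_inner[OF H.inner_form_G[OF z]] inner_sum_left)
    then show ?thesis
      using linear_basis_sum[OF lin, of v] by (simp add: inner_commute[of v] mult.commute)
  qed
  show "tan_part G f z w = ?t"
    unfolding tan_part_def
  proof (rule the_equality)
    show "\<forall>v. G (f z) (w - dd f z ?t) (dd f z v) = 0"
      using t by (simp add: G_simps[OF f_in[OF z]] induced_metric_def)
  next
    fix u assume "\<forall>v. G (f z) (w - dd f z u) (dd f z v) = 0"
    then have "h z u v = h z ?t v" for v
      unfolding t by (simp add: G_simps[OF f_in[OF z]] induced_metric_def)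
    then show "u = ?t" by (rule inner_form_ext[OF H.inner_form_G[OF z]])
  qed
  then show "h z (tan_part G f z w) v = G (f z) w (dd f z v)" by (simp add: t)
qed

lemma G_tan_part:
  "z \<in> S \<Longrightarrow> G (f z) (dd f z (tan_part G f z w)) (dd f z v) = G (f z) w (dd f z v)"
  using tan_part_inner[of z w v] by (simp add: induced_metric_def)

lemma tan_part_unique:
  assumes "z \<in> S" "\<And>v. h z u v = G (f z) w (dd f z v)"
  shows "tan_part G f z w = u"
  by (rule inner_form_ext[OF H.inner_form_G[OF assms(1)]]) (simp add: tan_part_inner assms)

lemma linear_tan_part: "z \<in> S \<Longrightarrow> linear (tan_part G f z)"
  by (rule linearI; rule tan_part_unique) (simp_all add: H.G_simps tan_part_inner G_simps f_in)

lemmas tan_simps = linear_add[OF linear_tan_part] linear_scale[OF linear_tan_part] linear_diff[OF linear_tan_part]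
  linear_neg[OF linear_tan_part] linear_0[OF linear_tan_part]

lemma smooth_tan_part:
  assumes W: "smooth_on S W"
  shows "smooth_on S (\<lambda>z. tan_part G f z (W z))"
proof (rule smooth_on_cong[OF open_S])
  show "smooth_on S (\<lambda>z. sharp (h z) (\<Sum>b\<in>Basis. G (f z) (W z) (dd f z b) *\<^sub>R b))"
    by (rule smooth_on_linear[where L = "\<lambda>z. sharp (h z)", OF open_S linear_sharp[OF H.inner_form_G] H.smooth_sharp],
        assumption)
      (intro smooth_on_sum smooth_on_scaleR open_S smooth_G_along W smooth_df smooth_on_const)
qed (simp add: tan_part_exists(1))

lemma smooth_df_field: "smooth_on S Y \<Longrightarrow> smooth_on S (\<lambda>z. dd f z (Y z))"
  by (rule smooth_on_linear[OF open_S linear_df smooth_df])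

lemma smooth_nor_part: "smooth_on S W \<Longrightarrow> smooth_on S (\<lambda>z. nor_part G f z (W z))"
  unfolding nor_part_def by (intro smooth_on_diff open_S smooth_df_field smooth_tan_part)

lemma normal_nor_part: "normal_on G f S (\<lambda>z. nor_part G f z (W z))"
  unfolding normal_on_def nor_part_def
  by (simp add: G_simps[OF f_in] G_tan_part)

text \<open>The tangential part of the ambient derivative is symmetric and compatible with the
  induced metric, so uniqueness makes it the Levi-Civita connection.\<close>

lemma christoffel_induced:
  assumes z: "z \<in> S"
  shows "christoffel h z u v = tan_part G f z (D (X v) z u)"
proof -
  define B where "B = (\<lambda>u v. tan_part G f z (D (X v) z u))"
  have d: "X v differentiable (at z)" for v by (rule smooth_on_differentiable[OF smooth_df z])
  have Xl: "D (X (v + v')) z u = D (X v) z u + D (X v') z u" "D (X (r *\<^sub>R v)) z u = r *\<^sub>R D (X v) z u" for v v' u r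
  proof -
    show "D (X (v + v')) z u = D (X v) z u + D (X v') z u"
      unfolding D_add[OF z d d, symmetric] by (rule D_cong[OF z]) (simp add: df_simps)
    \<comment> \<open>Torsion-freeness moves the scalar into the direction of differentiation, where
      \<open>D\<close> is linear.\<close>
    show "D (X (r *\<^sub>R v)) z u = r *\<^sub>R D (X v) z u"
      using D_torsion_free[OF z, of "r *\<^sub>R v" u] D_torsion_free[OF z, of v u] linear_scale[OF linear_D[OF z d]] by simp
  qed
  have "christoffel h z = B"
  proof (rule H.christoffel_unique(2)[OF z])
    show "bilinear B"
      by (rule bilinearI') (simp_all add: B_def linear_add[OF linear_D[OF z d]] linear_scale[OF linear_D[OF z d]] Xl tan_simps[OF z])
    show "B u v = B v u" for u v by (simp add: B_def D_torsion_free[OF z, of v u])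
    show "dd (\<lambda>z. h z v w) z u = h z (B u v) w + h z v (B u w)" for u v w
      using D_metric[OF z d d, of v w u] tan_part_inner[OF z] H.G_sym[OF z, of v] G_sym[OF f_in[OF z], of "X v z"]
      by (simp add: induced_metric_def[of G f] B_def)
  qed
  then show ?thesis by (simp add: B_def)
qed

lemma gauss_formula:
  shows "D (X v) z u = dd f z (christoffel h z u v) + \<sigma> z u v"
  by (simp add: second_ff_def cov_const)

lemma second_ff_normal: "z \<in> S \<Longrightarrow> G (f z) (\<sigma> z u v) (dd f z w) = 0"
  by (simp add: second_ff_def cov_const christoffel_induced G_simps[OF f_in] G_tan_part)

lemma smooth_second_ff: "smooth_on S (\<lambda>z. \<sigma> z u v)"
  unfolding second_ff_def cov_const
  by (intro smooth_on_diff open_S smooth_D smooth_df smooth_df_field H.christoffel_smooth)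

lemma
  assumes z: "z \<in> S"
  shows second_ff_bilinear: "bilinear (\<sigma> z)" and second_ff_sym: "\<sigma> z u v = \<sigma> z v u"
proof -
  show sym: "\<sigma> z u v = \<sigma> z v u" for u v
    by (simp add: second_ff_def cov_const D_torsion_free[OF z, of v u] H.christoffel_sym[OF z, of u v])
  have d: "X v differentiable (at z)" for v by (rule smooth_on_differentiable[OF smooth_df z])
  have l: "\<sigma> z (u + u') v = \<sigma> z u v + \<sigma> z u' v" "\<sigma> z (r *\<^sub>R u) v = r *\<^sub>R \<sigma> z u v" for u u' v r
    by (simp_all add: second_ff_def cov_const linear_add[OF linear_D[OF z d]] linear_scale[OF linear_D[OF z d]]
        H.chr_simps[OF z] df_simps[OF z] algebra_simps)
  show "bilinear (\<sigma> z)"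
    by (rule bilinearI') (simp_all add: l, simp_all add: sym[of _ "_ + _"] sym[of _ "_ *\<^sub>R _"] l, simp_all add: sym)
qed

lemma D_tangent:
  assumes z: "z \<in> S" and Y: "smooth_on S Y"
  shows "D (\<lambda>z. dd f z (Y z)) z u = dd f z (cov h Y z u) + \<sigma> z u (Y z)"
proof -
  have "dd (\<lambda>z. dd f z (Y z)) z u = dd (X (Y z)) z u + dd f z (dd Y z u)"
    by (rule dd_linear_eval[OF open_S z linear_df])
      (auto intro: smooth_on_differentiable[OF smooth_df z] smooth_on_differentiable[OF Y z])
  then have "D (\<lambda>z. dd f z (Y z)) z u = D (X (Y z)) z u + dd f z (dd Y z u)"
    by (simp add: cov_along_def)
  then show ?thesis by (simp add: gauss_formula cov_def df_simps[OF z])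
qed

text \<open>Obtained by differentiating \<open>G (f z) (W z) (X v z) = 0\<close>.\<close>

lemma shape_inner:
  assumes z: "z \<in> S" and W: "W differentiable (at z)" "normal_on G f S W"
  shows "h z (shape G f W z u) v = G (f z) (W z) (\<sigma> z u v)"
proof -
  have "dd (\<lambda>z. G (f z) (W z) (X v z)) z u = dd (\<lambda>_. 0) z u"
    by (rule dd_cong[OF open_S z, THEN fun_cong]) (use W(2) in \<open>simp add: normal_on_def\<close>)
  then have "G (f z) (D W z u) (X v z) + G (f z) (W z) (D (X v) z u) = 0"
    using D_metric[OF z W(1) smooth_on_differentiable[OF smooth_df z], of v u]
    by (simp add: frechet_derivative_const)
  moreover have "G (f z) (W z) (dd f z w) = 0" for w using W(2) z by (simp add: normal_on_def)
  ultimately show ?thesis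
    by (simp add: shape_def H.G_simps[OF z] tan_part_inner[OF z] gauss_formula G_simps[OF f_in[OF z]])
qed

text \<open>The Gauss equation, the tangential part of \<open>D_curvature\<close> for the field
  \<open>X w\<close>. Only the tangential part of the derivative of \<sigma> enters, and
  differentiating \<open>G (f z) (\<sigma> z v w) (X x z) = 0\<close> expresses it by a product of
  two values of \<sigma>.\<close>

lemma riem_gauss:
  assumes z: "z \<in> S"
  shows "h z (riem h z u v w) x = Riem (f z) (X u z) (X v z) (X w z) (X x z)
    + G (f z) (\<sigma> z v w) (\<sigma> z u x) - G (f z) (\<sigma> z u w) (\<sigma> z v x)"
proof -
  have *: "G (f z) (D (\<lambda>z. D (X w) z v) z u) (X x z)
    = h z (cov h (\<lambda>z. cov h (\<lambda>_. w) z v) z u) x - G (f z) (\<sigma> z v w) (\<sigma> z u x)" for u v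
  proof -
    note d\<sigma> = smooth_on_differentiable[OF smooth_second_ff z] 
    have "D (\<lambda>z. D (X w) z v) z u
      = D (\<lambda>z. dd f z (christoffel h z v w)) z u + D (\<lambda>z. \<sigma> z v w) z u"
      unfolding gauss_formula
      by (rule D_add[OF z smooth_on_differentiable[OF smooth_df_field[OF H.christoffel_smooth] z] d\<sigma>])
    also have "D (\<lambda>z. dd f z (christoffel h z v w)) z u
      = dd f z (cov h (\<lambda>z. cov h (\<lambda>_. w) z v) z u) + \<sigma> z u (christoffel h z v w)"
      by (simp add: D_tangent[OF z H.christoffel_smooth] cov_const)
    finally have 1: "G (f z) (D (\<lambda>z. D (X w) z v) z u) (X x z)
      = h z (cov h (\<lambda>z. cov h (\<lambda>_. w) z v) z u) x + G (f z) (D (\<lambda>z. \<sigma> z v w) z u) (X x z)"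
      by (simp add: G_simps[OF f_in[OF z]] second_ff_normal[OF z] induced_metric_def)
    have "dd (\<lambda>z. G (f z) (\<sigma> z v w) (X x z)) z u = dd (\<lambda>_. 0) z u"
      by (rule dd_cong[OF open_S z, THEN fun_cong]) (simp add: second_ff_normal)
    then have "G (f z) (D (\<lambda>z. \<sigma> z v w) z u) (X x z) + G (f z) (\<sigma> z v w) (D (X x) z u) = 0"
      using D_metric[OF z d\<sigma> smooth_on_differentiable[OF smooth_df z], of v w x u]
      by (simp add: frechet_derivative_const)
    then show ?thesis
      unfolding 1 by (simp add: gauss_formula G_simps[OF f_in[OF z]] second_ff_normal[OF z])
  qed
  have "Riem (f z) (X u z) (X v z) (X w z) (X x z)
    = G (f z) (D (\<lambda>z. D (X w) z v) z u) (X x z) - G (f z) (D (\<lambda>z. D (X w) z u) z v) (X x z)"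
    unfolding Riem_def D_curvature[OF z smooth_df, symmetric] by (simp add: G_simps[OF f_in[OF z]])
  moreover have "h z (riem h z u v w) x = h z (cov h (\<lambda>z. cov h (\<lambda>_. w) z v) z u) x
    - h z (cov h (\<lambda>z. cov h (\<lambda>_. w) z u) z v) x"
    unfolding H.cov_curvature[OF z smooth_on_const, symmetric] by (simp add: H.G_simps[OF z])
  ultimately show ?thesis unfolding * by simp
qed

end

section \<open>Normal fields parallel in the normal bundle: the Codazzi equation and the
  uncontracted Simons formula\<close>

locale parallel_normal_field = immersion \<Omega> G S f
  for \<Omega> :: "'q::euclidean_space set" and G and S :: "'m::euclidean_space set" and f :: "'m \<Rightarrow> 'q" +
  fixes V :: "'m \<Rightarrow> 'q"
  assumes smooth_V: "smooth_on S V" and normal_V: "normal_on G f S V"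
    and parallel_V: "z \<in> S \<Longrightarrow> normal_conn G f V z u = 0"
begin

abbreviation "A \<equiv> shape G f V"

lemma D_V: "z \<in> S \<Longrightarrow> D V z u = - dd f z (A z u)"
  using parallel_V[of z u] by (simp add: normal_conn_def nor_part_def shape_def df_simps)

lemma A_inner: "z \<in> S \<Longrightarrow> h z (A z u) v = G (f z) (V z) (\<sigma> z u v)"
  by (rule shape_inner[OF _ smooth_on_differentiable[OF smooth_V] normal_V])

lemma smooth_A: "H.smooth_endo A"
  unfolding H.smooth_endo_def
proof (intro conjI ballI allI)
  show "linear (A z)" if z: "z \<in> S" for z
    by (rule linearI; rule inner_form_ext[OF H.inner_form_G[OF z]])
      (simp_all add: A_inner[OF z] H.G_simps[OF z] bilinear_simps[OF second_ff_bilinear[OF z]] G_simps[OF f_in[OF z]])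
  show "smooth_on S (\<lambda>z. A z v)" for v
    unfolding shape_def by (intro smooth_on_minus open_S smooth_tan_part smooth_D smooth_V)
qed

lemma symmetric_A: "H.symmetric_endo A"
  unfolding H.symmetric_endo_def
  by (simp add: A_inner H.G_sym[of _ _ "A _ _"] second_ff_sym)

lemma codazzi:
  assumes z: "z \<in> S"
  shows "h z (cov_endo h A z u v - cov_endo h A z v u) w = - Riem (f z) (X u z) (X v z) (V z) (X w z)"
proof -
  have *: "D (\<lambda>z. D V z v) z u = - dd f z (cov h (\<lambda>z. A z v) z u) - \<sigma> z u (A z v)" for u v
  proof -
    have "D (\<lambda>z. D V z v) z u = D (\<lambda>z. - dd f z (A z v)) z u"
      by (rule D_cong[OF z]) (rule D_V)
    also have "\<dots> = - D (\<lambda>z. dd f z (A z v)) z u"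
      by (rule D_minus[OF z smooth_on_differentiable[OF smooth_df_field[OF H.endo_smooth[OF smooth_A]] z]])
    finally show ?thesis by (simp add: D_tangent[OF z H.endo_smooth[OF smooth_A]])
  qed
  have "Riem (f z) (X u z) (X v z) (V z) (X w z)
    = G (f z) (D (\<lambda>z. D V z v) z u - D (\<lambda>z. D V z u) z v) (X w z)"
    unfolding Riem_def D_curvature[OF z smooth_V] ..
  \<comment> \<open>Tested against the tangent vector \<open>X w\<close>, the normal terms
    \<open>\<sigma> z u (A z v)\<close> drop out.\<close>
  also have "\<dots> = - h z (cov h (\<lambda>z. A z v) z u - cov h (\<lambda>z. A z u) z v) w"
    unfolding * by (simp add: G_simps[OF f_in[OF z]] H.G_simps[OF z] second_ff_normal[OF z])
      (simp add: induced_metric_def)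
  also have "cov h (\<lambda>z. A z v) z u - cov h (\<lambda>z. A z u) z v = cov_endo h A z u v - cov_endo h A z v u"
    by (simp add: H.cov_eq_cov_endo H.christoffel_sym[OF z, of u v])
  finally show ?thesis by simp
qed

end

text \<open>The ambient space is locally symmetric along \<open>f\<close>: the product rule states
  \<open>\<nabla>R = 0\<close>. The explicit form of the curvature enters only in the
  contraction.\<close>

locale parallel_normal_field_symmetric = parallel_normal_field +
  assumes parallel_Riem: "z \<in> S \<Longrightarrow> smooth_on S W1 \<Longrightarrow> smooth_on S W2 \<Longrightarrow> smooth_on S W3 \<Longrightarrow> smooth_on S W4 \<Longrightarrow>
    dd (\<lambda>z. Riem (f z) (W1 z) (W2 z) (W3 z) (W4 z)) z u =
      Riem (f z) (D W1 z u) (W2 z) (W3 z) (W4 z) + Riem (f z) (W1 z) (D W2 z u) (W3 z) (W4 z)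
    + Riem (f z) (W1 z) (W2 z) (D W3 z u) (W4 z) + Riem (f z) (W1 z) (W2 z) (W3 z) (D W4 z u)"
begin

text \<open>By \<open>\<nabla>R = 0\<close> this is the covariant derivative in direction \<open>x\<close> of the right hand side
  \<open>- R(u,v,V,w)\<close> of the Codazzi equation; \<open>V\<close> contributes the term with \<open>D\<^sub>x V = - A x\<close>.\<close>

definition dcod :: "'b \<Rightarrow> 'b \<Rightarrow> 'b \<Rightarrow> 'b \<Rightarrow> 'b \<Rightarrow> real"
  where "dcod z x u v w = Riem (f z) (X u z) (X v z) (X (A z x) z) (X w z)
    - Riem (f z) (\<sigma> z x u) (X v z) (V z) (X w z) - Riem (f z) (X u z) (\<sigma> z x v) (V z) (X w z)
    - Riem (f z) (X u z) (X v z) (V z) (\<sigma> z x w)"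

text \<open>The Codazzi equation is differentiated as an equation between functions, with constant
  \<open>u\<close>, \<open>v\<close>, \<open>w\<close>. Each side also produces Christoffel terms.
  They are values of \<open>C\<close>, on the right side by the Codazzi equation at \<open>z\<close>
  itself, and cancel.\<close>

lemma codazzi_derivative:
  assumes z: "z \<in> S"
  shows "h z (cov_endo2 h A z x u v - cov_endo2 h A z x v u) w = dcod z x u v w"
proof -
  let ?\<Gamma> = "christoffel h z"
  define C where "C = (\<lambda>u v w. h z (cov_endo h A z u v - cov_endo h A z v u) w)"
  have C: "C u v w = - Riem (f z) (X u z) (X v z) (V z) (X w z)" for u v w
    unfolding C_def by (rule codazzi[OF z])
  note A' = H.smooth_endo_cov[OF smooth_A] and Ad = H.endo_differentiable[OF H.smooth_endo_cov[OF smooth_A] z]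
  have cd: "cov h (\<lambda>z. cov_endo h A z u v - cov_endo h A z v u) z x
    = cov h (\<lambda>z. cov_endo h A z u v) z x - cov h (\<lambda>z. cov_endo h A z v u) z x"
    using dd_eqI[OF has_derivative_diff[OF dd_has_derivative[OF Ad] dd_has_derivative[OF Ad]], of u v v u]
    by (simp add: cov_def H.chr_simps[OF z])
  have "dd (\<lambda>z. h z (cov_endo h A z u v - cov_endo h A z v u) w) z x
    = h z (cov h (\<lambda>z. cov_endo h A z u v) z x - cov h (\<lambda>z. cov_endo h A z v u) z x) w + C u v (?\<Gamma> x w)"
    using H.cov_metric[OF z differentiable_diff[OF Ad Ad] differentiable_const, of u v v u w x]
    by (simp add: C_def cd cov_const)
  also have "\<dots> = h z (cov_endo2 h A z x u v - cov_endo2 h A z x v u) w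
    + C (?\<Gamma> x u) v w + C u (?\<Gamma> x v) w + C u v (?\<Gamma> x w)"
    by (simp add: H.cov_eq_cov_endo[of "\<lambda>z. cov_endo h A z _"] cov_endo2_def cov_const C_def H.G_simps[OF z])
  finally have 1: "dd (\<lambda>z. h z (cov_endo h A z u v - cov_endo h A z v u) w) z x
    = h z (cov_endo2 h A z x u v - cov_endo2 h A z x v u) w
    + C (?\<Gamma> x u) v w + C u (?\<Gamma> x v) w + C u v (?\<Gamma> x w)" .
  \<comment> \<open>The curvature expression inherits differentiability from the other side of the
    Codazzi equation.\<close>
  have sR: "(\<lambda>z. Riem (f z) (X u z) (X v z) (V z) (X w z)) differentiable (at z)"
  proof -
    have "(\<lambda>z. - h z (cov_endo h A z u v - cov_endo h A z v u) w) differentiable (at z)"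
      by (rule smooth_on_differentiable[OF _ z])
        (intro smooth_on_minus open_S smooth_on_bilinear[OF open_S H.G_bilinear H.smooth_G] smooth_on_diff
          H.endo_smooth[OF A'] smooth_on_const)
    then show ?thesis by (rule differentiable_cong[OF open_S z, rotated]) (simp add: codazzi)
  qed
  have "dd (\<lambda>z. h z (cov_endo h A z u v - cov_endo h A z v u) w) z x
    = dd (\<lambda>z. - Riem (f z) (X u z) (X v z) (V z) (X w z)) z x"
    by (rule dd_cong[OF open_S z, THEN fun_cong]) (rule codazzi)
  also have "\<dots> = - dd (\<lambda>z. Riem (f z) (X u z) (X v z) (V z) (X w z)) z x"
    by (rule dd_bounded_linear[OF bounded_linear_minus[OF bounded_linear_ident] sR])
  also have "\<dots> = dcod z x u v w + C (?\<Gamma> x u) v w + C u (?\<Gamma> x v) w + C u v (?\<Gamma> x w)"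
    unfolding parallel_Riem[OF z smooth_df smooth_df smooth_V smooth_df]
    by (simp add: D_V[OF z] gauss_formula Riem_add[OF f_in[OF z]] Riem_minus3[OF f_in[OF z]] C dcod_def)
  finally show ?thesis using 1 by simp
qed

definition gauss_Riem :: "'b \<Rightarrow> 'b \<Rightarrow> 'b \<Rightarrow> 'b \<Rightarrow> 'b \<Rightarrow> real"
  where "gauss_Riem z u v w x = Riem (f z) (X u z) (X v z) (X w z) (X x z)
    + G (f z) (\<sigma> z v w) (\<sigma> z u x) - G (f z) (\<sigma> z u w) (\<sigma> z v x)"

lemma simons_formula:
  assumes z: "z \<in> S" and B: "orthonormal_basis (h z) B"
    and const: "\<And>z. z \<in> S \<Longrightarrow> endo_trace (h z) (A z) = k"
  shows "1/2 * laplacian h (\<lambda>z. endo_norm2 (h z) (A z)) z = cov_endo_norm2 h A z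
    + (\<Sum>i\<in>B. \<Sum>j\<in>B. gauss_Riem z i j (A z i) (A z j) - gauss_Riem z i j i (A z (A z j))
        + dcod z i i j (A z j) + dcod z j i (A z j) i)"
proof -
  note G_h = H.G_simps[OF z]
  let ?N = "cov_endo2 h A z"
  have sA: "h z (A z v) w = h z v (A z w)" for v w using symmetric_A z by (simp add: H.symmetric_endo_def)
  have tr0: "(\<Sum>i\<in>B. h z (?N u v i) i) = 0" for u v
  proof -
    have bil: "bilinear (\<lambda>p q. h z (?N u v p) q)"
      by (rule bilinearI') (simp_all add: cov_endo2_def H.cov_endo_linear[OF H.smooth_endo_cov[OF smooth_A] z]
          H.cov_endo_linear[OF smooth_A z] G_h algebra_simps)
    have "endo_trace (h z) (?N u v) = (\<Sum>i\<in>B. h z (?N u v i) i)"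
      unfolding endo_trace_def by (rule metric_trace_eq[OF H.inner_form_G[OF z] B bil])
    then show ?thesis using H.trace_cov_endo2_zero[OF smooth_A const z, of u v] by simp
  qed
  have step: "h z (?N i i j) (A z j) = gauss_Riem z i j (A z i) (A z j) - gauss_Riem z i j i (A z (A z j))
        + dcod z i i j (A z j) + dcod z j i (A z j) i + h z (?N j (A z j) i) i" for i j
  proof -
    have "h z (?N i i j) (A z j) = h z (?N i j i) (A z j) + dcod z i i j (A z j)"
      using codazzi_derivative[OF z, of i i j "A z j"] by (simp add: G_h)
    also have "h z (?N i j i) (A z j) = h z (?N j i i) (A z j)
        + h z (riem h z i j (A z i)) (A z j) - h z (A z (riem h z i j i)) (A z j)"
      using arg_cong[OF H.ricci_identity[OF smooth_A z, of i j i], of "\<lambda>t. h z t (A z j)"] by (simp add: G_h)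
    \<comment> \<open>The second derivative of a symmetric field is symmetric in its last two slots.
      This brings \<open>A z j\<close> next to the direction \<open>i\<close>, so that the
      differentiated Codazzi equation can exchange them.\<close>
    also have "h z (?N j i i) (A z j) = h z (?N j i (A z j)) i"
      using H.cov_endo2_symmetric[OF smooth_A symmetric_A z, of j i i "A z j"] H.G_sym[OF z] by metis
    also have "\<dots> = h z (?N j (A z j) i) i + dcod z j i (A z j) i"
      using codazzi_derivative[OF z, of j i "A z j" i] by (simp add: G_h)
    also have "h z (A z (riem h z i j i)) (A z j) = gauss_Riem z i j i (A z (A z j))"
      unfolding sA by (simp add: riem_gauss[OF z] gauss_Riem_def)
    also have "h z (riem h z i j (A z i)) (A z j) = gauss_Riem z i j (A z i) (A z j)"
      by (simp add: riem_gauss[OF z] gauss_Riem_def)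
    finally show ?thesis by simp
  qed
  \<comment> \<open>For fixed \<open>j\<close> the sum over \<open>i\<close> is the trace of the
    second derivative in the directions \<open>j\<close> and \<open>A z j\<close>.\<close>
  have "(\<Sum>i\<in>B. \<Sum>j\<in>B. h z (?N j (A z j) i) i) = 0"
    by (subst sum.swap) (simp add: tr0)
  then show ?thesis
    unfolding H.laplacian_endo_norm2[OF smooth_A z B] step by (simp add: sum.distrib)
qed

end

section \<open>Curvature of complex space forms and products\<close>

text \<open>The curvature of the product of a complex space form with the real line; \<open>g u \<xi>\<close> is \<open>\<eta>(u)\<close>.\<close>

definition space_form_tensor ::
    "real \<Rightarrow> ('q \<Rightarrow> 'q \<Rightarrow> real) \<Rightarrow> ('q \<Rightarrow> 'q) \<Rightarrow> 'q \<Rightarrow> 'q \<Rightarrow> 'q \<Rightarrow> 'q \<Rightarrow> 'q \<Rightarrow> real"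
  where "space_form_tensor c g \<phi> \<xi> u v w y = c / 4 * (g v w * g u y - g u w * g v y
    + g u (\<phi> w) * g (\<phi> v) y - g v (\<phi> w) * g (\<phi> u) y + 2 * (g u (\<phi> v) * g (\<phi> w) y)
    + g u \<xi> * g w \<xi> * g v y - g v \<xi> * g w \<xi> * g u y + g u w * g v \<xi> * g y \<xi> - g v w * g u \<xi> * g y \<xi>)"

text \<open>A Kaehler curvature tensor is determined by its holomorphic sectional curvatures;
  \<open>K\<close> stands for a difference of two of them. Polarizing \<open>q\<close> gives
  \<open>mixed\<close>, which the Bianchi identity and the invariance under \<open>J\<close> turn
  into \<open>sec\<close>. Replacing \<open>y\<close> by \<open>J y\<close> yields a second,
  independent linear equation, so all sectional curvatures vanish, and with them
  \<open>K\<close>.\<close>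

lemma kaehler_curvature_zero:
  fixes K :: "'v::real_vector \<Rightarrow> 'v \<Rightarrow> 'v \<Rightarrow> 'v \<Rightarrow> real"
  assumes add1: "\<And>u u' v w y. K (u + u') v w y = K u v w y + K u' v w y"
    and add3: "\<And>u v w w' y. K u v (w + w') y = K u v w y + K u v w' y"
    and skew12: "\<And>u v w y. K v u w y = - K u v w y"
    and skew34: "\<And>u v w y. K u v y w = - K u v w y"
    and bianchi: "\<And>u v w y. K u v w y + K v w u y + K w u v y = 0"
    and J: "linear J" "\<And>u. J (J u) = - u" "\<And>u v w y. K u v (J w) (J y) = K u v w y"
    and hol: "\<And>u. K u (J u) (J u) u = 0"
  shows "K u v w y = 0"
proof -
  have add2: "K u (v + v') w y = K u v w y + K u v' w y" for u v v' w y
    using skew12[of u "v + v'" w y] skew12[of u v w y] skew12[of u v' w y] add1[of v v' u w y] by linarith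
  have add4: "K u v w (y + y') = K u v w y + K u v w y'" for u v w y y'
    using skew34[of u v w "y + y'"] skew34[of u v w y] skew34[of u v w y'] add3[of u v y y' w] by linarith
  \<comment> \<open>The classical octahedron argument: four Bianchi identities combined with the two
    skew symmetries.\<close>
  have pair: "K u v w y = K w y u v" for u v w y
    using bianchi[of u v w y] bianchi[of v w y u] bianchi[of w y u v] bianchi[of y u v w]
      skew12[of u w v y] skew12[of v y w u] skew12[of u y w v] skew12[of u y v w]
      skew34[of v y u w] skew34[of v w u y] skew34[of w y u v] skew34[of u y v w] skew34[of u w v y]
      skew34[of u v w y] by linarith
  have J12: "K (J u) (J v) w y = K u v w y" for u v w y using pair J(3) by metis
  have neg1: "K (- u) v w y = - K u v w y" for u v w y
    using add1[of u "- u" v w y] add1[of 0 0 v w y] by simp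
  have neg2: "K u (- v) w y = - K u v w y" for u v w y
    using neg1[of v u w y] skew12 by metis
  have neg3: "K u v (- w) y = - K u v w y" for u v w y
    using neg1[of w y u v] pair by metis
  have neg4: "K u v w (- y) = - K u v w y" for u v w y
    using neg2[of w y u v] pair by metis
  have Jm: "J (- u) = - J u" "J (u + v) = J u + J v" for u v
    using J(1) by (simp_all add: linear_add linear_neg)
  define q where "q x = K x (J x) x (J x)" for x
  have q0: "q x = 0" for x using hol[of x] skew34[of x "J x" "J x" x] by (simp add: q_def)
  text \<open>The part of \<open>q (x + y)\<close> that is quadratic in both arguments is isolated by averaging over \<open>\<pm>y\<close>.\<close>
  have mixed: "K x (J x) y (J y) + 2 * K x (J y) x (J y) = 0" for x y
  proof -
    have "q (x + y) + q (x + - y) - 2 * q x - 2 * q y =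
       2 * (K x (J x) y (J y) + K y (J y) x (J x) + K x (J y) x (J y) + K x (J y) y (J x)
         + K y (J x) x (J y) + K y (J x) y (J x))"
      unfolding q_def Jm add1 add2 add3 add4 neg1 neg2 neg3 neg4 by simp
    moreover have "K y (J y) x (J x) = K x (J x) y (J y)" by (rule pair)
    moreover have JK: "K y (J x) w z = K x (J y) w z" for w z
      using J12[of y "J x" w z] skew12[of "J y" x w z] neg2[of "J y" x w z] J(2)[of x] by simp
    moreover have "K w z y (J x) = K w z x (J y)" for w z
      using JK[of w z] pair by metis
    ultimately show ?thesis using q0 by simp
  qed
  have sec: "K x y x y + 3 * K x (J y) x (J y) = 0" for x y
  proof -
    have "K x (J x) y (J y) = - K (J x) y x (J y) - K y x (J x) (J y)"
      using bianchi[of x "J x" y "J y"] by linarith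
    moreover have "K (J x) y x (J y) = - K x (J y) x (J y)"
      using J12[of "J x" y x "J y"] neg1[of x "J y"] J(2)[of x] by simp
    moreover have "K y x (J x) (J y) = - K x y x y" using J(3)[of y x x y] skew12[of x y x y] by simp
    ultimately show ?thesis using mixed[of x y] by linarith
  qed
  have s0: "K x y x y = 0" for x y
  proof -
    have "K x (J y) x (J y) + 3 * K x y x y = 0"
      using sec[of x "J y"] by (simp add: J(2) neg2 neg4)
    then show ?thesis using sec[of x y] by linarith
  qed
  have s1: "K x y z y = 0" for x y z
    using s0[of "x + z" y] s0[of x y] s0[of z y] pair[of x y z y] by (simp add: add1 add3)
  have s2: "K x y z w = - K x w z y" for x y z w
    using s1[of x "y + w" z] s1[of x y z] s1[of x w z] by (simp add: add2 add4)
  \<comment> \<open>\<open>K\<close> is now also skew in its second and fourth argument. Then the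
    three terms of the Bianchi identity coincide and \<open>3 K = 0\<close>.\<close>
  show ?thesis
    using bianchi[of u v w y] s2[of u v w y] s2[of u w v y] skew12[of u w v y] skew34[of u y v w]
      pair[of v w u y] by linarith
qed

section \<open>Symmetries of the curvature tensor and its form on a complex space form\<close>

context riemannian
begin

lemma Riem_skew12: "x \<in> \<Omega> \<Longrightarrow> Riem x v u w y = - Riem x u v w y"
  unfolding Riem_def riem_christoffel by (simp add: G_simps)

text \<open>Second derivatives of \<open>G z w y\<close> commute. In the expansion by metric
  compatibility the products of two first derivatives are symmetric in \<open>u\<close> and
  \<open>v\<close>, so only curvature terms remain in the difference.\<close>

lemma Riem_skew34:
  assumes x: "x \<in> \<Omega>"
  shows "Riem x u v y w = - Riem x u v w y"
proof -
  let ?c = "\<lambda>v w z. cov G (\<lambda>_. w) z v"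
  have s: "smooth_on \<Omega> (?c v w)" for v w unfolding cov_const by (rule christoffel_smooth)
  note d = smooth_on_differentiable[OF s]
  have sG: "smooth_on \<Omega> (\<lambda>z. G z (W z) (W' z))" if "smooth_on \<Omega> W" "smooth_on \<Omega> W'" for W W'
    by (rule smooth_on_bilinear[OF open_Omega G_bilinear smooth_G that])
  have *: "dd (\<lambda>z. dd (\<lambda>z. G z w y) z v) x u
     = G x (cov G (?c v w) x u) y + G x (?c v w x) (?c u y x) + G x (?c u w x) (?c v y x) + G x w (cov G (?c v y) x u)"
    for u v
  proof -
    have "dd (\<lambda>z. dd (\<lambda>z. G z w y) z v) x u = dd (\<lambda>z. G z (?c v w z) y + G z w (?c v y z)) x u"
      by (rule dd_cong[OF open_Omega x, THEN fun_cong]) (rule cov_metric, auto)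
    also have "\<dots> = dd (\<lambda>z. G z (?c v w z) y) x u + dd (\<lambda>z. G z w (?c v y z)) x u"
      by (rule dd_eqI[THEN fun_cong], rule has_derivative_add; rule dd_has_derivative,
        rule smooth_on_differentiable[OF sG x]; intro s smooth_on_const)
    finally show ?thesis
      using cov_metric[OF x d[OF x] differentiable_const, of w v y u]
        cov_metric[OF x differentiable_const d[OF x], of w y v u] by simp
  qed
  have "Riem x u v w y = G x (cov G (?c v w) x u) y - G x (cov G (?c u w) x v) y"
    "Riem x u v y w = G x (cov G (?c v y) x u) w - G x (cov G (?c u y) x v) w"
    unfolding Riem_def using cov_curvature[OF x smooth_on_const, of _ v u, symmetric]
    by (simp_all add: G_simps[OF x])
  then show ?thesis
    using *[of v u] *[of u v] symmetric_second_derivative[OF open_Omega x smooth_G, of w y v u]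
      G_sym[OF x, of w] by simp
qed

lemma Riem_bianchi:
  assumes x: "x \<in> \<Omega>"
  shows "Riem x u v w y + Riem x v w u y + Riem x w u v y = 0"
proof -
  have s: "dd (\<lambda>z. christoffel G z v w) x u = dd (\<lambda>z. christoffel G z w v) x u" for v w u
    by (rule dd_cong[OF open_Omega x, THEN fun_cong]) (rule christoffel_sym)
  have "riem G x u v w + riem G x v w u + riem G x w u v = 0"
    unfolding riem_christoffel[OF x] s[of w v] s[of w u] s[of v u]
      christoffel_sym[OF x, of w v] christoffel_sym[OF x, of w u] christoffel_sym[OF x, of v u]
    by (simp add: algebra_simps)
  then show ?thesis unfolding Riem_def
    by (metis G_simps(1) G_simps(9) x)
qed

text \<open>The Ricci identity, the second derivative of \<open>J\<close> being zero.\<close>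

lemma riem_parallel_endo:
  assumes J: "smooth_endo J" "\<And>z u v. z \<in> \<Omega> \<Longrightarrow> cov_endo G J z u v = 0" and x: "x \<in> \<Omega>"
  shows "riem G x u v (J x w) = J x (riem G x u v w)"
proof -
  have "cov_endo2 G J x u v w = 0" for u v
  proof -
    have "dd (\<lambda>z. cov_endo G J z v w) x u = dd (\<lambda>_. 0) x u"
      by (rule dd_cong[OF open_Omega x, THEN fun_cong]) (rule J(2))
    then show ?thesis
      by (simp add: cov_endo2_def cov_endo_eq[of G "\<lambda>z. cov_endo G J z v"] J(2)[OF x] chr_simps[OF x]
        frechet_derivative_const)
  qed
  then show ?thesis using ricci_identity[OF J(1) x, of u v w] by simp
qed

text \<open>The difference \<open>K\<close> of the curvature and its model has all the symmetries of
  a Kaehler curvature tensor and vanishes on holomorphic planes, so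
  \<open>kaehler_curvature_zero\<close> applies.\<close>

lemma Riem_complex_space_form:
  assumes J: "smooth_endo J" "\<And>z u v. z \<in> \<Omega> \<Longrightarrow> cov_endo G J z u v = 0"
    "\<And>u. J x (J x u) = - u" "\<And>u v. G x (J x u) (J x v) = G x u v"
    and hol: "\<And>u. u \<noteq> 0 \<Longrightarrow> sectional_curvature G x u (J x u) = c" and x: "x \<in> \<Omega>"
  shows "Riem x u v w y = c / 4 * (G x v w * G x u y - G x u w * G x v y + G x u (J x w) * G x (J x v) y
    - G x v (J x w) * G x (J x u) y + 2 * G x u (J x v) * G x (J x w) y)"
proof -
  define R0 where "R0 u v w y = G x v w * G x u y - G x u w * G x v y + G x u (J x w) * G x (J x v) y
    - G x v (J x w) * G x (J x u) y + 2 * G x u (J x v) * G x (J x w) y" for u v w y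
  define K where "K u v w y = Riem x u v w y - c / 4 * R0 u v w y" for u v w y
  note lin = G_simps[OF x] endo_add[OF J(1) x]
  have skew: "G x (J x u) v = - G x u (J x v)" for u v
    using J(4)[of u "J x v"] by (simp add: J(3) G_simps[OF x])
  have skew': "G x (J x u) v = - G x (J x v) u" for u v
    using skew[of u v] G_sym[OF x, of u] by simp
  \<comment> \<open>With \<open>J\<close> always in the first slot the symmetries of the model
    tensor reduce to skewness and ring arithmetic.\<close>
  have R0: "R0 u v w y = G x v w * G x u y - G x u w * G x v y - G x (J x u) w * G x (J x v) y
    + G x (J x v) w * G x (J x u) y - 2 * G x (J x u) v * G x (J x w) y" for u v w y
    by (simp add: R0_def skew[symmetric] skew'[of w y]) (simp add: skew)
  have 0: "K u v w y = 0"
  proof (rule kaehler_curvature_zero[of K "J x"])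
    show "linear (J x)" by (rule endo_linear[OF J(1) x])
    show "J x (J x u) = - u" for u by (rule J(3))
    show "K (u + u') v w y = K u v w y + K u' v w y" for u u' v w y
      by (simp add: K_def R0 Riem_add[OF x] lin algebra_simps)
    show "K u v (w + w') y = K u v w y + K u v w' y" for u v w w' y
      by (simp add: K_def R0 Riem_add[OF x] lin algebra_simps)
    show "K v u w y = - K u v w y" for u v w y
      by (simp add: K_def R0 Riem_skew12[OF x, of v u] skew'[of v u] algebra_simps)
    show "K u v y w = - K u v w y" for u v w y
      by (simp add: K_def R0 Riem_skew34[OF x, of u v y w] skew'[of y w] algebra_simps)
    show "K u v w y + K v w u y + K w u v y = 0" for u v w y
      using Riem_bianchi[OF x, of u v w y]
      by (simp add: K_def R0 skew'[of v u] skew'[of w u] skew'[of w v]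
        G_sym[OF x, of v u] G_sym[OF x, of w u] G_sym[OF x, of w v] algebra_simps)
    show "K u v (J x w) (J x y) = K u v w y" for u v w y
      using J(4) riem_parallel_endo[OF J(1,2) x, of u v w]
      by (simp add: K_def R0 Riem_def J(3) J(4) G_simps[OF x] skew)
    show "K u (J x u) (J x u) u = 0" for u
    proof (cases "u = 0")
      case False
      have 0: "G x u (J x u) = 0" using skew[of u u] G_sym[OF x, of u "J x u"] by simp
      have "G x u u > 0" using inner_form_pos[OF inner_form_G[OF x] False] .
      then have "Riem x u (J x u) (J x u) u = c * (G x u u)\<^sup>2"
        using hol[OF False] by (simp add: sectional_curvature_def J(4) 0 Riem_def riem_def field_simps power2_eq_square)
      \<comment> \<open>On \<open>u\<close> and \<open>J u\<close> the model tensor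
        \<open>R0\<close> has the value \<open>4 * (G x u u)\<^sup>2\<close>, one part from the
        metric terms and three from those with \<open>J\<close>. This explains the factor
        \<open>c / 4\<close>.\<close>
      then show ?thesis
        by (simp add: K_def R0_def J(3) J(4) 0 skew G_simps[OF x] power2_eq_square)
    qed (simp add: K_def R0 G_simps[OF x] Riem_def)
  qed
  then show ?thesis by (simp add: K_def R0_def)
qed

end

lemma dd_Pair_zero:
  assumes "k differentiable (at q)"
  shows "dd (\<lambda>z. (k z, 0)) q u = (dd k q u, 0)"
  by (rule dd_bounded_linear[where L = "\<lambda>v. (v, 0)", OF _ assms])
    (intro bounded_linear_Pair bounded_linear_ident bounded_linear_zero)

section \<open>The Riemannian product with the line\<close>

context riemannian
begin

definition "prod_dom = \<Omega> \<times> (UNIV :: real set)"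
abbreviation "PG \<equiv> product_metric G"

lemma open_prod_dom: "open prod_dom"
  unfolding prod_dom_def by (intro open_Times open_Omega open_UNIV)

lemma smooth_on_fst: "smooth_on \<Omega> k \<Longrightarrow> smooth_on prod_dom (\<lambda>q. k (fst q))"
  for k :: "'q \<Rightarrow> 'w::real_normed_vector"
  by (rule smooth_on_compose[OF open_prod_dom _ smooth_on_bounded_linear[OF open_prod_dom bounded_linear_fst smooth_on_ident]])
    (auto simp: prod_dom_def)

lemma dd_fst:
  fixes k :: "'q \<Rightarrow> 'w::real_normed_vector"
  assumes "k differentiable (at (fst q))"
  shows "dd (\<lambda>q. k (fst q)) (q :: 'q \<times> real) u = dd k (fst q) (fst u)"
proof -
  have "((\<lambda>q. k (fst q)) has_derivative (\<lambda>u. dd k (fst q) (fst u))) (at q)"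
    by (rule has_derivative_compose[of fst fst q UNIV k])
      (auto intro: dd_has_derivative assms bounded_linear.has_derivative[OF bounded_linear_fst] has_derivative_ident)
  from dd_eqI[OF this] show ?thesis by simp
qed

lemma riemannian_product: "riemannian prod_dom PG"
proof
  show "riemannian_metric_on prod_dom PG"
    unfolding riemannian_metric_on_def
  proof (intro conjI ballI allI impI)
    fix q assume "q \<in> prod_dom"
    then have q: "fst q \<in> \<Omega>" by (auto simp: prod_dom_def)
    show "bilinear (PG q)"
      by (rule bilinearI') (simp_all add: product_metric_def G_simps[OF q] algebra_simps)
    show "PG q u v = PG q v u" for u v
      by (simp add: product_metric_def G_sym[OF q, of "fst u"] mult.commute)
    show "PG q u u > 0" if "u \<noteq> 0" for u
    proof (cases "fst u = 0")
      case True
      then show ?thesis using that zero_less_power2[of "snd u"]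
        by (simp add: product_metric_def G_simps[OF q] prod_eq_iff power2_eq_square)
    next
      case False
      then show ?thesis using inner_form_pos[OF inner_form_G[OF q] False]
        by (simp add: product_metric_def add_pos_nonneg)
    qed
  next
    show "smooth_on prod_dom (\<lambda>q. PG q u v)" for u v
      unfolding product_metric_def by (intro smooth_on_add open_prod_dom smooth_on_fst smooth_G smooth_on_const)
  qed
qed (rule open_prod_dom)

interpretation P: riemannian prod_dom PG by (rule riemannian_product)

text \<open>The stated pair is symmetric and compatible with the product metric, so uniqueness
  applies. In particular the constant field \<open>(0, 1)\<close> is parallel.\<close>

lemma christoffel_product:
  assumes "q \<in> prod_dom"
  shows "christoffel PG q u v = (christoffel G (fst q) (fst u) (fst v), 0)"
proof -
  from assms have q: "fst q \<in> \<Omega>" by (auto simp: prod_dom_def)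
  have "christoffel PG q = (\<lambda>u v. (christoffel G (fst q) (fst u) (fst v), 0))"
  proof (rule P.christoffel_unique(2)[OF assms])
    show "bilinear (\<lambda>u v. (christoffel G (fst q) (fst u) (fst v), 0))"
      by (rule bilinearI') (simp_all add: chr_simps[OF q])
    show "(christoffel G (fst q) (fst u) (fst v), 0) = (christoffel G (fst q) (fst v) (fst u), 0)" for u v :: "'q \<times> real"
      by (simp add: christoffel_sym[OF q, of "fst u"])
    fix u v w :: "'q \<times> real"
    have "dd (\<lambda>z. PG z v w) q u = dd (\<lambda>z. G (fst z) (fst v) (fst w)) q u"
      using dd_eqI[OF has_derivative_add[OF dd_has_derivative[OF P.differentiable_G[OF assms, of "(fst v, 0)" "(fst w, 0)"]]
            has_derivative_const[of "snd v * snd w"]]]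
      by (simp add: product_metric_def)
    then show "dd (\<lambda>z. PG z v w) q u = PG q (christoffel G (fst q) (fst u) (fst v), 0) w
        + PG q v (christoffel G (fst q) (fst u) (fst w), 0)"
      by (simp add: dd_fst[OF differentiable_G[OF q]] christoffel_compat[OF q] product_metric_def)
  qed
  then show ?thesis by simp
qed

lemma riem_product:
  assumes "q \<in> prod_dom"
  shows "riem PG q u v w = (riem G (fst q) (fst u) (fst v) (fst w), 0)"
proof -
  from assms have q: "fst q \<in> \<Omega>" by (auto simp: prod_dom_def)
  have "dd (\<lambda>z. christoffel PG z v w) q u = (dd (\<lambda>z. christoffel G z (fst v) (fst w)) (fst q) (fst u), 0)"
    for u v w :: "'q \<times> real"
  proof -
    note d = smooth_on_differentiable[OF smooth_on_fst[OF christoffel_smooth] assms]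
    have "dd (\<lambda>z. christoffel PG z v w) q u = dd (\<lambda>z. (christoffel G (fst z) (fst v) (fst w), 0)) q u"
      by (rule dd_cong[OF open_prod_dom assms, THEN fun_cong]) (rule christoffel_product)
    also have "\<dots> = (dd (\<lambda>z. christoffel G (fst z) (fst v) (fst w)) q u, 0)"
      by (rule dd_Pair_zero[OF d])
    finally show ?thesis by (simp add: dd_fst[OF differentiable_christoffel[OF q]])
  qed
  then show ?thesis
    by (simp add: P.riem_christoffel[OF assms] riem_christoffel[OF q] christoffel_product[OF assms])
qed

lemma cov_endo_product_phi:
  assumes J: "smooth_endo J" and q: "q \<in> prod_dom"
  shows "cov_endo PG (product_phi J) q u v = (cov_endo G J (fst q) (fst u) (fst v), 0)"
proof -
  from q have fq: "fst q \<in> \<Omega>" by (auto simp: prod_dom_def)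
  have "dd (\<lambda>z. product_phi J z v) q u = (dd (\<lambda>z. J (fst z) (fst v)) q u, 0)"
    unfolding product_phi_def
    by (rule dd_Pair_zero[OF smooth_on_differentiable[OF smooth_on_fst[OF endo_smooth[OF J]] q]])
  then show ?thesis
    by (simp add: cov_endo_eq christoffel_product[OF q] dd_fst[OF endo_differentiable[OF J fq]]) (simp add: product_phi_def)
qed

end

section \<open>Contractions of the curvature tensor\<close>

text \<open>The linear algebra at one point, \<open>X\<close> being the differential of the
  immersion. \<open>An\<close>, \<open>Anv\<close> and \<open>Ant\<close> are the shape operators of
  N, nV and n(tV). They are described by the unprojected vectors \<xi>, \<open>\<phi> V\<close> and
  \<open>\<phi> (X (tan (\<phi> V)))\<close>: since \<sigma> is normal, the tangential parts do not
  contribute.\<close>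

locale simons_algebra =
  fixes h :: "'m::euclidean_space \<Rightarrow> 'm \<Rightarrow> real" and B :: "'m set"
    and G :: "'q::euclidean_space \<Rightarrow> 'q \<Rightarrow> real" and X :: "'m \<Rightarrow> 'q" and \<phi> :: "'q \<Rightarrow> 'q" and \<xi> V :: 'q
    and tan :: "'q \<Rightarrow> 'm" and \<sigma> :: "'m \<Rightarrow> 'm \<Rightarrow> 'q" and A An :: "'m \<Rightarrow> 'm" and Anv Ant :: "'m \<Rightarrow> 'm"
    and R :: "'q \<Rightarrow> 'q \<Rightarrow> 'q \<Rightarrow> 'q \<Rightarrow> real" and c :: real
  assumes h: "inner_form h" and B: "orthonormal_basis h B" and G: "inner_form G"
    and X: "linear X" "\<And>a b. G (X a) (X b) = h a b"
    and phi: "linear \<phi>" "\<And>u v. G (\<phi> u) v = - G u (\<phi> v)"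
    and tan: "\<And>w a. h (tan w) a = G w (X a)"
    and sigma: "bilinear \<sigma>" "\<And>a b. \<sigma> a b = \<sigma> b a" "\<And>a b e. G (\<sigma> a b) (X e) = 0"
    and V: "\<And>a. G V (X a) = 0"
    and A: "\<And>a b. h (A a) b = G V (\<sigma> a b)"
    and An: "\<And>a b. h (An a) b = G \<xi> (\<sigma> a b)"
    and Anv: "\<And>a b. h (Anv a) b = G (\<phi> V) (\<sigma> a b)"
    and Ant: "\<And>a b. h (Ant a) b = G (\<phi> (X (tan (\<phi> V)))) (\<sigma> a b)"
    and R: "\<And>u v w y. R u v w y = space_form_tensor c G \<phi> \<xi> u v w y"
begin

abbreviation "t a \<equiv> tan (\<phi> (X a))"
abbreviation "T \<equiv> tan \<xi>"
abbreviation "tv \<equiv> tan (\<phi> V)"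
abbreviation "s a b \<equiv> tan (\<phi> (\<sigma> a b))"
abbreviation "\<theta> \<equiv> G V \<xi>"

lemmas h_bil = inner_form_bilinear[OF h] and G_bil = inner_form_bilinear[OF G]
lemmas h_simps = bilinear_simps[OF h_bil] and G_simps = bilinear_simps[OF G_bil]
  and s_simps = bilinear_simps[OF sigma(1)]
lemmas h_ext = inner_form_ext[OF h] and h_sym = inner_form_sym[OF h] and G_sym = inner_form_sym[OF G]

lemma linear_tan: "linear tan"
  by (rule linearI; rule h_ext) (simp_all add: tan h_simps G_simps)

lemma linear_t: "linear (\<lambda>a. t a)"
  using linear_compose[OF linear_compose[OF X(1) phi(1)] linear_tan] by (simp add: o_def)

lemma bilinear_s: "bilinear (\<lambda>a b. s a b)"
  by (rule bilinearI') (simp_all add: s_simps linear_add[OF phi(1)] linear_scale[OF phi(1)]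
      linear_add[OF linear_tan] linear_scale[OF linear_tan])

lemma s_sym: "s a b = s b a" using sigma(2) by metis

lemma linear_form_op: "linear P" if "\<And>a b. h (P a) b = G w (\<sigma> a b)"
  by (rule linearI; rule h_ext) (simp_all add: that h_simps G_simps s_simps)

lemmas linear_ops = linear_form_op[OF A] linear_form_op[OF An] linear_form_op[OF Anv] linear_form_op[OF Ant] linear_t

lemmas op_simps = linear_ops[THEN linear_add] linear_ops[THEN linear_scale]

text \<open>As rewrite rules these move all operators to the first argument. This normal form makes the sums
  over the frame comparable.\<close>

lemma move: "h a (A b) = h (A a) b" "h a (An b) = h (An a) b" "h a (Anv b) = h (Anv a) b"
    "h a (Ant b) = h (Ant a) b" "h a (t b) = - h (t a) b" "h a (s b e) = h (s b e) a"
proof -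
  show "h a (A b) = h (A a) b" using A[of b a] A[of a b] sigma(2)[of a b] h_sym[of a] by simp
  show "h a (An b) = h (An a) b" using An[of b a] An[of a b] sigma(2)[of a b] h_sym[of a] by simp
  show "h a (Anv b) = h (Anv a) b" using Anv[of b a] Anv[of a b] sigma(2)[of a b] h_sym[of a] by simp
  show "h a (Ant b) = h (Ant a) b" using Ant[of b a] Ant[of a b] sigma(2)[of a b] h_sym[of a] by simp
  show "h a (t b) = - h (t a) b"
    using tan[of "\<phi> (X b)" a] tan[of "\<phi> (X a)" b] phi(2)[of "X b" "X a"] h_sym[of a] G_sym by simp
  show "h a (s b e) = h (s b e) a" by (rule h_sym)
qed

lemma t_self: "h (t a) a = 0" using move(5)[of a a] h_sym[of a] by simp

text \<open>The scalar products met in the curvature sums, brought into the normal form of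
  \<open>move\<close>. The minus signs come from the skewness of \<phi>.\<close>

lemma vals:
  "G (X a) (\<phi> (X b)) = h (t b) a" "G (\<phi> (X a)) (X b) = h (t a) b" "G (X a) \<xi> = h T a"
  "G (X a) V = 0" "G (X a) (\<phi> V) = h tv a" "G (\<phi> V) (X a) = h tv a"
  "G (\<sigma> a b) V = h (A a) b" "G (X e) (\<sigma> a b) = 0" "G (\<sigma> a b) \<xi> = h (An a) b"
  "G (\<sigma> a b) (\<phi> V) = h (Anv a) b" "G (\<phi> V) (\<sigma> a b) = h (Anv a) b"
  "G (\<phi> (\<sigma> a b)) (X e) = h (s a b) e" "G (X e) (\<phi> (\<sigma> a b)) = h (s a b) e"
  "G (\<sigma> a b) (\<phi> (X e)) = - h (s a b) e" "G (\<phi> (X e)) (\<sigma> a b) = - h (s a b) e"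
proof -
  show "G (X a) (\<phi> (X b)) = h (t b) a" "G (X a) \<xi> = h T a" "G (X a) (\<phi> V) = h tv a"
    "G (X e) (\<phi> (\<sigma> a b)) = h (s a b) e" "G (\<phi> (X a)) (X b) = h (t a) b" "G (\<phi> V) (X a) = h tv a"
    "G (\<phi> (\<sigma> a b)) (X e) = h (s a b) e"
    unfolding tan by (rule G_sym refl)+
  show "G (X a) V = 0" using V[of a] G_sym[of V] by simp
  show "G (X e) (\<sigma> a b) = 0" using sigma(3)[of a b e] G_sym[of "X e"] by simp
  show "G (\<sigma> a b) V = h (A a) b" "G (\<sigma> a b) \<xi> = h (An a) b" "G (\<sigma> a b) (\<phi> V) = h (Anv a) b"
    "G (\<phi> V) (\<sigma> a b) = h (Anv a) b"
    unfolding A An Anv by (rule G_sym refl)+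
  show *: "G (\<sigma> a b) (\<phi> (X e)) = - h (s a b) e"
    using phi(2)[of "\<sigma> a b" "X e"] by (simp add: tan)
  show "G (\<phi> (X e)) (\<sigma> a b) = - h (s a b) e"
    using * G_sym[of "\<phi> (X e)"] by simp
qed

section \<open>Traces of products of the operators over the frame\<close>

lemma par: "(\<Sum>j\<in>B. h a j * h b j) = h a b"
  using orthonormal_parseval[OF h B, of a b] by simp

lemma contract: "linear L \<Longrightarrow> (\<Sum>j\<in>B. h a j * L j) = (L a :: real)"
  using orthonormal_linear_expansion[OF h B, of L a] by simp

text \<open>Moves an operator with adjoint \<open>e P\<close> to the other slot:
  \<open>e = 1\<close> for \<open>A\<close> and \<open>e = -1\<close> for \<open>t\<close>.
  Expanding in the frame turns both sides into the same double sum.\<close>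

lemma trace_transfer:
  assumes P: "\<And>a b. h a (P b) = e * h (P a) b" and \<beta>: "bilinear \<beta>"
  shows "(\<Sum>j\<in>B. \<beta> (P j) j) = e * (\<Sum>j\<in>B. \<beta> j (P j) :: real)"
proof -
  have "(\<Sum>j\<in>B. \<beta> (P j) j) = (\<Sum>j\<in>B. \<Sum>k\<in>B. h (P j) k * \<beta> k j)"
    by (simp add: contract[OF bilinear_linear_left[OF \<beta>]])
  also have "\<dots> = (\<Sum>j\<in>B. \<Sum>k\<in>B. e * (h (P k) j * \<beta> k j))"
  proof (intro sum.cong refl)
    fix j k
    have "h (P j) k = e * h (P k) j" using P[of k j] h_sym[of k] by simp
    then show "h (P j) k * \<beta> k j = e * (h (P k) j * \<beta> k j)" by simp
  qed
  also have "\<dots> = e * (\<Sum>k\<in>B. \<Sum>j\<in>B. h (P k) j * \<beta> k j)"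
    by (subst sum.swap) (simp add: sum_distrib_left)
  also have "\<dots> = e * (\<Sum>k\<in>B. \<beta> k (P k))"
    by (simp add: contract[OF bilinear_linear_right[OF \<beta>]])
  finally show ?thesis .
qed

lemma trace_A: "bilinear \<beta> \<Longrightarrow> (\<Sum>j\<in>B. \<beta> (A j) j) = (\<Sum>j\<in>B. \<beta> j (A j) :: real)"
  using trace_transfer[of A 1 \<beta>] move(1) by simp

lemma trace_t: "bilinear \<beta> \<Longrightarrow> (\<Sum>j\<in>B. \<beta> (t j) j) = - (\<Sum>j\<in>B. \<beta> j (t j) :: real)"
  using trace_transfer[of "\<lambda>a. t a" "-1" \<beta>] move(5) by simp

lemma bilinear_h: "linear F \<Longrightarrow> linear F' \<Longrightarrow> bilinear (\<lambda>a b. h (F a) (F' b))"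
  by (rule bilinearI') (simp_all add: linear_add linear_scale h_simps)

definition "m = real (card B)"

lemma sum_h_self: "(\<Sum>i\<in>B. h i i) = m"
  using B by (simp add: orthonormal_basis_def m_def)

text \<open>In the notation of the theorem: \<open>n2\<close> is |A_V|^2, \<open>a1\<close> is trace
  A_V, \<open>s1\<close> is |tA_V|^2, \<open>s2\<close> is trace(A_V(t(A_V t))), \<open>s3\<close>
  is trace(A_V(tA_nV)). \<open>s4\<close> and \<open>s5\<close> are the two traces with \<sigma> and
  tV. \<open>s6\<close> is trace(A_V A_N), \<open>s7\<close> is trace(A_V A_n(tV)),
  \<open>s8\<close> is m<A_V(tH),tV> and \<open>s9\<close> is m<H,N>.\<close>

definition "n2 = (\<Sum>i\<in>B. h (A i) (A i))"
definition "a1 = (\<Sum>i\<in>B. h (A i) i)"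
definition "s1 = (\<Sum>i\<in>B. h (t (A i)) (t (A i)))"
definition "s2 = (\<Sum>i\<in>B. h (A (t (A (t i)))) i)"
definition "s3 = (\<Sum>i\<in>B. h (A (t (Anv i))) i)"
definition "s4 = (\<Sum>i\<in>B. h (s (A i) tv) i)"
definition "s5 = (\<Sum>i\<in>B. h (s (A tv) i) i)"
definition "s6 = (\<Sum>i\<in>B. h (A (An i)) i)"
definition "s7 = (\<Sum>i\<in>B. h (A (Ant i)) i)"
definition "s8 = (\<Sum>i\<in>B. h (A (s i i)) tv)"
definition "s9 = (\<Sum>i\<in>B. h (An i) i)"
abbreviation "ATT \<equiv> h (A T) T"
abbreviation "AAT \<equiv> h (A T) (A T)"
abbreviation "TT \<equiv> h T T"

lemma lin_comp: "linear F \<Longrightarrow> linear (\<lambda>a. A (F a))" "linear F \<Longrightarrow> linear (\<lambda>a. t (F a))" "linear F \<Longrightarrow> linear (\<lambda>a. Anv (F a))"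
  using linear_compose[of F A] linear_compose[of F "\<lambda>a. t a"] linear_compose[of F Anv] linear_ops by (auto simp: o_def)

text \<open>\<open>A\<close>, \<open>An\<close> and \<open>Anv\<close> are self-adjoint and
  \<open>t\<close> is skew, so transposing a product gives one sign for each factor
  \<open>t\<close>. Together with cyclicity this reduces all products that occur to a few; the trace
  of \<open>t A\<close> equals its own negative.\<close>

lemma sums:
  "(\<Sum>i\<in>B. h (A (A i)) i) = n2"
  "(\<Sum>i\<in>B. h (t (A i)) i) = 0" "(\<Sum>i\<in>B. h (A (t i)) i) = 0"
  "(\<Sum>i\<in>B. h (t (A (t (A i)))) i) = s2"
  "(\<Sum>i\<in>B. h (t (A (A (t i)))) i) = - s1" "(\<Sum>i\<in>B. h (A (t (t (A i)))) i) = - s1"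
  "(\<Sum>i\<in>B. h (t (A (Anv i))) i) = - s3" "(\<Sum>i\<in>B. h (A (Anv (t i))) i) = - s3"
  "(\<Sum>i\<in>B. h (Anv (t (A i))) i) = - s3" "(\<Sum>i\<in>B. h (Anv (A (t i))) i) = s3"
  "(\<Sum>i\<in>B. h (t (Anv (A i))) i) = s3" "(\<Sum>i\<in>B. h (A (t (Anv i))) i) = s3"
  "(\<Sum>i\<in>B. h (An (A i)) i) = s6" "(\<Sum>i\<in>B. h (A (An i)) i) = s6"
proof -
  note l = linear_id[unfolded id_def] lin_comp bilinear_h
  \<comment> \<open>The equations of \<open>move\<close> read backwards, with which a product is
    transposed factor by factor before \<open>h_sym\<close> restores the normal form.\<close>
  have rm: "h (A a) b = h a (A b)" "h (An a) b = h a (An b)" "h (Anv a) b = h a (Anv b)"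
    "h (t a) b = - h a (t b)" for a b by (simp_all add: move)
  show "(\<Sum>i\<in>B. h (A (A i)) i) = n2" by (simp add: n2_def move)
  show 1: "(\<Sum>i\<in>B. h (t (A i)) i) = 0"
  proof -
    have "(\<Sum>i\<in>B. h (t (A i)) i) = (\<Sum>i\<in>B. h (t i) (A i))"
      by (rule trace_A[of "\<lambda>a b. h (t a) b"]) (intro l linear_ops)
    also have "\<dots> = - (\<Sum>i\<in>B. h (t (A i)) i)" unfolding sum_negf[symmetric]
      by (intro sum.cong refl) (metis move(5) h_sym)
    finally show ?thesis by simp
  qed
  have "h (A (t i)) i = - h (t (A i)) i" for i by (rule trans[OF _ arg_cong[OF h_sym, of uminus]]) (simp add: rm)
  then show "(\<Sum>i\<in>B. h (A (t i)) i) = 0" using 1 by (simp add: sum_negf)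
  have "h (t (A (t (A i)))) i = h (A (t (A (t i)))) i" for i by (rule trans[OF _ h_sym]) (simp add: rm)
  then show "(\<Sum>i\<in>B. h (t (A (t (A i)))) i) = s2" by (simp add: s2_def)
  have "h (t (A (A (t i)))) i = - h (A (t i)) (A (t i))" for i by (simp add: move)
  moreover have "(\<Sum>i\<in>B. h (A (t i)) (A (t i))) = s1"
  proof -
    have "(\<Sum>i\<in>B. h (A (t i)) (A (t i))) = - (\<Sum>i\<in>B. h (A i) (A (t (t i))))"
      by (rule trace_t[of "\<lambda>a b. h (A a) (A (t b))"]) (intro l linear_ops)
    also have "\<dots> = - (\<Sum>i\<in>B. h (A (A (t (t i)))) i)"
      by (intro arg_cong[of _ _ uminus] sum.cong refl) (metis move(1) h_sym)
    also have "(\<Sum>i\<in>B. h (A (A (t (t i)))) i) = (\<Sum>i\<in>B. h (A (t (t (A i)))) i)"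
    proof -
      have "(\<Sum>i\<in>B. h (A (t (t (A i)))) i) = (\<Sum>i\<in>B. h (A (t (t i))) (A i))"
        by (rule trace_A[of "\<lambda>a b. h (A (t (t a))) b"]) (intro l linear_ops)
      then show ?thesis by (simp add: move)
    qed
    also have "- \<dots> = s1" by (simp add: s1_def move sum_negf)
    finally show ?thesis .
  qed
  ultimately show "(\<Sum>i\<in>B. h (t (A (A (t i)))) i) = - s1" by (simp add: sum_negf)
  show "(\<Sum>i\<in>B. h (A (t (t (A i)))) i) = - s1" by (simp add: s1_def move sum_negf)
  show s3: "(\<Sum>i\<in>B. h (A (t (Anv i))) i) = s3" by (simp add: s3_def)
  have c1: "h (Anv (t (A i))) i = - h (A (t (Anv i))) i" for i by (rule trans[OF _ arg_cong[OF h_sym, of uminus]]) (simp add: rm)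
  show s3a: "(\<Sum>i\<in>B. h (Anv (t (A i))) i) = - s3" unfolding c1 sum_negf s3 ..
  have "(\<Sum>i\<in>B. h (Anv (t (A i))) i) = (\<Sum>i\<in>B. h (Anv (t i)) (A i))"
    by (rule trace_A[of "\<lambda>a b. h (Anv (t a)) b"]) (intro l linear_ops)
  then show s3b: "(\<Sum>i\<in>B. h (A (Anv (t i))) i) = - s3" using s3a by (simp add: move)
  have "h (t (Anv (A i))) i = - h (A (Anv (t i))) i" for i by (rule trans[OF _ arg_cong[OF h_sym, of uminus]]) (simp add: rm)
  then show "(\<Sum>i\<in>B. h (t (Anv (A i))) i) = s3" using s3b by (simp add: sum_negf)
  have "(\<Sum>i\<in>B. h (A (Anv (t i))) i) = - (\<Sum>i\<in>B. h (A (Anv i)) (t i))"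
    by (rule trace_t[of "\<lambda>a b. h (A (Anv a)) b"]) (intro l linear_ops)
  then show s3c: "(\<Sum>i\<in>B. h (t (A (Anv i))) i) = - s3" using s3b by (simp add: move sum_negf)
  have "h (Anv (A (t i))) i = - h (t (A (Anv i))) i" for i by (rule trans[OF _ arg_cong[OF h_sym, of uminus]]) (simp add: rm)
  then show "(\<Sum>i\<in>B. h (Anv (A (t i))) i) = s3" using s3c by (simp add: sum_negf)
  show "(\<Sum>i\<in>B. h (A (An i)) i) = s6" by (simp add: s6_def)
  have "h (An (A i)) i = h (A (An i)) i" for i by (rule trans[OF _ h_sym]) (simp add: rm)
  then show "(\<Sum>i\<in>B. h (An (A i)) i) = s6" by (simp add: s6_def)
qed

lemma swap_args: "h (A a) b = h (A b) a" "h (t a) b = - h (t b) a" "h (An a) b = h (An b) a"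
    "h (Anv a) b = h (Anv b) a"
  using move(1)[of a b] move(5)[of a b] move(2)[of a b] move(3)[of a b] h_sym[of a] by simp_all

lemmas pull = sum.distrib sum_subtractf sum_negf sum_distrib_left[symmetric] sum_distrib_right[symmetric]

lemma s_contract:
  "(\<Sum>i\<in>B. h a i * h (s i b) e) = h (s a b) e" "(\<Sum>i\<in>B. h a i * h (s b i) e) = h (s b a) e"
  by (rule contract[of "\<lambda>i. h (s i b) e"] contract[of "\<lambda>i. h (s b i) e"],
      rule linearI; simp add: bilinear_simps[OF bilinear_s] h_simps)+

lemma s_contract':
  "(\<Sum>i\<in>B. h a i * h (s b (A i)) e) = h (s b (A a)) e" "(\<Sum>i\<in>B. h a i * h (A (s b i)) e) = h (A (s b a)) e"
  "(\<Sum>i\<in>B. h a i * (\<Sum>j\<in>B. h (s i (A j)) j)) = (\<Sum>j\<in>B. h (s a (A j)) j)"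
  "(\<Sum>i\<in>B. h a i * (\<Sum>j\<in>B. h (A (s i j)) j)) = (\<Sum>j\<in>B. h (A (s a j)) j)"
  "(\<Sum>i\<in>B. h a i * (\<Sum>j\<in>B. h (s i j) j)) = (\<Sum>j\<in>B. h (s a j) j)"
  by (rule contract[of "\<lambda>i. h (s b (A i)) e"] contract[of "\<lambda>i. h (A (s b i)) e"]
      contract[of "\<lambda>i. \<Sum>j\<in>B. h (s i (A j)) j"] contract[of "\<lambda>i. \<Sum>j\<in>B. h (A (s i j)) j"]
      contract[of "\<lambda>i. \<Sum>j\<in>B. h (s i j) j"],
      rule linearI; simp add: bilinear_simps[OF bilinear_s] h_simps op_simps sum.distrib sum_distrib_left)+

text \<open>The last equation is the origin of A_n(tV): skewness moves \<phi> from the value of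
  \<sigma> to \<open>X tv\<close>, and testing the result against \<sigma> gives
  \<open>Ant\<close>.\<close>

lemma s_sums:
  "(\<Sum>j\<in>B. h (A (s tv j)) j) = s4" "(\<Sum>j\<in>B. h (A (s j tv)) j) = s4" "(\<Sum>j\<in>B. h (s tv (A j)) j) = s4"
  "(\<Sum>i\<in>B. h (s i (A tv)) i) = s5" "(\<Sum>i\<in>B. h (s (A tv) i) i) = s5"
  "(\<Sum>j\<in>B. h (s j (A j)) tv) = - s7"
proof -
  have "s4 = (\<Sum>j\<in>B. h (s j tv) (A j))"
    unfolding s4_def by (rule trace_A[of "\<lambda>a b. h (s a tv) b"], rule bilinearI')
      (simp_all add: bilinear_simps[OF bilinear_s] h_simps)
  then show "(\<Sum>j\<in>B. h (A (s j tv)) j) = s4" by (simp add: move)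
  then show "(\<Sum>j\<in>B. h (A (s tv j)) j) = s4" using s_sym by simp
  show "(\<Sum>j\<in>B. h (s tv (A j)) j) = s4" by (simp add: s4_def s_sym[of tv])
  show "(\<Sum>i\<in>B. h (s (A tv) i) i) = s5" by (simp add: s5_def)
  then show "(\<Sum>i\<in>B. h (s i (A tv)) i) = s5" by (simp add: s_sym[of _ "A tv"])
  have "h (A (Ant j)) j = - h (s j (A j)) tv" for j
  proof -
    have "h (A (Ant j)) j = h (Ant j) (A j)" using move(1)[of "Ant j" j] by simp
    also have "\<dots> = G (\<phi> (X tv)) (\<sigma> j (A j))" by (rule Ant)
    also have "\<dots> = - h (s j (A j)) tv" by (rule vals(15))
    finally show ?thesis .
  qed
  then show "(\<Sum>j\<in>B. h (s j (A j)) tv) = - s7" by (simp add: s7_def sum_negf)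
qed

lemmas sum_defs = s2_def[symmetric] a1_def[symmetric] s8_def[symmetric] s9_def[symmetric]

text \<open>In the nine sums below the terms of \<open>R\<close> are written such that the index of the inner sum, wherever
  possible, is the last argument of two factors; then \<open>par\<close> contracts it.\<close>

lemma curvature_sum:
  assumes "\<And>i j. F i j = c / 4 * P i j" "(\<Sum>i\<in>B. \<Sum>j\<in>B. P i j) = r"
  shows "(\<Sum>i\<in>B. \<Sum>j\<in>B. F i j) = c / 4 * r"
  unfolding assms(2)[symmetric] by (simp only: assms(1) sum_distrib_left)

lemma sum_R_tangent1:
  "(\<Sum>i\<in>B. \<Sum>j\<in>B. R (X i) (X j) (X (A i)) (X (A j))) = c / 4 * (n2 - a1\<^sup>2 + 3 * s2 + 2 * a1 * ATT - 2 * AAT)"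
proof (rule curvature_sum)
  show "R (X i) (X j) (X (A i)) (X (A j)) = c / 4 * (h (A i) j * h (A i) j - h (A i) i * h (A j) j + h (t (A i)) i * h (A (t j)) j
     - h (t (A i)) j * h (A (t i)) j + 2 * (- (h (t i) j * h (A (t (A i))) j))
     + (h T i * h (A T) i) * h (A j) j - h (A T) i * (h T j * h (A i) j)
     + h (A i) i * (h T j * h (A T) j) - h T i * (h (A T) j * h (A i) j))" for i j
    unfolding R space_form_tensor_def X(2) vals sigma(3) move by (simp add: swap_args[of j i] h_sym[of j i] t_self)
qed (simp add: pull par move sums s_contract s_contract' s_sums sum_defs sum_h_self;
    (simp add: power2_eq_square algebra_simps)?)

lemma sum_R_tangent2:
  "(\<Sum>i\<in>B. \<Sum>j\<in>B. R (X i) (X j) (X i) (X (A (A j)))) = c / 4 * (n2 - m * n2 - 3 * s1 + TT * n2 + m * AAT - 2 * AAT)"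
proof (rule curvature_sum)
  show "R (X i) (X j) (X i) (X (A (A j))) = c / 4 * (h i j * h (A (A i)) j - h i i * h (A (A j)) j - h (t i) j * h (A (A (t i))) j
     - 2 * (h (t i) j * h (A (A (t i))) j) + (h T i * h T i) * h (A (A j)) j - h T i * (h T j * h (A (A i)) j)
     + h i i * (h T j * h (A (A T)) j) - h T i * (h (A (A T)) j * h i j))" for i j
    unfolding R space_form_tensor_def X(2) vals sigma(3) move by (simp add: swap_args[of j i] h_sym[of j i] t_self)
qed (simp add: pull par move sums s_contract s_contract' s_sums sum_defs sum_h_self;
    (simp add: power2_eq_square algebra_simps)?)

text \<open>\<open>A\<close> acts only on the index \<open>j\<close> here, so the sums are exchanged
  to make the bare index \<open>i\<close> the inner one.\<close>

lemma sum_R_tangent3: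
  "(\<Sum>i\<in>B. \<Sum>j\<in>B. R (X i) (X (A j)) (X (A j)) (X i)) = c / 4 * (m * n2 - n2 + 3 * s1 - TT * n2 - m * AAT + 2 * AAT)"
proof (subst sum.swap, rule curvature_sum)
  show "R (X i) (X (A j)) (X (A j)) (X i) = c / 4 * (h (A (A j)) j * h i i - h (A j) i * h (A j) i + h (t (A j)) i * h (t (A j)) i
     + 2 * (h (t (A j)) i * h (t (A j)) i) + 2 * (h (A T) j * (h T i * h (A j) i)) - (h (A T) j * h (A T) j) * h i i
     - h (A (A j)) j * (h T i * h T i))" for j i
    unfolding R space_form_tensor_def X(2) vals sigma(3) move by (simp add: swap_args[of j i] h_sym[of j i] t_self)
qed (simp add: pull par move sums s_contract s_contract' s_sums sum_defs sum_h_self;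
    (simp add: power2_eq_square algebra_simps)?)

text \<open>The arguments \<open>\<sigma> i i\<close> add up to \<open>m H\<close>, so that of the
  nine sums this one contributes \<open>s8\<close> and \<open>s9\<close>.\<close>

lemma sum_R_normal1:
  "(\<Sum>i\<in>B. \<Sum>j\<in>B. R (\<sigma> i i) (X j) V (X (A j))) = c / 4 * (- a1\<^sup>2 - 3 * s8 + \<theta> * s9 * a1 + a1 * ATT)"
proof (rule curvature_sum)
  show "R (\<sigma> i i) (X j) V (X (A j)) = c / 4 * (- (h (A i) i * h (A j) j) + h (Anv i) i * h (A (t j)) j - h tv j * h (A (s i i)) j
     - 2 * (h (s i i) j * h (A tv) j) + \<theta> * (h (An i) i * h (A j) j) + h (A i) i * (h T j * h (A T) j))" for i j
    unfolding R space_form_tensor_def X(2) vals sigma(3) move by (simp add: swap_args[of j i] h_sym[of j i] t_self)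
qed (simp add: pull par move sums s_contract s_contract' s_sums sum_defs sum_h_self;
    (simp add: power2_eq_square algebra_simps)?)

lemma sum_R_normal3:
  "(\<Sum>i\<in>B. \<Sum>j\<in>B. R (X i) (X j) V (\<sigma> i (A j))) = c / 4 * (- s4 + s5 - 2 * s3)"
proof (rule curvature_sum)
  show "R (X i) (X j) V (\<sigma> i (A j)) = c / 4 * (- (h tv i * h (s i (A j)) j) + h tv j * h (s i (A j)) i - 2 * (h (t i) j * h (A (Anv i)) j))" for i j
    unfolding R space_form_tensor_def X(2) vals sigma(3) move by (simp add: swap_args[of j i] h_sym[of j i] t_self)
qed (simp add: pull par move sums s_contract s_contract' s_sums sum_defs sum_h_self;
    (simp add: power2_eq_square algebra_simps)?)

lemma sum_R_normal2:
  "(\<Sum>i\<in>B. \<Sum>j\<in>B. R (X i) (\<sigma> i j) V (X (A j))) = c / 4 * (n2 + s4 - s3 + 2 * s5 - \<theta> * s6 - AAT)"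
proof (rule curvature_sum)
  show "R (X i) (\<sigma> i j) V (X (A j)) = c / 4 * (h (A i) j * h (A i) j + h tv i * h (A (s i j)) j - h (Anv i) j * h (A (t i)) j
     + 2 * (h (A tv) j * h (s i j) i) - \<theta> * (h (An i) j * h (A i) j) - h T i * (h (A T) j * h (A i) j))" for i j
    unfolding R space_form_tensor_def X(2) vals sigma(3) move by (simp add: swap_args[of j i] h_sym[of j i] t_self)
qed (simp add: pull par move sums s_contract s_contract' s_sums sum_defs sum_h_self;
    (simp add: power2_eq_square algebra_simps)?)

lemma sum_R_normal4:
  "(\<Sum>i\<in>B. \<Sum>j\<in>B. R (\<sigma> j i) (X (A j)) V (X i)) = c / 4 * (- n2 - s3 - s5 - 2 * s4 + \<theta> * s6 + AAT)"
proof (subst sum.swap, rule curvature_sum)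
  show "R (\<sigma> j i) (X (A j)) V (X i) = c / 4 * (- (h (A j) i * h (A j) i) + h (Anv j) i * h (t (A j)) i - h (A tv) j * h (s j i) i
     - 2 * (h tv i * h (A (s j i)) j) + \<theta> * (h (An j) i * h (A j) i) + h (A T) j * (h T i * h (A j) i))" for j i
    unfolding R space_form_tensor_def X(2) vals sigma(3) move by (simp add: swap_args[of j i] h_sym[of j i] t_self)
qed (simp add: pull par move sums s_contract s_contract' s_sums sum_defs sum_h_self;
    (simp add: power2_eq_square algebra_simps)?)

text \<open>The term \<open>s7\<close> enters here, through the contraction of
  \<open>s j (A j)\<close> with \<open>tv\<close>. Repeating \<open>X i\<close> produces the factors
  \<open>m\<close>.\<close>

lemma sum_R_normal5:
  "(\<Sum>i\<in>B. \<Sum>j\<in>B. R (X i) (\<sigma> j (A j)) V (X i)) = c / 4 * (m * n2 - 3 * s7 - m * \<theta> * s6 - TT * n2)"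
proof (subst sum.swap, rule curvature_sum)
  show "R (X i) (\<sigma> j (A j)) V (X i) = c / 4 * (h (A (A j)) j * h i i + h tv i * h (s j (A j)) i + 2 * (h (s j (A j)) i * h tv i)
     - \<theta> * (h (A (An j)) j * h i i) - h (A (A j)) j * (h T i * h T i))" for j i
    unfolding R space_form_tensor_def X(2) vals sigma(3) move by (simp add: swap_args[of j i] h_sym[of j i] t_self)
qed (simp add: pull par move sums s_contract s_contract' s_sums sum_defs sum_h_self;
    (simp add: power2_eq_square algebra_simps)?)

lemma sum_R_normal6:
  "(\<Sum>i\<in>B. \<Sum>j\<in>B. R (X i) (X (A j)) V (\<sigma> j i)) = c / 4 * (- s4 + s5 - 2 * s3)"
proof (subst sum.swap, rule curvature_sum)
  show "R (X i) (X (A j)) V (\<sigma> j i) = c / 4 * (- (h tv i * h (A (s j i)) j) + h (A tv) j * h (s j i) i + 2 * (h (t (A j)) i * h (Anv j) i))" for j i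
    unfolding R space_form_tensor_def X(2) vals sigma(3) move by (simp add: swap_args[of j i] h_sym[of j i] t_self)
qed (simp add: pull par move sums s_contract s_contract' s_sums sum_defs sum_h_self;
    (simp add: power2_eq_square algebra_simps)?)

text \<open>\<open>dR\<close> and \<open>RG\<close> are \<open>dcod\<close> and
  \<open>gauss_Riem\<close> at a fixed point, written with the abstract data of this locale.\<close>

definition dR :: "'m \<Rightarrow> 'm \<Rightarrow> 'm \<Rightarrow> 'm \<Rightarrow> real"
  where "dR x a b e = R (X a) (X b) (X (A x)) (X e) - R (\<sigma> x a) (X b) V (X e)
    - R (X a) (\<sigma> x b) V (X e) - R (X a) (X b) V (\<sigma> x e)"

definition RG :: "'m \<Rightarrow> 'm \<Rightarrow> 'm \<Rightarrow> 'm \<Rightarrow> real"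
  where "RG a b e d = R (X a) (X b) (X e) (X d) + G (\<sigma> b e) (\<sigma> a d) - G (\<sigma> a e) (\<sigma> b d)"

text \<open>The first sum occurs twice, once from the Ricci identity and once from the
  differentiated Codazzi equation. The second and third are opposite to each other, so together they
  count twice; half of their terms \<open>m * n2\<close> and \<open>TT * n2\<close> is taken back by
  \<open>sum_R_normal5\<close>. All \<open>n2\<close> and \<open>AAT\<close> without the factor
  \<open>m\<close> cancel, apart from the \<open>TT * n2\<close> that remains.\<close>

lemma simons_sum:
  "(\<Sum>i\<in>B. \<Sum>j\<in>B. RG i j (A i) (A j) - RG i j i (A (A j)) + dR i i j (A j) + dR j i (A j) i)
   = c / 4 * (m * n2 - 2 * m * AAT + 6 * s1 - TT * n2 + 3 * a1 * ATT + 6 * s3 + 3 * s7 - a1\<^sup>2 + 6 * s2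
       + 3 * s4 - 3 * s5 + \<theta> * (m * s6 - a1 * s9) + 3 * s8)
     + (\<Sum>i\<in>B. \<Sum>j\<in>B. G (\<sigma> j (A i)) (\<sigma> i (A j)) - G (\<sigma> i (A i)) (\<sigma> j (A j))
         - G (\<sigma> j i) (\<sigma> i (A (A j))) + G (\<sigma> i i) (\<sigma> j (A (A j))))" (is "_ = _ + ?S")
proof -
  have "(\<Sum>i\<in>B. \<Sum>j\<in>B. RG i j (A i) (A j) - RG i j i (A (A j)) + dR i i j (A j) + dR j i (A j) i)
    = 2 * (\<Sum>i\<in>B. \<Sum>j\<in>B. R (X i) (X j) (X (A i)) (X (A j)))
      - (\<Sum>i\<in>B. \<Sum>j\<in>B. R (X i) (X j) (X i) (X (A (A j))))
      + (\<Sum>i\<in>B. \<Sum>j\<in>B. R (X i) (X (A j)) (X (A j)) (X i))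
      - (\<Sum>i\<in>B. \<Sum>j\<in>B. R (\<sigma> i i) (X j) V (X (A j)))
      - (\<Sum>i\<in>B. \<Sum>j\<in>B. R (X i) (\<sigma> i j) V (X (A j)))
      - (\<Sum>i\<in>B. \<Sum>j\<in>B. R (X i) (X j) V (\<sigma> i (A j)))
      - (\<Sum>i\<in>B. \<Sum>j\<in>B. R (\<sigma> j i) (X (A j)) V (X i))
      - (\<Sum>i\<in>B. \<Sum>j\<in>B. R (X i) (\<sigma> j (A j)) V (X i))
      - (\<Sum>i\<in>B. \<Sum>j\<in>B. R (X i) (X (A j)) V (\<sigma> j i)) + ?S"
    unfolding RG_def dR_def by (simp add: sum.distrib sum_subtractf sum_negf sum_distrib_left[symmetric])
  then show ?thesis
    unfolding sum_R_tangent1 sum_R_tangent2 sum_R_tangent3 sum_R_normal1 sum_R_normal2 sum_R_normal3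
      sum_R_normal4 sum_R_normal5 sum_R_normal6
    by (simp add: algebra_simps)
qed

text \<open>Each product of two values of \<sigma> is expanded in the normal frame. With P the shape
  operator of one frame vector, the four terms become, in this order, the traces tr(APAP), -(tr
  AP)^2, -tr(AAPP) and tr P tr(AAP).\<close>

lemma normal_sum:
  fixes I :: "'i set" and \<nu> :: "'i \<Rightarrow> 'q" and A' :: "'i \<Rightarrow> 'm \<Rightarrow> 'm"
  assumes frame: "\<And>a b e d. G (\<sigma> a b) (\<sigma> e d) = (\<Sum>\<alpha>\<in>I. G (\<nu> \<alpha>) (\<sigma> a b) * G (\<nu> \<alpha>) (\<sigma> e d))"
    and A': "\<And>\<alpha> a b. \<alpha> \<in> I \<Longrightarrow> h (A' \<alpha> a) b = G (\<nu> \<alpha>) (\<sigma> a b)"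
  shows "(\<Sum>i\<in>B. \<Sum>j\<in>B. G (\<sigma> j (A i)) (\<sigma> i (A j)) - G (\<sigma> i (A i)) (\<sigma> j (A j))
         - G (\<sigma> j i) (\<sigma> i (A (A j))) + G (\<sigma> i i) (\<sigma> j (A (A j))))
    = (\<Sum>\<alpha>\<in>I. (\<Sum>i\<in>B. h (A (A' \<alpha> (A (A' \<alpha> i))) - A (A (A' \<alpha> (A' \<alpha> i)))) i)
        + (\<Sum>i\<in>B. h (A' \<alpha> i) i) * (\<Sum>i\<in>B. h (A (A (A' \<alpha> i))) i) - (\<Sum>i\<in>B. h (A (A' \<alpha> i)) i)\<^sup>2)"
proof -
  have *: "G (\<sigma> a b) (\<sigma> e d) = (\<Sum>\<alpha>\<in>I. h (A' \<alpha> a) b * h (A' \<alpha> e) d)" for a b e d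
    unfolding frame by (intro sum.cong refl) (simp add: A')
  have "(\<Sum>i\<in>B. \<Sum>j\<in>B. G (\<sigma> j (A i)) (\<sigma> i (A j)) - G (\<sigma> i (A i)) (\<sigma> j (A j))
         - G (\<sigma> j i) (\<sigma> i (A (A j))) + G (\<sigma> i i) (\<sigma> j (A (A j))))
    = (\<Sum>i\<in>B. \<Sum>j\<in>B. \<Sum>\<alpha>\<in>I. h (A' \<alpha> j) (A i) * h (A' \<alpha> i) (A j) - h (A' \<alpha> i) (A i) * h (A' \<alpha> j) (A j)
         - h (A' \<alpha> j) i * h (A' \<alpha> i) (A (A j)) + h (A' \<alpha> i) i * h (A' \<alpha> j) (A (A j)))"
    unfolding * by (simp add: sum.distrib sum_subtractf)
  also have "\<dots> = (\<Sum>\<alpha>\<in>I. \<Sum>i\<in>B. \<Sum>j\<in>B. h (A' \<alpha> j) (A i) * h (A' \<alpha> i) (A j) - h (A' \<alpha> i) (A i) * h (A' \<alpha> j) (A j)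
         - h (A' \<alpha> j) i * h (A' \<alpha> i) (A (A j)) + h (A' \<alpha> i) i * h (A' \<alpha> j) (A (A j)))"
    by (subst (2) sum.swap, subst sum.swap) (rule refl)
  also have "\<dots> = (\<Sum>\<alpha>\<in>I. (\<Sum>i\<in>B. h (A (A' \<alpha> (A (A' \<alpha> i))) - A (A (A' \<alpha> (A' \<alpha> i)))) i)
        + (\<Sum>i\<in>B. h (A' \<alpha> i) i) * (\<Sum>i\<in>B. h (A (A (A' \<alpha> i))) i) - (\<Sum>i\<in>B. h (A (A' \<alpha> i)) i)\<^sup>2)"
  proof (rule sum.cong[OF refl])
    fix \<alpha> assume \<alpha>: "\<alpha> \<in> I"
    define P where "P = A' \<alpha>"
    have P: "h (P a) b = G (\<nu> \<alpha>) (\<sigma> a b)" for a b using A'[OF \<alpha>] by (simp add: P_def)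
    have linP: "linear P" by (rule linear_form_op[OF P])
    have mP: "h a (P b) = h (P a) b" for a b using P[of b a] P[of a b] sigma(2)[of a b] h_sym[of a] by simp
    have rm: "h (A a) b = h a (A b)" "h (P a) b = h a (P b)" for a b by (simp_all add: move mP)
    have 1: "h (P j) (A i) * h (P i) (A j) - h (P i) (A i) * h (P j) (A j)
         - h (P j) i * h (P i) (A (A j)) + h (P i) i * h (P j) (A (A j))
       = h (P (A i)) j * h (A (P i)) j - h (A (P i)) i * h (A (P j)) j
         - h (P i) j * h (A (A (P i))) j + h (P i) i * h (A (A (P j))) j" for i j
    proof -
      have "h (P j) (A i) = h (P (A i)) j"
        by (rule trans[OF _ h_sym]) (simp add: rm(2))
      moreover have "h (P j) i = h (P i) j" by (rule trans[OF _ h_sym]) (simp add: rm(2))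
      ultimately show ?thesis by (simp add: move)
    qed
    have 2: "(\<Sum>i\<in>B. h (P i) (A (A (P i)))) = (\<Sum>i\<in>B. h (A (A (P (P i)))) i)"
    proof -
      have "(\<Sum>i\<in>B. h (P i) (A (A (P i)))) = (\<Sum>i\<in>B. h i (A (A (P (P i)))))"
        using trace_transfer[of P 1 "\<lambda>a b. h a (A (A (P b)))"] mP
          bilinear_h[OF linear_id[unfolded id_def] lin_comp(1)[OF lin_comp(1)[OF linP]]] by simp
      then show ?thesis by (simp add: h_sym[of _ "A _"])
    qed
    have 3: "h (P (A i)) (A (P i)) = h (A (P (A (P i)))) i" for i
      by (rule trans[OF _ h_sym]) (simp add: rm)
    show "(\<Sum>i\<in>B. \<Sum>j\<in>B. h (A' \<alpha> j) (A i) * h (A' \<alpha> i) (A j) - h (A' \<alpha> i) (A i) * h (A' \<alpha> j) (A j)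
         - h (A' \<alpha> j) i * h (A' \<alpha> i) (A (A j)) + h (A' \<alpha> i) i * h (A' \<alpha> j) (A (A j)))
       = (\<Sum>i\<in>B. h (A (A' \<alpha> (A (A' \<alpha> i))) - A (A (A' \<alpha> (A' \<alpha> i)))) i)
        + (\<Sum>i\<in>B. h (A' \<alpha> i) i) * (\<Sum>i\<in>B. h (A (A (A' \<alpha> i))) i) - (\<Sum>i\<in>B. h (A (A' \<alpha> i)) i)\<^sup>2"
      unfolding P_def[symmetric] 1
      by (simp add: pull par 2 3 h_simps power2_eq_square)
  qed
  finally show ?thesis .
qed

end

section \<open>Submanifolds of a space with parallel structure tensors\<close>

text \<open>Abstracts from the product what makes its curvature parallel: a parallel skew \<phi>, a
  constant vector \<xi> whose field is parallel, and the curvature expressed by these and the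
  metric.\<close>

locale space_form_immersion = parallel_normal_field \<Omega> G S f V
  for \<Omega> :: "'q::euclidean_space set" and G and S :: "'m::euclidean_space set" and f :: "'m \<Rightarrow> 'q" and V +
  fixes \<phi> :: "'q \<Rightarrow> 'q \<Rightarrow> 'q" and \<xi> :: 'q and c :: real
  assumes smooth_phi: "smooth_endo \<phi>" and parallel_phi: "q \<in> \<Omega> \<Longrightarrow> cov_endo G \<phi> q u v = 0"
    and skew_phi: "q \<in> \<Omega> \<Longrightarrow> G q (\<phi> q u) v = - G q u (\<phi> q v)"
    and parallel_xi: "q \<in> \<Omega> \<Longrightarrow> christoffel G q u \<xi> = 0"
    and Riem_formula: "q \<in> \<Omega> \<Longrightarrow> Riem q u v w y = space_form_tensor c (G q) (\<phi> q) \<xi> u v w y"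
begin

lemma smooth_phi_along: "smooth_on S W \<Longrightarrow> smooth_on S (\<lambda>z. \<phi> (f z) (W z))"
  by (rule smooth_on_linear[OF open_S endo_linear[OF smooth_phi f_in] smooth_compose_f[OF endo_smooth[OF smooth_phi]]])

lemma has_derivative_G:
  assumes z: "z \<in> S" and W: "smooth_on S W" "smooth_on S W'"
  shows "((\<lambda>z. G (f z) (W z) (W' z)) has_derivative
    (\<lambda>u. G (f z) (D W z u) (W' z) + G (f z) (W z) (D W' z u))) (at z)"
proof -
  have "(\<lambda>u. G (f z) (D W z u) (W' z) + G (f z) (W z) (D W' z u))
      = frechet_derivative (\<lambda>z. G (f z) (W z) (W' z)) (at z)"
    by (rule ext, rule D_metric[OF z, symmetric]; rule smooth_on_differentiable[OF _ z]; rule W)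
  then show ?thesis
    using dd_has_derivative[OF smooth_on_differentiable[OF smooth_G_along[OF W] z]] by simp
qed

lemma D_phi: "z \<in> S \<Longrightarrow> smooth_on S W \<Longrightarrow> D (\<lambda>z. \<phi> (f z) (W z)) z u = \<phi> (f z) (D W z u)"
  by (rule D_parallel_endo) (auto intro: endo_linear endo_smooth smooth_phi parallel_phi smooth_on_differentiable)

lemma D_xi: "z \<in> S \<Longrightarrow> D (\<lambda>_. \<xi>) z u = 0"
  by (simp add: cov_along_def frechet_derivative_const parallel_xi f_in)

sublocale parallel_normal_field_symmetric \<Omega> G S f V
proof
  fix z u and W1 W2 W3 W4 :: "'m \<Rightarrow> 'q"
  assume z: "z \<in> S" and W: "smooth_on S W1" "smooth_on S W2" "smooth_on S W3" "smooth_on S W4"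
  let ?G = "G (f z)" and ?\<phi> = "\<phi> (f z)"
  let ?D1 = "\<lambda>u. D W1 z u" and ?D2 = "\<lambda>u. D W2 z u" and ?D3 = "\<lambda>u. D W3 z u" and ?D4 = "\<lambda>u. D W4 z u"
  note p = has_derivative_G[OF z] and phiW = W[THEN smooth_phi_along]
  have g: "((\<lambda>z. G (f z) (W z) (W' z)) has_derivative (\<lambda>u. ?G (D W z u) (W' z) + ?G (W z) (D W' z u))) (at z)"
    "((\<lambda>z. G (f z) (W z) (\<phi> (f z) (W' z))) has_derivative (\<lambda>u. ?G (D W z u) (?\<phi> (W' z)) + ?G (W z) (?\<phi> (D W' z u)))) (at z)"
    "((\<lambda>z. G (f z) (\<phi> (f z) (W z)) (W' z)) has_derivative (\<lambda>u. ?G (?\<phi> (D W z u)) (W' z) + ?G (?\<phi> (W z)) (D W' z u))) (at z)"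
    "((\<lambda>z. G (f z) (W z) \<xi>) has_derivative (\<lambda>u. ?G (D W z u) \<xi>)) (at z)"
    if "smooth_on S W" "smooth_on S W'" for W W'
    using p[OF that] p[OF that(1) smooth_phi_along[OF that(2)]] p[OF smooth_phi_along[OF that(1)] that(2)]
      p[OF that(1) smooth_on_const[of S \<xi>]]
    by (simp_all add: D_phi[OF z] that D_xi[OF z] G_simps[OF f_in[OF z]])
  \<comment> \<open>The order of the rules below matters: the rule \<open>g(1)\<close> for two
    arbitrary fields also fits factors containing \<phi> or \<xi>, so the special rules are tried
    before it.\<close>
  have "((\<lambda>z. space_form_tensor c (G (f z)) (\<phi> (f z)) \<xi> (W1 z) (W2 z) (W3 z) (W4 z)) has_derivative
    (\<lambda>u. Riem (f z) (?D1 u) (W2 z) (W3 z) (W4 z) + Riem (f z) (W1 z) (?D2 u) (W3 z) (W4 z)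
    + Riem (f z) (W1 z) (W2 z) (?D3 u) (W4 z) + Riem (f z) (W1 z) (W2 z) (W3 z) (?D4 u))) (at z)"
    unfolding space_form_tensor_def
    by (rule has_derivative_eq_rhs,
        (rule has_derivative_mult_right has_derivative_add has_derivative_diff has_derivative_mult
          g(4)[OF _ W(1)] g(2) g(3) g(1) W)+)
      (rule ext, simp add: Riem_formula[OF f_in[OF z]] space_form_tensor_def algebra_simps)
  then have "((\<lambda>z. Riem (f z) (W1 z) (W2 z) (W3 z) (W4 z)) has_derivative
    (\<lambda>u. Riem (f z) (?D1 u) (W2 z) (W3 z) (W4 z) + Riem (f z) (W1 z) (?D2 u) (W3 z) (W4 z)
    + Riem (f z) (W1 z) (W2 z) (?D3 u) (W4 z) + Riem (f z) (W1 z) (W2 z) (W3 z) (?D4 u))) (at z)"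
    by (rule has_derivative_transform_within_open[OF _ open_S z]) (simp add: Riem_formula f_in)
  from dd_eqI[OF this] show "dd (\<lambda>z. Riem (f z) (W1 z) (W2 z) (W3 z) (W4 z)) z u =
      Riem (f z) (?D1 u) (W2 z) (W3 z) (W4 z) + Riem (f z) (W1 z) (?D2 u) (W3 z) (W4 z)
    + Riem (f z) (W1 z) (W2 z) (?D3 u) (W4 z) + Riem (f z) (W1 z) (W2 z) (W3 z) (?D4 u)" by simp
qed

abbreviation "tphi z w \<equiv> tan_part G f z (\<phi> (f z) w)"
abbreviation "nphi z w \<equiv> nor_part G f z (\<phi> (f z) w)"
abbreviation "nV z \<equiv> nphi z (V z)"
abbreviation "ntV z \<equiv> nphi z (dd f z (tphi z (V z)))"
abbreviation "N z \<equiv> nor_part G f z \<xi>"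

text \<open>Since \<sigma> is normal, it does not see the tangential part of \<open>W\<close>. The
  projections in N, nV and n(tV) can therefore be dropped, as \<open>simons_algebra\<close>
  requires.\<close>

lemma shape_nor_part:
  assumes z: "z \<in> S" and W: "smooth_on S W"
  shows "h z (shape G f (\<lambda>z. nor_part G f z (W z)) z u) v = G (f z) (W z) (\<sigma> z u v)"
proof -
  have "h z (shape G f (\<lambda>z. nor_part G f z (W z)) z u) v = G (f z) (nor_part G f z (W z)) (\<sigma> z u v)"
    by (rule shape_inner[OF z smooth_on_differentiable[OF smooth_nor_part[OF W] z] normal_nor_part])
  also have "\<dots> = G (f z) (W z) (\<sigma> z u v)"
    using second_ff_normal[OF z, of u v] G_sym[OF f_in[OF z], of "\<sigma> z u v"]
    by (simp add: nor_part_def G_simps[OF f_in[OF z]])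
  finally show ?thesis .
qed

lemma simons_algebra:
  assumes z: "z \<in> S" and B: "orthonormal_basis (h z) B"
  shows "simons_algebra (h z) B (G (f z)) (\<lambda>u. dd f z u) (\<phi> (f z)) \<xi> (V z) (tan_part G f z) (\<sigma> z)
    (A z) (shape G f N z) (shape G f nV z) (shape G f ntV z) (Riem (f z)) c"
proof (rule simons_algebra.intro)
  note sV = smooth_phi_along[OF smooth_V]
  show "inner_form (h z)" by (rule H.inner_form_G[OF z])
  show "inner_form (G (f z))" by (rule inner_form_G[OF f_in[OF z]])
  show "linear (\<phi> (f z))" by (rule endo_linear[OF smooth_phi f_in[OF z]])
  show "h z (shape G f N z a) b = G (f z) \<xi> (\<sigma> z a b)" for a b
    by (rule shape_nor_part[OF z smooth_on_const])
  show "h z (shape G f nV z a) b = G (f z) (\<phi> (f z) (V z)) (\<sigma> z a b)" for a b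
    by (rule shape_nor_part[OF z sV])
  show "h z (shape G f ntV z a) b = G (f z) (\<phi> (f z) (dd f z (tphi z (V z)))) (\<sigma> z a b)" for a b
    by (rule shape_nor_part[OF z smooth_phi_along[OF smooth_df_field[OF smooth_tan_part[OF sV]]]])
  show "Riem (f z) u v w y = space_form_tensor c (G (f z)) (\<phi> (f z)) \<xi> u v w y" for u v w y
    by (rule Riem_formula[OF f_in[OF z]])
  show "orthonormal_basis (h z) B" by (rule B)
  show "linear (\<lambda>u. dd f z u)" by (rule linear_df[OF z])
  show "G (f z) (dd f z a) (dd f z b) = h z a b" for a b by (simp add: induced_metric_def)
  show "G (f z) (\<phi> (f z) u) v = - G (f z) u (\<phi> (f z) v)" for u v by (rule skew_phi[OF f_in[OF z]])
  show "h z (tan_part G f z w) a = G (f z) w (dd f z a)" for w a by (rule tan_part_inner[OF z])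
  show "bilinear (\<sigma> z)" by (rule second_ff_bilinear[OF z])
  show "\<sigma> z a b = \<sigma> z b a" for a b by (rule second_ff_sym[OF z])
  show "G (f z) (\<sigma> z a b) (dd f z e) = 0" for a b e by (rule second_ff_normal[OF z])
  show "G (f z) (V z) (dd f z a) = 0" for a using normal_V z by (simp add: normal_on_def)
  show "h z (A z a) b = G (f z) (V z) (\<sigma> z a b)" for a b by (rule A_inner[OF z])
qed

text \<open>By the dimension count the image of the tangent frame and the normal frame together form
  an orthonormal basis of the ambient space; the first part contributes nothing as \<open>n\<close>
  is normal.\<close>

lemma frame_parseval:
  assumes z: "z \<in> S" and B: "orthonormal_basis (h z) B" and I: "finite I" "card I + DIM('m) = DIM('q)"
    and E: "\<And>\<alpha> \<beta>. \<alpha> \<in> I \<Longrightarrow> \<beta> \<in> I \<Longrightarrow> G (f z) (E \<alpha>) (E \<beta>) = (if \<alpha> = \<beta> then 1 else 0)"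
      "\<And>\<alpha> u. \<alpha> \<in> I \<Longrightarrow> G (f z) (E \<alpha>) (dd f z u) = 0"
    and n: "\<And>u. G (f z) n (dd f z u) = 0"
  shows "G (f z) n n' = (\<Sum>\<alpha>\<in>I. G (f z) (E \<alpha>) n * G (f z) (E \<alpha>) n')"
proof -
  note sG = G_sym[OF f_in[OF z]]
  have Bf: "finite B" "card B = DIM('m)" and Bo: "\<And>u v. u \<in> B \<Longrightarrow> v \<in> B \<Longrightarrow> h z u v = (if u = v then 1 else 0)"
    using B by (auto simp: orthonormal_basis_def)
  have injX: "inj_on (\<lambda>u. dd f z u) B" using inj_df[OF z] by (rule inj_on_subset) simp
  have injE: "inj_on E I"
    by (rule inj_onI) (metis E(1) zero_neq_one)
  have E': "G (f z) (dd f z u) (E \<alpha>) = 0" if "\<alpha> \<in> I" for \<alpha> u using E(2)[OF that] sG by metis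
  have disj: "(\<lambda>u. dd f z u) ` B \<inter> E ` I = {}"
  proof (rule ccontr)
    assume "(\<lambda>u. dd f z u) ` B \<inter> E ` I \<noteq> {}"
    then obtain u \<alpha> where u: "u \<in> B" "\<alpha> \<in> I" "dd f z u = E \<alpha>" by auto
    then show False using E(2)[OF u(2), of u] E(1)[OF u(2,2)] by simp
  qed
  have C: "orthonormal_basis (G (f z)) ((\<lambda>u. dd f z u) ` B \<union> E ` I)"
    unfolding orthonormal_basis_def
  proof (intro conjI ballI)
    show "finite ((\<lambda>u. dd f z u) ` B \<union> E ` I)" using Bf I by simp
    show "card ((\<lambda>u. dd f z u) ` B \<union> E ` I) = DIM('q)"
      using card_Un_disjoint[OF _ _ disj] Bf I card_image[OF injX] card_image[OF injE] by simp
    fix a b assume "a \<in> (\<lambda>u. dd f z u) ` B \<union> E ` I" "b \<in> (\<lambda>u. dd f z u) ` B \<union> E ` I"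
    then show "G (f z) a b = (if a = b then 1 else 0)"
      using Bo E E' disj inj_onD[OF injX] inj_onD[OF injE]
      by (elim UnE imageE) (auto simp: induced_metric_def)
  qed
  have "G (f z) n n' = (\<Sum>e\<in>(\<lambda>u. dd f z u) ` B \<union> E ` I. G (f z) n e * G (f z) n' e)"
    by (rule orthonormal_parseval[OF inner_form_G[OF f_in[OF z]] C])
  also have "\<dots> = (\<Sum>e\<in>(\<lambda>u. dd f z u) ` B. G (f z) n e * G (f z) n' e) + (\<Sum>e\<in>E ` I. G (f z) n e * G (f z) n' e)"
    by (rule sum.union_disjoint) (use Bf I disj in auto)
  also have "(\<Sum>e\<in>(\<lambda>u. dd f z u) ` B. G (f z) n e * G (f z) n' e) = 0"
    by (rule sum.neutral) (auto simp: n)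
  also have "(\<Sum>e\<in>E ` I. G (f z) n e * G (f z) n' e) = (\<Sum>\<alpha>\<in>I. G (f z) (E \<alpha>) n * G (f z) (E \<alpha>) n')"
    by (simp add: sum.reindex[OF injE] sG[of n] sG[of n'])
  finally show ?thesis by simp
qed

theorem simons_space_form:
  assumes z: "z \<in> S" and const: "\<And>z. z \<in> S \<Longrightarrow> endo_trace (h z) (A z) = k"
    and I: "finite I" "card I + DIM('m) = DIM('q)" and E: "orthonormal_normal_frame_on G f S I E"
  defines "t \<equiv> tphi z" and "T \<equiv> tan_part G f z \<xi>" and "AV \<equiv> A z" and "tV \<equiv> tphi z (V z)"
    and "tr \<equiv> endo_trace (h z)" and "H \<equiv> mean_curvature G f z"
    and "A' \<equiv> (\<lambda>W. shape G f W z)"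
  shows "1/2 * laplacian h (\<lambda>z. endo_norm2 (h z) (A z)) z = cov_endo_norm2 h A z
    + c/4 * (DIM('m) * endo_norm2 (h z) AV - 2 * DIM('m) * h z (AV T) (AV T)
          + 6 * endo_norm2 (h z) (\<lambda>X. t (dd f z (AV X)))
          - h z T T * endo_norm2 (h z) AV + 3 * tr AV * h z (AV T) T
          + 6 * tr (\<lambda>X. AV (t (dd f z (A' nV X)))) + 3 * tr (\<lambda>X. AV (A' ntV X))
          - (tr AV)\<^sup>2 + 6 * tr (\<lambda>X. AV (t (dd f z (AV (t (dd f z X))))))
          + 3 * metric_trace (h z) (\<lambda>X Y. h z (t (\<sigma> z (AV X) tV)) Y)
          - 3 * metric_trace (h z) (\<lambda>X Y. h z (t (\<sigma> z (AV tV) X)) Y)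
          + DIM('m) * G (f z) (V z) (N z) * (tr (\<lambda>X. AV (A' N X)) - tr AV * G (f z) H (N z))
          + 3 * DIM('m) * h z (AV (t H)) tV)
      + (\<Sum>\<alpha>\<in>I. tr (\<lambda>X. AV (A' (E \<alpha>) (AV (A' (E \<alpha>) X))) - AV (AV (A' (E \<alpha>) (A' (E \<alpha>) X))))
          + tr (A' (E \<alpha>)) * tr (\<lambda>X. AV (AV (A' (E \<alpha>) X))) - (tr (\<lambda>X. AV (A' (E \<alpha>) X)))\<^sup>2)"
proof -
  obtain B where B: "orthonormal_basis (h z) B" using orthonormal_basis_exists[OF H.inner_form_G[OF z]] by blast
  interpret sa: simons_algebra "h z" B "G (f z)" "\<lambda>u. dd f z u" "\<phi> (f z)" \<xi> "V z" "tan_part G f z" "\<sigma> z"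
    "A z" "shape G f N z" "shape G f nV z" "shape G f ntV z" "Riem (f z)" c
    by (rule simons_algebra[OF z B])
  have tr_eq: "endo_trace (h z) L = (\<Sum>i\<in>B. h z (L i) i)" if "linear L" for L
    unfolding endo_trace_def
    by (rule metric_trace_eq[OF H.inner_form_G[OF z] B sa.bilinear_h[OF that linear_id[unfolded id_def]]])
  have norm_eq: "endo_norm2 (h z) L = (\<Sum>i\<in>B. h z (L i) (L i))" if "linear L" for L
    unfolding endo_norm2_def by (rule metric_trace_eq[OF H.inner_form_G[OF z] B sa.bilinear_h[OF that that]])
  have linE: "linear (shape G f (E \<alpha>) z)" and innerE: "h z (shape G f (E \<alpha>) z a) b = G (f z) (E \<alpha> z) (\<sigma> z a b)"
    if "\<alpha> \<in> I" for \<alpha> a b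
  proof -
    have "smooth_on S (E \<alpha>)" "normal_on G f S (E \<alpha>)" using E that by (auto simp: orthonormal_normal_frame_on_def)
    \<comment> \<open>\<open>shape\<close> differentiates the frame field, but by
      \<open>shape_inner\<close> only its value at \<open>z\<close> is left.\<close>
    then show *: "h z (shape G f (E \<alpha>) z a) b = G (f z) (E \<alpha> z) (\<sigma> z a b)" for a b
      using shape_inner[OF z smooth_on_differentiable[OF _ z]] by blast
    show "linear (shape G f (E \<alpha>) z)" by (rule sa.linear_form_op[OF *])
  qed
  have frame: "G (f z) (\<sigma> z a b) (\<sigma> z e d)
      = (\<Sum>\<alpha>\<in>I. G (f z) (E \<alpha> z) (\<sigma> z a b) * G (f z) (E \<alpha> z) (\<sigma> z e d))" for a b e d
    by (rule frame_parseval[OF z B I])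
      (use E z in \<open>auto simp: orthonormal_normal_frame_on_def normal_on_def second_ff_normal\<close>)
  have mB: "sa.m = DIM('m)" using B by (simp add: sa.m_def orthonormal_basis_def)
  have H: "DIM('m) *\<^sub>R H = (\<Sum>i\<in>B. \<sigma> z i i)"
    unfolding H_def mean_curvature_def
    by (simp add: metric_trace_eq[OF H.inner_form_G[OF z] B second_ff_bilinear[OF z]])
  \<comment> \<open>The tangential part of \<xi> is orthogonal to \<open>V\<close>, which identifies
    the coefficient \<theta> of the contraction with <V,N>.\<close>
  have VN: "G (f z) (V z) (N z) = G (f z) (V z) \<xi>"
    using normal_V z by (simp add: nor_part_def G_simps[OF f_in[OF z]] normal_on_def)
  have s9: "DIM('m) * G (f z) H (N z) = sa.s9"
  proof -
    have "DIM('m) * G (f z) H (N z) = G (f z) (\<Sum>i\<in>B. \<sigma> z i i) (N z)"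
      by (simp add: H[symmetric] G_simps[OF f_in[OF z]])
    also have "\<dots> = (\<Sum>i\<in>B. G (f z) (\<sigma> z i i) \<xi>)"
      by (simp add: nor_part_def G_simps[OF f_in[OF z]] second_ff_normal[OF z])
    finally show ?thesis by (simp add: sa.s9_def sa.vals)
  qed
  have s8: "DIM('m) * h z (AV (t H)) tV = sa.s8"
  proof -
    have "DIM('m) * h z (AV (t H)) tV = h z (AV (t (DIM('m) *\<^sub>R H))) tV"
      by (simp add: t_def AV_def linear_scale[OF sa.phi(1)] linear_scale[OF sa.linear_tan]
          linear_scale[OF sa.linear_ops(1)] sa.h_simps)
    then show ?thesis
      unfolding H by (simp add: t_def AV_def tV_def sa.s8_def linear_sum[OF sa.phi(1)] linear_sum[OF sa.linear_tan]
          linear_sum[OF sa.linear_ops(1)] sa.h_simps)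
  qed
  have m4: "metric_trace (h z) (\<lambda>X Y. h z (t (\<sigma> z (AV X) tV)) Y) = sa.s4"
    unfolding sa.s4_def t_def AV_def tV_def
    by (rule metric_trace_eq[OF H.inner_form_G[OF z] B], rule bilinearI')
      (simp_all add: sa.op_simps bilinear_simps[OF sa.bilinear_s] sa.h_simps)
  have m5: "metric_trace (h z) (\<lambda>X Y. h z (t (\<sigma> z (AV tV) X)) Y) = sa.s5"
    unfolding sa.s5_def t_def AV_def tV_def
    by (rule metric_trace_eq[OF H.inner_form_G[OF z] B], rule bilinearI')
      (simp_all add: bilinear_simps[OF sa.bilinear_s] sa.h_simps)
  note lc = sa.lin_comp sa.linear_ops
  have terms: "endo_norm2 (h z) AV = sa.n2" "endo_norm2 (h z) (\<lambda>X. t (dd f z (AV X))) = sa.s1"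
    "tr AV = sa.a1" "tr (\<lambda>X. AV (t (dd f z (A' nV X)))) = sa.s3" "tr (\<lambda>X. AV (A' ntV X)) = sa.s7"
    "tr (\<lambda>X. AV (t (dd f z (AV (t (dd f z X)))))) = sa.s2" "tr (\<lambda>X. AV (A' N X)) = sa.s6"
    unfolding tr_def AV_def t_def A'_def sa.n2_def sa.s1_def sa.a1_def sa.s3_def sa.s7_def sa.s2_def sa.s6_def
    by (rule norm_eq tr_eq, intro lc)+
  have nsum: "(\<Sum>\<alpha>\<in>I. tr (\<lambda>X. AV (A' (E \<alpha>) (AV (A' (E \<alpha>) X))) - AV (AV (A' (E \<alpha>) (A' (E \<alpha>) X))))
          + tr (A' (E \<alpha>)) * tr (\<lambda>X. AV (AV (A' (E \<alpha>) X))) - (tr (\<lambda>X. AV (A' (E \<alpha>) X)))\<^sup>2)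
    = (\<Sum>i\<in>B. \<Sum>j\<in>B. G (f z) (\<sigma> z j (A z i)) (\<sigma> z i (A z j)) - G (f z) (\<sigma> z i (A z i)) (\<sigma> z j (A z j))
         - G (f z) (\<sigma> z j i) (\<sigma> z i (A z (A z j))) + G (f z) (\<sigma> z i i) (\<sigma> z j (A z (A z j))))"
  proof (rule trans[OF _ sa.normal_sum[where I = I and \<nu> = "\<lambda>\<alpha>. E \<alpha> z" and A' = "\<lambda>\<alpha>. shape G f (E \<alpha>) z", OF frame innerE, symmetric]],
      rule sum.cong[OF refl])
    fix \<alpha> assume \<alpha>: "\<alpha> \<in> I"
    note l = linE[OF \<alpha>]
    have l': "linear F \<Longrightarrow> linear (\<lambda>X. shape G f (E \<alpha>) z (F X))" for F
      using linear_compose[OF _ l, of F] by (simp add: o_def)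
    show "tr (\<lambda>X. AV (A' (E \<alpha>) (AV (A' (E \<alpha>) X))) - AV (AV (A' (E \<alpha>) (A' (E \<alpha>) X))))
          + tr (A' (E \<alpha>)) * tr (\<lambda>X. AV (AV (A' (E \<alpha>) X))) - (tr (\<lambda>X. AV (A' (E \<alpha>) X)))\<^sup>2
      = (\<Sum>i\<in>B. h z (A z (shape G f (E \<alpha>) z (A z (shape G f (E \<alpha>) z i)))
            - A z (A z (shape G f (E \<alpha>) z (shape G f (E \<alpha>) z i)))) i)
        + (\<Sum>i\<in>B. h z (shape G f (E \<alpha>) z i) i) * (\<Sum>i\<in>B. h z (A z (A z (shape G f (E \<alpha>) z i))) i)
        - (\<Sum>i\<in>B. h z (A z (shape G f (E \<alpha>) z i)) i)\<^sup>2"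
      unfolding tr_def AV_def A'_def
      by (subst tr_eq, intro linear_compose_sub sa.lin_comp(1) l l')+ (rule refl)
  qed
  have RG: "gauss_Riem z u v w x = sa.RG u v w x" and dR: "dcod z x u v w = sa.dR x u v w" for u v w x
    by (simp_all add: gauss_Riem_def sa.RG_def dcod_def sa.dR_def)
  show ?thesis
    unfolding nsum terms m4 m5 VN
    using simons_formula[OF z B const]
    unfolding RG dR sa.simons_sum mB s8[symmetric] s9[symmetric]
    by (simp add: T_def AV_def algebra_simps)
qed

end

section \<open>The theorem in charts\<close>

context riemannian
begin

text \<open>The metric of the first factor is the product metric minus
  \<open>\<eta> \<otimes> \<eta>\<close>. Substituting this in the two purely metric terms yields
  the four terms with \<eta>; those of fourth order in \<eta> cancel.\<close>

lemma Riem_product: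
  assumes J: "smooth_endo J" "\<And>z u v. z \<in> \<Omega> \<Longrightarrow> cov_endo G J z u v = 0"
    "\<And>z u. z \<in> \<Omega> \<Longrightarrow> J z (J z u) = - u" "\<And>z u v. z \<in> \<Omega> \<Longrightarrow> G z (J z u) (J z v) = G z u v"
    and hol: "\<And>z u. z \<in> \<Omega> \<Longrightarrow> u \<noteq> 0 \<Longrightarrow> sectional_curvature G z u (J z u) = c" and q: "q \<in> prod_dom"
  shows "riemannian.Riem PG q u v w y = space_form_tensor c (PG q) (product_phi J q) (0, 1) u v w y"
proof -
  from q have fq: "fst q \<in> \<Omega>" by (auto simp: prod_dom_def)
  interpret P: riemannian prod_dom PG by (rule riemannian_product)
  have "P.Riem q u v w y = Riem (fst q) (fst u) (fst v) (fst w) (fst y)"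
    by (simp add: P.Riem_def Riem_def riem_product[OF q] product_metric_def)
  also have "\<dots> = c / 4 * (G (fst q) (fst v) (fst w) * G (fst q) (fst u) (fst y)
     - G (fst q) (fst u) (fst w) * G (fst q) (fst v) (fst y)
     + G (fst q) (fst u) (J (fst q) (fst w)) * G (fst q) (J (fst q) (fst v)) (fst y)
     - G (fst q) (fst v) (J (fst q) (fst w)) * G (fst q) (J (fst q) (fst u)) (fst y)
     + 2 * G (fst q) (fst u) (J (fst q) (fst v)) * G (fst q) (J (fst q) (fst w)) (fst y))"
    by (rule Riem_complex_space_form[OF J(1,2) J(3)[OF fq] J(4)[OF fq] hol[OF fq] fq])
  finally show ?thesis
    by (simp add: space_form_tensor_def product_metric_def product_phi_def G_simps[OF fq] algebra_simps)
qed

end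

lemma chart_inv_in: "x \<in> chart_img c \<Longrightarrow> chart_inv c x \<in> chart_dom c"
  unfolding chart_inv_def by (rule inv_into_into)

lemma complex_space_form_chart:
  assumes "complex_space_form n c \<A> g J" and a: "a \<in> \<A>"
  shows "riemannian (chart_img a) (local_metric g a)"
    and "riemannian.smooth_endo (chart_img a) (local_endo J a)"
    and "x \<in> chart_img a \<Longrightarrow> cov_endo (local_metric g a) (local_endo J a) x u v = 0"
    and "x \<in> chart_img a \<Longrightarrow> local_endo J a x (local_endo J a x u) = - u"
    and "x \<in> chart_img a \<Longrightarrow>
      local_metric g a x (local_endo J a x u) (local_endo J a x v) = local_metric g a x u v"
    and "x \<in> chart_img a \<Longrightarrow> u \<noteq> 0 \<Longrightarrow>
      sectional_curvature (local_metric g a) x u (local_endo J a x u) = c"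
proof -
  have K: "kaehler_manifold \<A> g J" using assms(1) by (simp add: complex_space_form_def)
  show R: "riemannian (chart_img a) (local_metric g a)"
    using K a by unfold_locales (auto simp: kaehler_manifold_def smooth_manifold_def riemannian_metric_def)
  show "riemannian.smooth_endo (chart_img a) (local_endo J a)"
    unfolding riemannian.smooth_endo_def[OF R]
    using K a chart_inv_in[of _ a] by (auto simp: kaehler_manifold_def almost_complex_structure_def local_endo_def)
  show "x \<in> chart_img a \<Longrightarrow> cov_endo (local_metric g a) (local_endo J a) x u v = 0"
    using K a by (auto simp: kaehler_manifold_def)
  show "x \<in> chart_img a \<Longrightarrow> local_endo J a x (local_endo J a x u) = - u"
    using K a chart_inv_in[of x a] by (auto simp: kaehler_manifold_def almost_complex_structure_def local_endo_def)
  show "x \<in> chart_img a \<Longrightarrow>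
      local_metric g a x (local_endo J a x u) (local_endo J a x v) = local_metric g a x u v"
    using K a chart_inv_in[of x a] by (auto simp: kaehler_manifold_def local_endo_def local_metric_def)
  show "x \<in> chart_img a \<Longrightarrow> u \<noteq> 0 \<Longrightarrow>
      sectional_curvature (local_metric g a) x u (local_endo J a x u) = c"
    using assms by (auto simp: complex_space_form_def)
qed

lemma local_map_in:
  assumes "smooth_manifold \<B>" "b \<in> \<B>" "y \<in> overlap a b F"
  shows "local_map a b F y \<in> chart_img a \<times> UNIV"
proof -
  obtain p where p: "p \<in> chart_dom b" "fst (F p) \<in> chart_dom a" "y = chart_map b p"
    using assms(3) by (auto simp: overlap_def)
  have "chart_inv b y = p"
    using assms(1,2) p unfolding smooth_manifold_def by (metis homeomorphism_apply1)
  then show ?thesis using p(2) by (simp add: local_map_def)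
qed

theorem theorem7p1:
  fixes \<A> :: "('a::{t2_space,second_countable_topology}, 'v::euclidean_space) chart set"
    and g :: "('a, 'v) chart \<Rightarrow> 'a \<Rightarrow> 'v \<Rightarrow> 'v \<Rightarrow> real"
    and J :: "('a, 'v) chart \<Rightarrow> 'a \<Rightarrow> 'v \<Rightarrow> 'v"
    and \<B> :: "('s::{t2_space,second_countable_topology}, 'm::euclidean_space) chart set"
    and F :: "'s \<Rightarrow> 'a \<times> real"
    and V :: "('a, 'v) chart \<Rightarrow> 's \<Rightarrow> 'v \<times> real"
    and c :: real and n m :: nat
    and a :: "('a, 'v) chart" and b :: "('s, 'm) chart" and p :: 's
    and U :: "'m set" and E :: "nat \<Rightarrow> 'm \<Rightarrow> 'v \<times> real"
  assumes "complex_space_form n c \<A> g J"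
    and "immersed_submanifold \<A> \<B> F" and "DIM('m) = m" and "m \<le> 2 * n"
    and "normal_field \<A> g \<B> F V"
    and "parallel_in_normal_bundle \<A> g \<B> F V"
    and "constant_trace_shape \<A> g \<B> F V"
    and "a \<in> \<A>" and "b \<in> \<B>" and "p \<in> chart_dom b" and "fst (F p) \<in> chart_dom a"
    and "open U" and "chart_map b p \<in> U" and "U \<subseteq> overlap a b F"
    and "orthonormal_normal_frame_on (product_metric (local_metric g a)) (local_map a b F) U
           {m+1..2*n+1} E"
  shows "let
      G = product_metric (local_metric g a);
      \<phi> = product_phi (local_endo J a);
      f = local_map a b F;
      y = chart_map b p;
      h = induced_metric G f;
      V' = local_field a b V;
      T = tan_part G f y (0, 1);
      N = (\<lambda>z. nor_part G f z (0, 1));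
      t = (\<lambda>z W. tan_part G f z (\<phi> (f z) W));
      nu = (\<lambda>z W. nor_part G f z (\<phi> (f z) W));
      tX = (\<lambda>X. t y (dd f y X));
      tV = (\<lambda>z. t z (V' z));
      nV = (\<lambda>z. nu z (V' z));
      ntV = (\<lambda>z. nu z (dd f z (tV z)));
      A = (\<lambda>W. shape G f W y);
      AV = A V';
      \<sigma> = second_ff G f y;
      H = mean_curvature G f y;
      tr = endo_trace (h y)
    in
      1/2 * laplacian h (\<lambda>z. endo_norm2 (h z) (shape G f V' z)) y =
      cov_endo_norm2 h (shape G f V') y
      + c/4 * (m * endo_norm2 (h y) AV - 2 * m * h y (AV T) (AV T)
          + 6 * endo_norm2 (h y) (\<lambda>X. t y (dd f y (AV X)))
          - h y T T * endo_norm2 (h y) AV + 3 * tr AV * h y (AV T) T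
          + 6 * tr (\<lambda>X. AV (t y (dd f y (A nV X)))) + 3 * tr (\<lambda>X. AV (A ntV X))
          - (tr AV)\<^sup>2 + 6 * tr (\<lambda>X. AV (tX (AV (tX X))))
          + 3 * metric_trace (h y) (\<lambda>X Y. h y (t y (\<sigma> (AV X) (tV y))) Y)
          - 3 * metric_trace (h y) (\<lambda>X Y. h y (t y (\<sigma> (AV (tV y)) X)) Y)
          + m * G (f y) (V' y) (N y) * (tr (\<lambda>X. AV (A N X)) - tr AV * G (f y) H (N y))
          + 3 * m * h y (AV (t y H)) (tV y))
      + (\<Sum>\<alpha>=m+1..2*n+1.
          tr (\<lambda>X. AV (A (E \<alpha>) (AV (A (E \<alpha>) X))) - AV (AV (A (E \<alpha>) (A (E \<alpha>) X))))
          + tr (A (E \<alpha>)) * tr (\<lambda>X. AV (AV (A (E \<alpha>) X)))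
          - (tr (\<lambda>X. AV (A (E \<alpha>) X)))\<^sup>2)"
proof -
  let ?G = "product_metric (local_metric g a)" and ?f = "local_map a b F" and ?V = "local_field a b V"
  let ?\<Omega> = "chart_img a \<times> (UNIV :: real set)" and ?\<phi> = "product_phi (local_endo J a)"
  note csf = complex_space_form_chart[OF assms(1,8)]
  interpret R: riemannian "chart_img a" "local_metric g a" by (rule csf(1))
  have dom: "R.prod_dom = ?\<Omega>" by (simp add: R.prod_dom_def)
  interpret P: riemannian ?\<Omega> ?G using R.riemannian_product by (simp add: dom)
  have imm: "smooth_manifold \<B>" "smooth_on (overlap a b F) ?f"
    "\<And>y. y \<in> overlap a b F \<Longrightarrow> inj (frechet_derivative ?f (at y))"
    using assms(2,8,9) by (auto simp: immersed_submanifold_def)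
  have nf: "smooth_on (overlap a b F) ?V" "normal_on ?G ?f (overlap a b F) ?V"
    using assms(5,8,9) by (auto simp: normal_field_def)
  \<comment> \<open>The coordinate domain is shrunk to \<open>U\<close>, where the normal frame is
    given, and \<xi> is the constant vector \<open>(0, 1)\<close>.\<close>
  interpret space_form_immersion ?\<Omega> ?G U ?f ?V ?\<phi> "(0, 1)" c
  proof (unfold_locales)
    show "open U" by (rule assms(12))
    show "smooth_on U ?f" by (rule smooth_on_mono[OF imm(2) assms(14)])
    show "?f ` U \<subseteq> ?\<Omega>" using local_map_in[OF imm(1) assms(9)] assms(14) by blast
    show "inj (frechet_derivative ?f (at z))" if "z \<in> U" for z using imm(3) that assms(14) by blast
    show "smooth_on U ?V" by (rule smooth_on_mono[OF nf(1) assms(14)])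
    show "normal_on ?G ?f U ?V" using nf(2) assms(14) by (auto simp: normal_on_def)
    show "normal_conn ?G ?f ?V z u = 0" if "z \<in> U" for z u
      using assms(6,8,9,14) that by (auto simp: parallel_in_normal_bundle_def)
    show "P.smooth_endo ?\<phi>"
      unfolding P.smooth_endo_def
    proof (intro conjI ballI allI)
      show "linear (?\<phi> q)" if "q \<in> ?\<Omega>" for q
        using R.endo_linear[OF csf(2), of "fst q"] that
        by (intro linearI) (auto simp: product_phi_def linear_add linear_scale)
      show "smooth_on ?\<Omega> (\<lambda>q. ?\<phi> q w)" for w
        unfolding product_phi_def
        by (intro smooth_on_Pair smooth_on_const P.open_Omega R.smooth_on_fst[unfolded dom] R.endo_smooth[OF csf(2)])
    qed
    show "cov_endo ?G ?\<phi> q u v = 0" if "q \<in> ?\<Omega>" for q u v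
      using R.cov_endo_product_phi[OF csf(2), unfolded dom, OF that] csf(3)[of "fst q"] that
      by (auto simp: zero_prod_def)
    show "?G q (?\<phi> q u) v = - ?G q u (?\<phi> q v)" if "q \<in> ?\<Omega>" for q u v
    proof -
      have q: "fst q \<in> chart_img a" using that by auto
      have "local_metric g a (fst q) (local_endo J a (fst q) (fst u)) (fst v)
          = - local_metric g a (fst q) (fst u) (local_endo J a (fst q) (fst v))"
        using csf(5)[OF q, of "fst u" "local_endo J a (fst q) (fst v)"]
        by (simp add: csf(4)[OF q] R.G_simps[OF q])
      then show ?thesis by (simp add: product_metric_def product_phi_def)
    qed
    show "christoffel ?G q u (0, 1) = 0" if "q \<in> ?\<Omega>" for q u
    proof -
      have q: "fst q \<in> chart_img a" using that by auto
      show ?thesis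
        using R.christoffel_product[unfolded dom, OF that, of u "(0, 1)"]
        by (simp add: R.chr_simps[OF q] zero_prod_def)
    qed
    show "P.Riem q u v w y = space_form_tensor c (?G q) (?\<phi> q) (0, 1) u v w y"
      if "q \<in> ?\<Omega>" for q u v w y
      by (rule R.Riem_product[OF csf(2-6), unfolded dom, OF _ _ _ _ _ that])
  qed
  obtain k where k: "\<And>z. z \<in> U \<Longrightarrow> endo_trace (h z) (A z) = k"
    using assms(7,8,9,14) unfolding constant_trace_shape_def by blast
  have "DIM('v) = 2 * n" using assms(1) by (simp add: complex_space_form_def)
  \<comment> \<open>The 2n + 1 - m normal vectors and the m tangent directions add up to the
    dimension 2n + 1 of the product, so the normal frame is complete.\<close>
  then have card: "card {m+1..2*n+1} + DIM('m) = DIM('v \<times> real)" using assms(3,4) by simp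
  show ?thesis
    using simons_space_form[OF assms(13) k finite_atLeastAtMost card assms(15)]
    unfolding Let_def assms(3) by simp
qed

end
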